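(* Let $\Omega$ be an open bounded polygonal domain of $\mathbb{R}^2$. Let $p,s,m$ be real numbers such that either $1\le p<2$ and $1\le s\le m\le p^*=\frac{2p}{2-p}$, or $p\ge 2$ and $1\le s\le m<+\infty$. Let $$\theta=\frac{\frac1s-\frac1m}{\frac1s+\frac12-\frac1p}.$$ Then there exists a constant $C>0$ depending only on $p$, $s$, $m$ and $\Omega$ such that, for every DDFV mesh $\mathcal{T}=(\overline{\mathfrak{M}},\overline{\mathfrak{M}^*},\mathfrak{D})$ of $\Omega$ satisfying the regularity conditions (R1) with parameter $\alpha_{\mathcal{T}}$ and (R2) with parameter $\zeta$ (defined in the context), $$\|u\|_{0,m,\mathcal{T}}\le \frac{C}{(\sin\alpha_{\mathcal{T}})^{\theta/p}\,\zeta^{\theta(p-1)/p}}\,\|u\|_{1,p,\mathcal{T}}^{\theta}\,\|u\|_{0,s,\mathcal{T}}^{1-\theta}\qquad\text{for all }u\in Z(\mathcal{T}).$$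
   Context: Standing assumption: $\Omega$ is a Lipschitz domain. $\mathrm{m}(\cdot)$ denotes area (2D Lebesgue measure) or length. DDFV mesh. The interior primal mesh $\mathfrak{M}$ is a finite partition of $\Omega$ (up to a null set) into disjoint open polygonal control volumes $\mathcal{K}$, each with a center $x_{\mathcal{K}}\in\mathcal{K}$. $\partial\mathfrak{M}$ is the set of boundary edges, considered as degenerate control volumes, each with a center $x_{\mathcal{K}}$ on the edge. The primal mesh is $\overline{\mathfrak{M}}=\mathfrak{M}\cup\partial\mathfrak{M}$. The dual mesh $\overline{\mathfrak{M}^*}$ is obtained by connecting the centers of the primal mesh: to each vertex $x_{\mathcal{K}^*}$ of the primal mesh is associated the polygonal dual cell $\mathcal{K}^*$ around it whose vertices are the centers $x_{\mathcal{K}}$ of the $\mathcal{K}\in\overline{\mathfrak{M}}$ having $x_{\mathcal{K}^*}$ as a vertex (together with $x_{\mathcal{K}^*}$ itself when $x_{\mathcal{K}^*}\in\partial\Omega$). $\mathfrak{M}^*$ (resp. $\partial\mathfrak{M}^*$) is the set of dual cells whose vertex $x_{\mathcal{K}^*}$ is interior to $\Omega$ (resp. on $\partial\Omega$), and $\overline{\mathfrak{M}^*}=\mathfrak{M}^*\cup\partial\mathfrak{M}^*$ is also a partition of $\Omega$. Each primal cell $\mathcal{K}\in\mathfrak{M}$ is assumed star-shaped with respect to $x_{\mathcal{K}}$ and each dual cell $\mathcal{K}^*$ star-shaped with respect to $x_{\mathcal{K}^*}$. To each primal edge $\sigma=\mathcal{K}|\mathcal{L}$ (with endpoints $x_{\mathcal{K}^*},x_{\mathcal{L}^*}$;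 if $\sigma\subset\partial\Omega$, $\mathcal{L}\in\partial\mathfrak{M}$ is the degenerate volume $\sigma$) corresponds the dual edge $\sigma^*=\mathcal{K}^*|\mathcal{L}^*$, the segment joining $x_{\mathcal{K}}$ and $x_{\mathcal{L}}$. The diamond $\mathcal{D}=\mathcal{D}_{\sigma,\sigma^*}$ is the quadrilateral with diagonals $\sigma$ and $\sigma^*$, i.e. with vertices $x_{\mathcal{K}},x_{\mathcal{K}^*},x_{\mathcal{L}},x_{\mathcal{L}^*}$ (degenerating into a triangle if $\sigma\subset\partial\Omega$). The set $\mathfrak{D}$ of diamonds is a partition of $\Omega$. For $V$ a primal or dual cell, $\mathfrak{D}_V$ is the set of diamonds $\mathcal{D}_{\sigma,\sigma^*}$ such that $\sigma$ (if $V$ is primal) or $\sigma^*$ (if $V$ is dual) is an edge of $V$. $\alpha_{\mathcal{D}}$ is the angle between the lines $(x_{\mathcal{K}},x_{\mathcal{L}})$ and $(x_{\mathcal{K}^*},x_{\mathcal{L}^*})$, so $2\mathrm{m}(\mathcal{D})=\mathrm{m}(\sigma)\mathrm{m}(\sigma^* )\sin\alpha_{\mathcal{D}}$. Regularity conditions. (R1): $\alpha_{\mathcal{T}}\in(0,\pi/2]$ and $|\sin\alpha_{\mathcal{D}}|\ge\sin\alpha_{\mathcal{T}}$ for all $\mathcal{D}\in\mathfrak{D}$. (R2): $\zeta>0$, $\sum_{\mathcal{D}_{\sigma,\sigma^*}\in\mathfrak{D}_{\mathcal{K}}}\mathrm{m}(\sigma)\mathrm{m}(\sigma^* )\le \mathrm{m}(\mathcal{K})/\zeta$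 for all $\mathcal{K}\in\mathfrak{M}$, and $\sum_{\mathcal{D}_{\sigma,\sigma^*}\in\mathfrak{D}_{\mathcal{K}^*}}\mathrm{m}(\sigma)\mathrm{m}(\sigma^* )\le \mathrm{m}(\mathcal{K}^* )/\zeta$ for all $\mathcal{K}^*\in\overline{\mathfrak{M}^*}$. Discrete functions. $Z(\mathcal{T})$ is the set of functions $u=\frac12(u_{\mathfrak{M}}+u_{\overline{\mathfrak{M}^*}})$ with $u_{\mathfrak{M}}=\sum_{\mathcal{K}\in\mathfrak{M}}u_{\mathcal{K}}\mathbf{1}_{\mathcal{K}}$ and $u_{\overline{\mathfrak{M}^*}}=\sum_{\mathcal{K}^*\in\overline{\mathfrak{M}^*}}u_{\mathcal{K}^*}\mathbf{1}_{\mathcal{K}^*}$, where $u_{\mathcal{T}}=((u_{\mathcal{K}})_{\mathcal{K}\in\overline{\mathfrak{M}}},(u_{\mathcal{K}^*})_{\mathcal{K}^*\in\overline{\mathfrak{M}^*}})$ are real discrete unknowns; $u$ is understood as given together with $u_{\mathcal{T}}$, and the quantities below are computed from $u_{\mathcal{T}}$. For $p\in[1,\infty)$, $$\|u\|_{0,p,\mathcal{T}}^p=\tfrac12\|u_{\mathfrak{M}}\|_{L^p(\Omega)}^p+\tfrac12\|u_{\overline{\mathfrak{M}^*}}\|_{L^p(\Omega)}^p.$$ For $\mathcal{D}=\mathcal{D}_{\sigma,\sigma^*}\in\mathfrak{D}$ the discrete gradient is $$\nabla^{\mathcal{D}}u=\frac{1}{\sin\alpha_{\mathcal{D}}}\Big(\frac{u_{\mathcal{L}}-u_{\mathcal{K}}}{\mathrm{m}(\sigma^*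 )}\mathbf{n}_{\sigma\mathcal{K}}+\frac{u_{\mathcal{L}^*}-u_{\mathcal{K}^*}}{\mathrm{m}(\sigma)}\mathbf{n}_{\sigma^*\mathcal{K}^*}\Big),$$ where $\mathbf{n}_{\sigma\mathcal{K}}$ is the unit normal to $\sigma$ outward $\mathcal{K}$ and $\mathbf{n}_{\sigma^*\mathcal{K}^*}$ the unit normal to $\sigma^*$ outward $\mathcal{K}^*$; equivalently, its component along the unit vector from $x_{\mathcal{K}}$ to $x_{\mathcal{L}}$ is $(u_{\mathcal{L}}-u_{\mathcal{K}})/\mathrm{m}(\sigma^* )$ and its component along the unit vector from $x_{\mathcal{K}^*}$ to $x_{\mathcal{L}^*}$ is $(u_{\mathcal{L}^*}-u_{\mathcal{K}^*})/\mathrm{m}(\sigma)$. Finally $$|u|_{1,p,\mathcal{T}}=\Big(\sum_{\mathcal{D}\in\mathfrak{D}}\mathrm{m}(\mathcal{D})|\nabla^{\mathcal{D}}u|^p\Big)^{1/p},\qquad \|u\|_{1,p,\mathcal{T}}=\|u\|_{0,p,\mathcal{T}}+|u|_{1,p,\mathcal{T}}.$$ *)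

theory Defs
  imports "HOL-Analysis.Analysis"
begin

type_synonym plane = "real ^ 2"

section \<open>Plane geometry\<close>

definition segment_union :: "plane set \<Rightarrow> bool" where
  "segment_union \<Gamma> \<longleftrightarrow>
     (\<exists>S :: (plane \<times> plane) set. finite S \<and> \<Gamma> = (\<Union>(a, b)\<in>S. closed_segment a b))"

text \<open>Polygonal domains need not be simply connected; Lipschitz domains are, locally at each
  boundary point and in suitable orthonormal coordinates, strict epigraphs of Lipschitz functions.\<close>

definition polygonal_domain :: "plane set \<Rightarrow> bool" where
  "polygonal_domain \<Omega> \<longleftrightarrow> open \<Omega> \<and> connected \<Omega> \<and> \<Omega> \<noteq> {} \<and> segment_union (frontier \<Omega>)"

definition lipschitz_domain :: "plane set \<Rightarrow> bool" where
  "lipschitz_domain \<Omega> \<longleftrightarrow> open \<Omega> \<and> connected \<Omega> \<and> \<Omega> \<noteq> {} \<and>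
     (\<forall>x\<in>frontier \<Omega>. \<exists>r>0. \<exists>(R :: plane \<Rightarrow> plane) (\<phi> :: real \<Rightarrow> real) L.
        orthogonal_transformation R \<and> L-lipschitz_on UNIV \<phi> \<and>
        \<Omega> \<inter> ball x r = {y \<in> ball x r. \<phi> (R y $ 1) < R y $ 2})"

definition polygonal_curve :: "plane set \<Rightarrow> bool" where
  "polygonal_curve \<Gamma> \<longleftrightarrow>
     (\<exists>g. simple_path g \<and> pathfinish g = pathstart g \<and> path_image g = \<Gamma>) \<and> segment_union \<Gamma>"

definition open_polygon :: "plane set \<Rightarrow> bool" where
  "open_polygon S \<longleftrightarrow> (\<exists>\<Gamma>. polygonal_curve \<Gamma> \<and> S = inside \<Gamma>)"

definition star_shaped_wrt :: "plane set \<Rightarrow> plane \<Rightarrow> bool" where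
  "star_shaped_wrt S a \<longleftrightarrow> a \<in> S \<and> (\<forall>x\<in>S. closed_segment a x \<subseteq> S)"

definition ae_partition :: "plane set \<Rightarrow> 'i set \<Rightarrow> ('i \<Rightarrow> plane set) \<Rightarrow> bool" where
  "ae_partition \<Omega> I S \<longleftrightarrow>
     finite I \<and> (\<forall>i\<in>I. S i \<subseteq> \<Omega>) \<and> disjoint_family_on S I \<and> negligible (\<Omega> - (\<Union>i\<in>I. S i))"

text \<open>The angle in \<open>[0, \<pi>/2]\<close> between two lines with direction vectors \<open>a\<close> and \<open>b\<close>.\<close>

definition line_angle :: "plane \<Rightarrow> plane \<Rightarrow> real" where
  "line_angle a b = arccos (\<bar>a \<bullet> b\<bar> / (norm a * norm b))"

text \<open>The unit normal to the side \<open>[a, b]\<close> of the polygon \<open>S\<close>, outward to \<open>S\<close>.\<close>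

definition outer_normal :: "plane set \<Rightarrow> plane \<Rightarrow> plane \<Rightarrow> plane" where
  "outer_normal S a b = (THE n. norm n = 1 \<and> n \<bullet> (b - a) = 0 \<and>
     (\<forall>y\<in>open_segment a b. \<forall>\<^sub>F t in at_right 0. y - t *\<^sub>R n \<in> S \<and> y + t *\<^sub>R n \<notin> S))"

section \<open>DDFV meshes\<close>

text \<open>A diamond carries the two primal volumes \<open>K\<close>, \<open>L\<close> and the two vertices \<open>x\<^sub>K\<^sub>*\<close>, \<open>x\<^sub>L\<^sub>*\<close> of
  its primal edge. This fixes one orientation of each edge; no quantity below that enters the
  norms depends on it. Dual cells are indexed by their vertices. If the edge
  lies on the boundary of the domain, \<open>L\<close> is the degenerate control volume, i.e. the edge itself.\<close>

record diamond =
  volK :: "plane set"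
  volL :: "plane set"
  vertK :: plane
  vertL :: plane

record ddfv_mesh =
  cells :: "plane set set"
  diamonds :: "diamond set"
  center :: "plane set \<Rightarrow> plane"

definition edge :: "diamond \<Rightarrow> plane set" where
  "edge D = closed_segment (vertK D) (vertL D)"

definition dual_edge :: "ddfv_mesh \<Rightarrow> diamond \<Rightarrow> plane set" where
  "dual_edge T D = closed_segment (center T (volK D)) (center T (volL D))"

definition edge_length :: "diamond \<Rightarrow> real" where
  "edge_length D = dist (vertK D) (vertL D)"

definition dual_edge_length :: "ddfv_mesh \<Rightarrow> diamond \<Rightarrow> real" where
  "dual_edge_length T D = dist (center T (volK D)) (center T (volL D))"

definition vertices :: "ddfv_mesh \<Rightarrow> plane set" where
  "vertices T = vertK ` diamonds T \<union> vertL ` diamonds T"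

definition diamonds_of_cell :: "ddfv_mesh \<Rightarrow> plane set \<Rightarrow> diamond set" where
  "diamonds_of_cell T K = {D \<in> diamonds T. K = volK D \<or> K = volL D}"

definition diamonds_of_vertex :: "ddfv_mesh \<Rightarrow> plane \<Rightarrow> diamond set" where
  "diamonds_of_vertex T v = {D \<in> diamonds T. v = vertK D \<or> v = vertL D}"

text \<open>The dual cell of \<open>v\<close> is the polygon bounded by the dual edges of the primal edges issuing
  from \<open>v\<close>. When \<open>v\<close> lies on the boundary of the domain, \<open>v\<close> itself is a further vertex, and the
  polygon is closed by joining \<open>v\<close> to the centers of the boundary edges issuing from \<open>v\<close>.\<close>

definition dual_boundary :: "ddfv_mesh \<Rightarrow> plane \<Rightarrow> plane set" where
  "dual_boundary T v =
     (\<Union>D\<in>diamonds_of_vertex T v. dual_edge T D) \<union>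
     (\<Union>D\<in>{D \<in> diamonds_of_vertex T v. volL D = edge D}. closed_segment v (center T (volL D)))"

definition dual_cell :: "ddfv_mesh \<Rightarrow> plane \<Rightarrow> plane set" where
  "dual_cell T v = inside (dual_boundary T v)"

text \<open>The open quadrilateral with vertices \<open>x\<^sub>K\<close>, \<open>x\<^sub>K\<^sub>*\<close>, \<open>x\<^sub>L\<close>, \<open>x\<^sub>L\<^sub>*\<close>, as the union of the two
  triangles into which it is cut by its diagonal, the primal edge; the second triangle is flat for
  a boundary edge.\<close>

definition diamond_region :: "ddfv_mesh \<Rightarrow> diamond \<Rightarrow> plane set" where
  "diamond_region T D = interior
     (convex hull {center T (volK D), vertK D, vertL D} \<union>
      convex hull {center T (volL D), vertK D, vertL D})"

definition diamond_angle :: "ddfv_mesh \<Rightarrow> diamond \<Rightarrow> real" where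
  "diamond_angle T D =
     line_angle (center T (volL D) - center T (volK D)) (vertL D - vertK D)"

text \<open>Edges meet only at common endpoints; hanging nodes are allowed, as vertices of a cell
  at which the angle is flat. Star-shapedness of a dual cell is required of its closure because
  \<open>v\<close> lies on the boundary of its dual cell when it lies on the boundary of the domain.\<close>

definition is_ddfv_mesh :: "plane set \<Rightarrow> ddfv_mesh \<Rightarrow> bool" where
  "is_ddfv_mesh \<Omega> T \<longleftrightarrow>
     ae_partition \<Omega> (cells T) (\<lambda>K. K) \<and>
     (\<forall>K\<in>cells T. open_polygon K \<and> star_shaped_wrt K (center T K) \<and>
        frontier K = (\<Union>D\<in>diamonds_of_cell T K. edge D)) \<and>
     (\<forall>D\<in>diamonds T. vertK D \<noteq> vertL D \<and> volK D \<in> cells T \<and>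
        (volL D \<in> cells T \<and> volL D \<noteq> volK D \<or>
         volL D = edge D \<and> edge D \<subseteq> frontier \<Omega> \<and> center T (volL D) \<in> edge D)) \<and>
     (\<forall>D\<in>diamonds T. \<forall>D'\<in>diamonds T. D \<noteq> D' \<longrightarrow>
        edge D \<inter> edge D' \<subseteq> {vertK D, vertL D} \<inter> {vertK D', vertL D'}) \<and>
     (\<forall>v\<in>vertices T. polygonal_curve (dual_boundary T v) \<and>
        star_shaped_wrt (closure (dual_cell T v)) v \<and> (v \<in> \<Omega> \<longrightarrow> v \<in> dual_cell T v)) \<and>
     ae_partition \<Omega> (vertices T) (dual_cell T) \<and>
     ae_partition \<Omega> (diamonds T) (diamond_region T)"

definition regular_R1 :: "ddfv_mesh \<Rightarrow> real \<Rightarrow> bool" where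
  "regular_R1 T \<alpha> \<longleftrightarrow> 0 < \<alpha> \<and> \<alpha> \<le> pi / 2 \<and>
     (\<forall>D\<in>diamonds T. \<bar>sin (diamond_angle T D)\<bar> \<ge> sin \<alpha>)"

definition regular_R2 :: "ddfv_mesh \<Rightarrow> real \<Rightarrow> bool" where
  "regular_R2 T \<zeta> \<longleftrightarrow> \<zeta> > 0 \<and>
     (\<forall>K\<in>cells T. (\<Sum>D\<in>diamonds_of_cell T K. edge_length D * dual_edge_length T D)
        \<le> measure lebesgue K / \<zeta>) \<and>
     (\<forall>v\<in>vertices T. (\<Sum>D\<in>diamonds_of_vertex T v. edge_length D * dual_edge_length T D)
        \<le> measure lebesgue (dual_cell T v) / \<zeta>)"

section \<open>Discrete functions and norms\<close>

text \<open>The unknowns of a discrete function: \<open>fst u\<close> gives the values on the cells and boundary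
  edges of the primal mesh, \<open>snd u\<close> those on the dual cells. Values elsewhere are never used.\<close>

type_synonym ddfv_unknowns = "(plane set \<Rightarrow> real) \<times> (plane \<Rightarrow> real)"

definition primal_fun :: "ddfv_mesh \<Rightarrow> ddfv_unknowns \<Rightarrow> plane \<Rightarrow> real" where
  "primal_fun T u x = (\<Sum>K\<in>cells T. fst u K * indicator K x)"

definition dual_fun :: "ddfv_mesh \<Rightarrow> ddfv_unknowns \<Rightarrow> plane \<Rightarrow> real" where
  "dual_fun T u x = (\<Sum>v\<in>vertices T. snd u v * indicator (dual_cell T v) x)"

definition Lp_norm :: "plane set \<Rightarrow> real \<Rightarrow> (plane \<Rightarrow> real) \<Rightarrow> real" where
  "Lp_norm \<Omega> p f = (LINT x:\<Omega>|lebesgue. \<bar>f x\<bar> powr p) powr (1 / p)"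

definition norm0 :: "plane set \<Rightarrow> ddfv_mesh \<Rightarrow> real \<Rightarrow> ddfv_unknowns \<Rightarrow> real" where
  "norm0 \<Omega> T p u =
     (1/2 * Lp_norm \<Omega> p (primal_fun T u) powr p + 1/2 * Lp_norm \<Omega> p (dual_fun T u) powr p)
       powr (1 / p)"

definition discrete_grad :: "ddfv_mesh \<Rightarrow> ddfv_unknowns \<Rightarrow> diamond \<Rightarrow> plane" where
  "discrete_grad T u D = (1 / sin (diamond_angle T D)) *\<^sub>R
     (((fst u (volL D) - fst u (volK D)) / dual_edge_length T D) *\<^sub>R
        outer_normal (volK D) (vertK D) (vertL D) +
      ((snd u (vertL D) - snd u (vertK D)) / edge_length D) *\<^sub>R
        outer_normal (dual_cell T (vertK D)) (center T (volK D)) (center T (volL D)))"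

definition seminorm1 :: "ddfv_mesh \<Rightarrow> real \<Rightarrow> ddfv_unknowns \<Rightarrow> real" where
  "seminorm1 T p u =
     (\<Sum>D\<in>diamonds T. measure lebesgue (diamond_region T D) * norm (discrete_grad T u D) powr p)
       powr (1 / p)"

definition norm1 :: "plane set \<Rightarrow> ddfv_mesh \<Rightarrow> real \<Rightarrow> ddfv_unknowns \<Rightarrow> real" where
  "norm1 \<Omega> T p u = norm0 \<Omega> T p u + seminorm1 T p u"

end

theory Submission
  imports Defs
begin

text \<open>The estimate is a discrete Gagliardo-Nirenberg-Sobolev inequality. Its only analytic input is the
embedding of BV into \<open>L\<^sup>2\<close> on a bounded Lipschitz domain of the plane, and for functions that are
constant on the cells of a polygonal partition this embedding has a direct proof
(\<open>Sobolev_partition\<close>). By the cone condition, every point of the domain is the origin of two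
segments contained in the domain, with directions \<open>c1\<close>, \<open>c2\<close> taken from a finite list. Along
such a segment the function changes only where it crosses an edge, and then by the jump across
that edge (\<open>variation_on_line\<close>). Averaging over the segment bounds the value at the point by the
integral of the function over the whole line plus the jumps that the line meets, a
quantity (\<open>line_bound\<close>) that depends on the line only. In the coordinates \<open>s *\<^sub>R c1 + t *\<^sub>R c2\<close> one
bound depends on \<open>t\<close> alone and the other on \<open>s\<close> alone, so that the integral of their product is
the product of two integrals, and each of these is controlled by the \<open>L\<^sup>1\<close> norm plus the sum
of edge length times jump.

The embedding is applied to \<open>\<bar>u\<bar> powr r\<close>, on the primal and on the dual partition. Hoelder's
inequality separates the discrete gradient from the powers of \<open>u\<close> (\<open>power_estimate\<close>), and the
regularity of the mesh turns the result into
\<open>power_sum u (2 * r) powr (1/2) \<le> C * A * \<parallel>u\<parallel>\<^sub>1\<^sub>,\<^sub>p * power_sum u q powr (1 - 1/p)\<close> for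
\<open>q * (p - 1) = p * (r - 1)\<close> (\<open>power_sum_estimate\<close>), where \<open>power_sum u q\<close> is the \<open>q\<close>-th power of
the \<open>L\<^sup>q\<close> norm and \<open>A = (sin \<alpha>) powr (-1/p) * \<zeta> powr (1/p - 1)\<close>. The logarithm of \<open>power_sum u\<close> is a
convex function of the exponent; this absorbs the last factor on the right and yields the
norm with exponent \<open>m\<close> (\<open>interpolation_sum\<close>). For \<open>p < 2\<close> the choice \<open>2 * r = q = 2 * p / (2 - p)\<close>
gives the critical exponent; for \<open>p \<ge> 2\<close> any large \<open>r\<close> will do.

What remains is geometry. The discrete gradient is defined through outward unit normals, and
it bounds the difference quotients of \<open>u\<close> only if these normals exist
(\<open>outer_normal_polygon\<close>). Edges are given as segments lying on a Jordan curve, and the normal exists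
because a Jordan curve contains no three segments that meet in a common endpoint and nowhere
else: near an inner point of the edge, the curve is the edge. Star-shapedness of the cells puts the two
centers on opposite sides of the line through the edge, and hence gives the area of a diamond as
half the product of the lengths of its diagonals and the sine of their angle
(\<open>diamond_measure\<close>).\<close>

section \<open>Inequalities for weighted sums of powers\<close>

text \<open>Hoelder's inequality for \<open>x = A powr \<alpha>\<close> and \<open>y = B powr \<beta>\<close>, where \<open>1 / \<alpha>\<close> and \<open>1 / \<beta>\<close> are the
conjugate exponents. Since \<open>0 powr 0 = 0\<close>, it also holds at the endpoints \<open>\<alpha> = 0\<close> and \<open>\<beta> = 0\<close>: when the sum raised to the
power 0 vanishes, so do all the terms on the left. Hence the case \<open>p = 1\<close> needs no separate
treatment later on.\<close>

lemma Holder_sum: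
  fixes w A B :: "'i \<Rightarrow> real"
  assumes fin: "finite J" and nn: "\<And>j. j \<in> J \<Longrightarrow> 0 \<le> w j" "\<And>j. j \<in> J \<Longrightarrow> 0 \<le> A j" "\<And>j. j \<in> J \<Longrightarrow> 0 \<le> B j"
    and \<alpha>\<beta>: "0 \<le> \<alpha>" "0 \<le> \<beta>" "\<alpha> + \<beta> = 1"
  shows "(\<Sum>j\<in>J. w j * (A j powr \<alpha> * B j powr \<beta>))
    \<le> (\<Sum>j\<in>J. w j * A j) powr \<alpha> * (\<Sum>j\<in>J. w j * B j) powr \<beta>"
proof -
  define X where "X = (\<Sum>j\<in>J. w j * A j)"
  define Z where "Z = (\<Sum>j\<in>J. w j * B j)"
  have X0: "0 \<le> X" and Z0: "0 \<le> Z"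
    unfolding X_def Z_def using nn by (auto intro!: sum_nonneg)
  show ?thesis
  proof (cases "X = 0 \<or> Z = 0")
    case True
    have "w j * (A j powr \<alpha> * B j powr \<beta>) = 0" if j: "j \<in> J" for j
    proof -
      have "w j * A j = 0 \<or> w j * B j = 0"
        using True j nn fin unfolding X_def Z_def
        by (subst (asm) (1 2) sum_nonneg_eq_0_iff) auto
      then show ?thesis by auto
    qed
    then have "(\<Sum>j\<in>J. w j * (A j powr \<alpha> * B j powr \<beta>)) = 0" by (intro sum.neutral) blast
    then show ?thesis by simp
  next
    case False
    then have X: "0 < X" and Z: "0 < Z" using X0 Z0 by auto
    have term_le: "A j powr \<alpha> * B j powr \<beta> \<le> X powr \<alpha> * Z powr \<beta> * (\<alpha> * (A j / X) + \<beta> * (B j / Z))"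
      if j: "j \<in> J" for j
    proof (cases "A j = 0 \<or> B j = 0")
      case True
      have "0 \<le> \<alpha> * (A j / X) + \<beta> * (B j / Z)" using X Z nn j \<alpha>\<beta> by simp
      moreover have "0 \<le> X powr \<alpha> * Z powr \<beta>" by simp
      ultimately have "0 \<le> X powr \<alpha> * Z powr \<beta> * (\<alpha> * (A j / X) + \<beta> * (B j / Z))"
        by (rule mult_nonneg_nonneg[rotated])
      then show ?thesis using True by auto
    next
      case False
      then have pos: "0 < A j" "0 < B j" using nn[OF j] by auto
      have "(A j / X) powr \<alpha> * (B j / Z) powr \<beta> \<le> \<alpha> * (A j / X) + \<beta> * (B j / Z)"
        using pos X Z \<alpha>\<beta> by (intro Youngs_inequality_0) auto
      then have "X powr \<alpha> * Z powr \<beta> * ((A j / X) powr \<alpha> * (B j / Z) powr \<beta>)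
          \<le> X powr \<alpha> * Z powr \<beta> * (\<alpha> * (A j / X) + \<beta> * (B j / Z))"
        by (intro mult_left_mono) auto
      moreover have "X powr \<alpha> * Z powr \<beta> * ((A j / X) powr \<alpha> * (B j / Z) powr \<beta>) = A j powr \<alpha> * B j powr \<beta>"
        using pos X Z by (simp add: powr_divide)
      ultimately show ?thesis by simp
    qed
    have "(\<Sum>j\<in>J. w j * (A j powr \<alpha> * B j powr \<beta>))
        \<le> (\<Sum>j\<in>J. w j * (X powr \<alpha> * Z powr \<beta> * (\<alpha> * (A j / X) + \<beta> * (B j / Z))))"
      using term_le nn by (intro sum_mono mult_left_mono) auto
    also have "\<dots> = X powr \<alpha> * Z powr \<beta> * (\<alpha> * ((\<Sum>j\<in>J. w j * A j) / X) + \<beta> * ((\<Sum>j\<in>J. w j * B j) / Z))"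
      unfolding sum_divide_distrib sum_distrib_left sum.distrib[symmetric]
      by (intro sum.cong) (auto simp: algebra_simps)
    also have "\<dots> = X powr \<alpha> * Z powr \<beta>"
      using X Z \<alpha>\<beta> unfolding X_def[symmetric] Z_def[symmetric] by simp
    finally show ?thesis unfolding X_def Z_def .
  qed
qed

lemma abs_powr_diff_le:
  fixes a b r :: real
  assumes "0 \<le> a" "0 \<le> b" "1 \<le> r"
  shows "\<bar>a powr r - b powr r\<bar> \<le> r * \<bar>a - b\<bar> * (a powr (r - 1) + b powr (r - 1))"
proof -
  have *: "a powr r - b powr r \<le> r * (a - b) * a powr (r - 1)" if "0 \<le> b" "b \<le> a" for a b :: real
  proof (cases "b = 0 \<or> a = b")
    case True
    have "a powr r \<le> r * a * a powr (r - 1)" if "a > 0"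
    proof -
      have "a powr r = a * a powr (r - 1)" using that by (simp add: powr_diff)
      moreover have "1 * (a * a powr (r - 1)) \<le> r * (a * a powr (r - 1))"
        using \<open>1 \<le> r\<close> that by (intro mult_right_mono) auto
      ultimately show ?thesis by (simp add: mult.assoc)
    qed
    then show ?thesis using True \<open>b \<le> a\<close> \<open>0 \<le> b\<close> by (cases "a = 0") auto
  next
    case False
    then have "0 < b" "b < a" using that by auto
    have "\<exists>z. b < z \<and> z < a \<and> a powr r - b powr r = (a - b) * (r * z powr (r - 1))"
      using \<open>0 < b\<close> \<open>b < a\<close>
      by (intro MVT2) (auto intro!: derivative_eq_intros)
    then obtain z where z: "b < z" "z < a" "a powr r - b powr r = (a - b) * (r * z powr (r - 1))"
      by blast
    have "z powr (r - 1) \<le> a powr (r - 1)"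
      using z \<open>0 < b\<close> \<open>1 \<le> r\<close> by (intro powr_mono2) auto
    then have "(a - b) * (r * z powr (r - 1)) \<le> (a - b) * (r * a powr (r - 1))"
      using \<open>b < a\<close> \<open>1 \<le> r\<close> by (intro mult_left_mono) auto
    then show ?thesis using z by (simp add: mult_ac)
  qed
  show ?thesis
  proof (cases "b \<le> a")
    case True
    have "b powr r \<le> a powr r" using True assms by (intro powr_mono2) auto
    then have "\<bar>a powr r - b powr r\<bar> \<le> r * (a - b) * a powr (r - 1)" using *[of b a] True assms by simp
    also have "\<dots> \<le> r * (a - b) * (a powr (r - 1) + b powr (r - 1))"
      using True assms by (intro mult_left_mono) auto
    finally show ?thesis using True by simp
  next
    case False
    have "a powr r \<le> b powr r" using False assms by (intro powr_mono2) auto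
    then have "\<bar>a powr r - b powr r\<bar> \<le> r * (b - a) * b powr (r - 1)" using *[of a b] False assms by simp
    also have "\<dots> \<le> r * (b - a) * (a powr (r - 1) + b powr (r - 1))"
      using False assms by (intro mult_left_mono) auto
    finally show ?thesis using False by simp
  qed
qed

lemma Lyapunov_sum:
  fixes w a :: "'i \<Rightarrow> real"
  assumes "finite J" "\<And>j. j \<in> J \<Longrightarrow> 0 \<le> w j" "\<And>j. j \<in> J \<Longrightarrow> 0 \<le> a j"
    and "s < m" "s \<le> q" "q \<le> m"
  shows "(\<Sum>j\<in>J. w j * a j powr q)
    \<le> (\<Sum>j\<in>J. w j * a j powr s) powr ((m - q) / (m - s)) * (\<Sum>j\<in>J. w j * a j powr m) powr ((q - s) / (m - s))"
proof -
  have e: "s * ((m - q) / (m - s)) + m * ((q - s) / (m - s)) = q"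
  proof -
    have "s * ((m - q) / (m - s)) + m * ((q - s) / (m - s)) = q * (m - s) / (m - s)"
      by (simp add: add_divide_distrib[symmetric] algebra_simps)
    then show ?thesis using \<open>s < m\<close> by simp
  qed
  have "a j powr q = (a j powr s) powr ((m - q) / (m - s)) * (a j powr m) powr ((q - s) / (m - s))" for j
    by (simp only: powr_powr powr_add[symmetric] e)
  then have "(\<Sum>j\<in>J. w j * a j powr q) = (\<Sum>j\<in>J. w j * ((a j powr s) powr ((m - q) / (m - s)) * (a j powr m) powr ((q - s) / (m - s))))"
    by simp
  also have "\<dots> \<le> (\<Sum>j\<in>J. w j * a j powr s) powr ((m - q) / (m - s)) * (\<Sum>j\<in>J. w j * a j powr m) powr ((q - s) / (m - s))"
    using assms by (intro Holder_sum) (auto simp: add_divide_distrib[symmetric])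
  finally show ?thesis .
qed

text \<open>The inequality assumed for \<open>F (2 * r)\<close> has \<open>F q\<close> on its right, with \<open>s \<le> q \<le> 2 * r\<close>. Convexity of
\<open>ln F\<close> bounds \<open>F q\<close> by \<open>F s\<close> and \<open>F (2 * r)\<close>; the power of \<open>F (2 * r)\<close> that this produces is smaller than
the one on the left exactly when \<open>1 / s + 1 / 2 - 1 / p\<close> is positive, and it can then be moved
there. A second use of convexity passes from \<open>2 * r\<close> to \<open>m\<close>. The value of \<open>\<theta>\<close> is
dictated by homogeneity. After taking logarithms everything is linear.\<close>

lemma interpolation_sum:
  fixes w a :: "'i \<Rightarrow> real" and J :: "'i set" and p q r s m B \<theta> :: real
  defines "F \<equiv> \<lambda>q. \<Sum>j\<in>J. w j * a j powr q"
  assumes J: "finite J" "\<And>j. j \<in> J \<Longrightarrow> 0 \<le> w j" "\<And>j. j \<in> J \<Longrightarrow> 0 \<le> a j"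
    and p: "1 \<le> p" and sm: "1 \<le> s" "s < m" "m \<le> 2 * r" and q: "s \<le> q" "q \<le> 2 * r"
    and qp: "q * (p - 1) = p * (r - 1)"
    and ineq: "F (2 * r) powr (1 / 2) \<le> B * F q powr (1 - 1 / p)" and "0 \<le> B"
    and \<delta>: "0 < 1 / s + 1 / 2 - 1 / p" and \<theta>: "\<theta> = (1 / s - 1 / m) / (1 / s + 1 / 2 - 1 / p)"
  shows "F m powr (1 / m) \<le> B powr \<theta> * (F s powr (1 / s)) powr (1 - \<theta>)"
proof (cases "F m = 0")
  case True
  then show ?thesis by simp
next
  case False
  then obtain j where j: "j \<in> J" "w j * a j powr m \<noteq> 0"
    unfolding F_def by (meson sum.neutral)
  have wa: "0 < w j" "0 < a j" using j J(2)[of j] J(3)[of j] by (auto simp: less_le)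
  have Fpos: "0 < F t" for t
  proof -
    have "0 < w j * a j powr t" using wa by simp
    also have "\<dots> \<le> F t" unfolding F_def using J j by (intro member_le_sum) auto
    finally show ?thesis .
  qed
  have Fne: "F t \<noteq> 0" for t using Fpos[of t] by simp
  have B: "0 < B"
  proof (rule ccontr)
    assume "\<not> 0 < B"
    then have "B = 0" using \<open>0 \<le> B\<close> by simp
    then show False using ineq Fpos[of "2 * r"] by (simp add: not_le)
  qed
  define f where "f t = ln (F t)" for t
  define b where "b = ln B"
  have sr: "s < 2 * r" using sm by simp
  have lyap: "(2 * r - s) * f t \<le> (2 * r - t) * f s + (t - s) * f (2 * r)" if "s \<le> t" "t \<le> 2 * r" for t
  proof -
    have "F t \<le> F s powr ((2 * r - t) / (2 * r - s)) * F (2 * r) powr ((t - s) / (2 * r - s))"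
      unfolding F_def using J sr that by (intro Lyapunov_sum) auto
    then have "ln (F t) \<le> ln (F s powr ((2 * r - t) / (2 * r - s)) * F (2 * r) powr ((t - s) / (2 * r - s)))"
      using Fpos Fne by (subst ln_le_cancel_iff) (auto intro!: mult_pos_pos)
    then have "f t \<le> (2 * r - t) / (2 * r - s) * f s + (t - s) / (2 * r - s) * f (2 * r)"
      using Fpos[of s] Fpos[of "2 * r"] by (simp add: f_def ln_mult ln_powr)
    then have "(2 * r - s) * f t \<le> (2 * r - s) * ((2 * r - t) / (2 * r - s) * f s + (t - s) / (2 * r - s) * f (2 * r))"
      using sr by (intro mult_left_mono) auto
    then show ?thesis using sr by (simp add: distrib_left)
  qed
  have "ln (F (2 * r) powr (1 / 2)) \<le> ln (B * F q powr (1 - 1 / p))"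
    using Fpos[of q] Fpos[of "2 * r"] B ineq by (subst ln_le_cancel_iff) auto
  then have "f (2 * r) / 2 \<le> b + (1 - 1 / p) * f q"
    using Fpos[of q] Fpos[of "2 * r"] B by (simp add: f_def b_def ln_mult ln_powr)
  then have main: "p * f (2 * r) \<le> 2 * p * b + 2 * (p - 1) * f q"
    using p by (simp add: field_simps)
  define d where "d = 2 * p + p * s - 2 * s"
  have d: "0 < d" "1 / s + 1 / 2 - 1 / p = d / (2 * s * p)"
    using \<delta> p sm by (simp_all add: d_def field_simps)
  have \<theta>': "\<theta> * (m * d) = 2 * p * (m - s)"
    using d(1) p sm unfolding \<theta> d(2) by (simp add: field_simps)
  have "(2 * r - s) * (p * f (2 * r)) \<le> (2 * r - s) * (2 * p * b) + 2 * (p - 1) * ((2 * r - s) * f q)"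
    using mult_left_mono[OF main, of "2 * r - s"] sr by (simp add: algebra_simps)
  also have "\<dots> \<le> (2 * r - s) * (2 * p * b) + 2 * (p - 1) * ((2 * r - q) * f s + (q - s) * f (2 * r))"
    using p lyap[OF q] by (intro add_left_mono mult_left_mono) auto
  also have "\<dots> = (2 * r - s) * (2 * p * b) + 2 * (2 * r * (p - 1) - q * (p - 1)) * f s
       + 2 * (q * (p - 1) - s * (p - 1)) * f (2 * r)"
    by (simp add: algebra_simps)
  also have "\<dots> = (2 * r - s) * (2 * p * b) + 2 * (2 * r * (p - 1) - p * (r - 1)) * f s
       + 2 * (p * (r - 1) - s * (p - 1)) * f (2 * r)"
    unfolding qp ..
  finally have "d * f (2 * r) \<le> (2 * r - s) * (2 * p * b) + 2 * (r * p - 2 * r + p) * f s"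
    by (simp add: algebra_simps d_def)
  then have "(m - s) * (d * f (2 * r)) \<le> (m - s) * ((2 * r - s) * (2 * p * b) + 2 * (r * p - 2 * r + p) * f s)"
    using sm by (intro mult_left_mono) auto
  moreover have "d * ((2 * r - s) * f m) \<le> d * ((2 * r - m) * f s + (m - s) * f (2 * r))"
    using d lyap[of m] sm by (intro mult_left_mono) auto
  ultimately have "(2 * r - s) * (d * f m)
      \<le> (2 * r - s) * (2 * p * (m - s) * b) + (d * (2 * r - m) + (m - s) * (2 * (r * p - 2 * r + p))) * f s"
    by (simp add: algebra_simps)
  also have "d * (2 * r - m) + (m - s) * (2 * (r * p - 2 * r + p)) = (2 * r - s) * (m * (p - 2) + 2 * p)"
    by (simp add: algebra_simps d_def)
  finally have "(2 * r - s) * (d * f m) \<le> (2 * r - s) * (2 * p * (m - s) * b + (m * (p - 2) + 2 * p) * f s)"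
    by (simp add: algebra_simps)
  then have "d * f m \<le> 2 * p * (m - s) * b + (m * (p - 2) + 2 * p) * f s"
    using sr by simp
  moreover have "m * d * (1 - \<theta>) = s * (m * (p - 2) + 2 * p)"
    using \<theta>' by (simp add: algebra_simps d_def)
  then have "(m * (p - 2) + 2 * p) = m * d * (1 - \<theta>) / s" using sm by (simp add: mult.commute)
  ultimately have "d * f m \<le> \<theta> * (m * d) * b + m * d * (1 - \<theta>) / s * f s"
    unfolding \<theta>' by simp
  also have "\<dots> = d * (m * (\<theta> * b + (1 - \<theta>) / s * f s))"
    by (simp add: distrib_left mult_ac)
  finally have "d * f m \<le> d * (m * (\<theta> * b + (1 - \<theta>) / s * f s))" .
  then have "f m \<le> m * (\<theta> * b + (1 - \<theta>) / s * f s)" using d by simp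
  then have "f m / m \<le> \<theta> * b + (1 - \<theta>) / s * f s" using sm by (simp add: field_simps)
  then have "ln (F m powr (1 / m)) \<le> ln (B powr \<theta> * (F s powr (1 / s)) powr (1 - \<theta>))"
    using Fpos[of m] Fpos[of s] B by (simp add: f_def b_def ln_mult ln_powr powr_powr)
  then show ?thesis using Fpos[of m] Fpos[of s] B by (subst (asm) ln_le_cancel_iff) auto
qed

section \<open>The cross product of plane vectors\<close>

definition cross2 :: "plane \<Rightarrow> plane \<Rightarrow> real" where
  "cross2 u v = u $ 1 * v $ 2 - u $ 2 * v $ 1"

lemma inner_plane: "(u :: plane) \<bullet> v = u $ 1 * v $ 1 + u $ 2 * v $ 2"
  by (simp add: inner_vec_def sum_2)

lemma plane_eq_iff: "(u :: plane) = v \<longleftrightarrow> u $ 1 = v $ 1 \<and> u $ 2 = v $ 2"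
  by (simp add: vec_eq_iff forall_2)

lemma cross2_add [simp]: "cross2 u (v + w) = cross2 u v + cross2 u w"
  and cross2_diff [simp]: "cross2 u (v - w) = cross2 u v - cross2 u w"
  and cross2_scaleR [simp]: "cross2 u (c *\<^sub>R v) = c * cross2 u v"
  and cross2_minus [simp]: "cross2 u (- v) = - cross2 u v"
  and cross2_self [simp]: "cross2 u u = 0"
  and cross2_zero [simp]: "cross2 u 0 = 0"
  by (simp_all add: cross2_def algebra_simps)

lemma cross2_left_simps [simp]:
  "cross2 (v + w) u = cross2 v u + cross2 w u"
  "cross2 (v - w) u = cross2 v u - cross2 w u"
  "cross2 (c *\<^sub>R v) u = c * cross2 v u"
  "cross2 (- v) u = - cross2 v u"
  "cross2 0 u = 0"
  by (simp_all add: cross2_def algebra_simps)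

lemma cross2_commute: "cross2 u v = - cross2 v u"
  by (simp add: cross2_def)

lemma Lagrange_cross2: "(cross2 u v)\<^sup>2 + (u \<bullet> v)\<^sup>2 = (norm u)\<^sup>2 * (norm v)\<^sup>2"
  unfolding power2_norm_eq_inner cross2_def inner_plane by (simp add: power2_eq_square algebra_simps)

lemma abs_cross2_le: "\<bar>cross2 u v\<bar> \<le> norm u * norm v"
proof (rule power2_le_imp_le)
  show "\<bar>cross2 u v\<bar>\<^sup>2 \<le> (norm u * norm v)\<^sup>2"
    using Lagrange_cross2[of u v] zero_le_power2[of "u \<bullet> v"] by (simp only: power2_abs power_mult_distrib)
qed simp

lemma cross2_eq_0_D:
  assumes "cross2 d v = 0" "d \<noteq> 0"
  obtains c where "v = c *\<^sub>R d"
proof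
  have "d \<bullet> d \<noteq> 0" using assms by simp
  then have nz: "d $ 1 * d $ 1 + d $ 2 * d $ 2 \<noteq> 0" by (simp add: inner_plane)
  have "(d $ 1 * d $ 1 + d $ 2 * d $ 2) * v $ 1 = (v \<bullet> d) * d $ 1 - d $ 2 * cross2 d v"
    "(d $ 1 * d $ 1 + d $ 2 * d $ 2) * v $ 2 = (v \<bullet> d) * d $ 2 + d $ 1 * cross2 d v"
    by (simp_all add: inner_plane cross2_def algebra_simps)
  then show "v = ((v \<bullet> d) / (d $ 1 * d $ 1 + d $ 2 * d $ 2)) *\<^sub>R d"
    using nz assms by (simp add: plane_eq_iff field_simps)
qed

lemma closed_segment_param:
  assumes "z \<in> closed_segment p q"
  obtains t where "0 \<le> t" "t \<le> 1" "z = p + t *\<^sub>R (q - p)"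
proof -
  obtain t where t: "0 \<le> t" "t \<le> 1" "z = (1 - t) *\<^sub>R p + t *\<^sub>R q"
    using assms by (auto simp: in_segment)
  then show ?thesis by (intro that[of t]) (auto simp: algebra_simps)
qed

lemma unit_normals_cases:
  fixes n n' d :: plane
  assumes "norm n = 1" "norm n' = 1" "n \<bullet> d = 0" "n' \<bullet> d = 0" "d \<noteq> 0"
  shows "n' = n \<or> n' = - n"
proof -
  have "d $ 1 * cross2 n n' = 0" "d $ 2 * cross2 n n' = 0"
    using assms(3,4) unfolding cross2_def inner_plane by algebra+
  then have "cross2 n n' = 0" using assms(5) by (auto simp: plane_eq_iff)
  moreover have "n \<noteq> 0" using assms by auto
  ultimately obtain c where c: "n' = c *\<^sub>R n" by (rule cross2_eq_0_D)
  then have "\<bar>c\<bar> = 1" using assms by simp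
  then show ?thesis using c by (auto simp: abs_if split: if_splits)
qed

section \<open>Jordan curves made of segments\<close>

text \<open>The Jordan curve theorem is transported from the complex plane along the linear bijection \<open>h\<close>,
which commutes with connected components, closures and boundedness, hence with inside and outside.\<close>

lemma Jordan_plane:
  fixes g :: "real \<Rightarrow> plane"
  assumes "simple_path g" "pathfinish g = pathstart g"
  shows "open (inside (path_image g)) \<and> open (outside (path_image g)) \<and> bounded (inside (path_image g)) \<and>
    frontier (inside (path_image g)) = path_image g \<and> frontier (outside (path_image g)) = path_image g"
proof -
  define h :: "plane \<Rightarrow> complex" where "h x = Complex (x $ 1) (x $ 2)" for x
  have lin: "linear h"
    by (rule linearI) (auto simp: h_def complex_eq_iff)
  have inj: "inj h" by (auto simp: h_def inj_def plane_eq_iff)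
  define k :: "complex \<Rightarrow> plane" where "k z = vector [Re z, Im z]" for z
  have hk: "h (k z) = z" "k (h x) = x" for x z
    by (auto simp: h_def k_def plane_eq_iff complex_eq_iff)
  have surj: "surj h" using hk by (metis surjI)
  have k: "linear k"
    by (rule linearI) (auto simp: k_def plane_eq_iff)
  have bij: "bij h" using inj surj by (simp add: bij_def)
  have cc: "h ` connected_component_set S x = connected_component_set (h ` S) (h x)" for S x
  proof -
    have 1: "h ` connected_component_set S x \<subseteq> connected_component_set (h ` S) (h x)" if "x \<in> S" for S x
    proof (rule connected_component_maximal)
      show "h x \<in> h ` connected_component_set S x" using that by auto
      show "connected (h ` connected_component_set S x)"
        by (intro connected_linear_image lin) auto
      show "h ` connected_component_set S x \<subseteq> h ` S"
        by (intro image_mono connected_component_subset)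
    qed
    have "k ` connected_component_set (h ` S) (h x) \<subseteq> connected_component_set (k ` h ` S) (k (h x))" if "x \<in> S" for x
    proof (rule connected_component_maximal)
      show "k (h x) \<in> k ` connected_component_set (h ` S) (h x)" using that by auto
      show "connected (k ` connected_component_set (h ` S) (h x))"
        by (intro connected_linear_image k) auto
      show "k ` connected_component_set (h ` S) (h x) \<subseteq> k ` h ` S"
        by (intro image_mono connected_component_subset)
    qed
    then have 2: "connected_component_set (h ` S) (h x) \<subseteq> h ` connected_component_set S x" if "x \<in> S" for x
      using image_mono[of "k ` connected_component_set (h ` S) (h x)" "connected_component_set S x" h] that
      by (simp add: image_image hk)
    show ?thesis
    proof (cases "x \<in> S")
      case True
      then show ?thesis using 1[of x S] 2[of x] by blast
    next
      case False
      then have "h x \<notin> h ` S" using inj by (auto dest: injD)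
      then show ?thesis using False by (metis connected_component_eq_empty image_empty)
    qed
  qed
  have bd: "bounded (h ` S) \<longleftrightarrow> bounded S" for S
    using bounded_linear_image[of S h] bounded_linear_image[of "h ` S" k] lin k
    by (auto simp: image_image hk linear_conv_bounded_linear)
  have compl: "h ` (- S) = - h ` S" for S by (rule bij_image_Compl_eq[OF bij])
  have ins: "h ` inside S = inside (h ` S)" and outs: "h ` outside S = outside (h ` S)" for S
  proof -
    have *: "h x \<in> inside (h ` S) \<longleftrightarrow> x \<in> inside S" for x
      using inj unfolding inside_def
      by (auto simp: compl[symmetric] cc[symmetric] bd inj_image_mem_iff)
    then show "h ` inside S = inside (h ` S)" by (metis (no_types, opaque_lifting) hk(1) inj inj_image_mem_iff set_eqI)
    have *: "h x \<in> outside (h ` S) \<longleftrightarrow> x \<in> outside S" for x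
      using inj unfolding outside
      by (auto simp: compl[symmetric] cc[symmetric] bd inj_image_mem_iff)
    then show "h ` outside S = outside (h ` S)" by (metis (no_types, opaque_lifting) hk(1) inj inj_image_mem_iff set_eqI)
  qed
  have fr: "h ` frontier S = frontier (h ` S)" for S
    unfolding frontier_closures compl[symmetric] closure_injective_linear_image[OF lin inj, symmetric]
    by (rule image_Int[OF inj])
  have op: "open (h ` S) \<longleftrightarrow> open S" for S
  proof -
    have "closed (h ` (- S)) \<longleftrightarrow> closed (- S)"
      using closed_injective_linear_image_eq[OF lin] linear_injective_0[OF lin] inj by blast
    then show ?thesis by (simp add: compl closed_def)
  qed
  have "simple_path (h \<circ> g)" "pathfinish (h \<circ> g) = pathstart (h \<circ> g)"
    using assms simple_path_linear_image_eq[OF lin inj] by (auto simp: pathfinish_def pathstart_def)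
  note J = Jordan_inside_outside[OF this, unfolded path_image_linear_image[OF lin], folded ins outs fr]
  then show ?thesis
    by (auto simp: op bd inj_image_eq_iff[OF inj])
qed

text \<open>Three arms meet at \<open>y\<close>, so an injective image of them in the line has two arms on the same
side of the image of \<open>y\<close>; by the intermediate value theorem the longer of these covers the tip of
the other.\<close>

lemma no_tripod_in_line:
  fixes f :: "plane \<Rightarrow> real" and y a b c :: plane
  defines "T \<equiv> closed_segment y a \<union> closed_segment y b \<union> closed_segment y c"
  assumes cont: "continuous_on T f" and inj: "inj_on f T"
    and ne: "a \<noteq> y" "b \<noteq> y" "c \<noteq> y"
    and disj: "closed_segment y a \<inter> closed_segment y b = {y}" "closed_segment y a \<inter> closed_segment y c = {y}"
       "closed_segment y b \<inter> closed_segment y c = {y}"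
  shows False
proof -
  have *: False
    if f: "continuous_on (closed_segment y b) f" "inj_on f (closed_segment y a \<union> closed_segment y b)"
      and ab: "closed_segment y a \<inter> closed_segment y b = {y}" and "a \<noteq> y" and le: "f y < f a" "f a \<le> f b"
    for a b :: plane and f :: "plane \<Rightarrow> real"
  proof -
    have "connected (f ` closed_segment y b)"
      using f by (intro connected_continuous_image) auto
    moreover have "f y \<in> f ` closed_segment y b" "f b \<in> f ` closed_segment y b"
      by (simp_all only: imageI ends_in_segment)
    ultimately have "f a \<in> f ` closed_segment y b"
      using le by (meson connectedD_interval less_imp_le)
    then obtain z where z: "z \<in> closed_segment y b" "f a = f z" by blast
    have ay: "a \<in> closed_segment y a" by (rule ends_in_segment)
    have "a = z" using inj_onD[OF f(2) z(2)] ay z(1) by blast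
    then show False using z(1) ab ay \<open>a \<noteq> y\<close> by blast
  qed
  have one_side: "\<not> (f y < f a \<and> f y < f b)" 
    if f: "continuous_on (closed_segment y a) f" "continuous_on (closed_segment y b) f" 
      "inj_on f (closed_segment y a \<union> closed_segment y b)"
      and ab: "closed_segment y a \<inter> closed_segment y b = {y}" and "a \<noteq> y" "b \<noteq> y"
    for a b :: plane and f :: "plane \<Rightarrow> real"
  proof
    assume lt: "f y < f a \<and> f y < f b"
    show False
    proof (cases "f a \<le> f b")
      case True
      then show False using *[OF f(2,3) ab \<open>a \<noteq> y\<close>] lt by blast
    next
      case False
      have "inj_on f (closed_segment y b \<union> closed_segment y a)" "closed_segment y b \<inter> closed_segment y a = {y}"
        using f(3) ab by (simp_all only: Un_commute Int_commute)
      then show False using *[OF f(1) _ _ \<open>b \<noteq> y\<close>] lt False by linarith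
    qed
  qed
  have two_sides: "f y < f a \<longleftrightarrow> \<not> f y < f b" 
    if f: "continuous_on (closed_segment y a) f" "continuous_on (closed_segment y b) f" 
      "inj_on f (closed_segment y a \<union> closed_segment y b)"
      and ab: "closed_segment y a \<inter> closed_segment y b = {y}" and "a \<noteq> y" "b \<noteq> y"
    for a b :: plane
  proof -
    have "\<not> (f y < f a \<and> f y < f b)" using one_side[OF that] .
    moreover have "\<not> (f a < f y \<and> f b < f y)"
      using one_side[of a "\<lambda>x. - f x" b] that by (simp add: continuous_on_minus inj_on_def)
    moreover have "f a \<noteq> f y" "f b \<noteq> f y"
      using inj_onD[OF f(3)] \<open>a \<noteq> y\<close> \<open>b \<noteq> y\<close> ends_in_segment[of y a] ends_in_segment[of y b] by blast+
    ultimately show ?thesis by linarith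
  qed
  have c: "continuous_on (closed_segment y a) f" "continuous_on (closed_segment y b) f" "continuous_on (closed_segment y c) f"
    using cont unfolding T_def by (auto intro: continuous_on_subset)
  have i: "inj_on f (closed_segment y a \<union> closed_segment y b)" "inj_on f (closed_segment y a \<union> closed_segment y c)"
    "inj_on f (closed_segment y b \<union> closed_segment y c)"
    using inj unfolding T_def by (auto intro: inj_on_subset)
  show False
    using two_sides[OF c(1,2) i(1) disj(1) ne(1,2)] two_sides[OF c(1,3) i(2) disj(2) ne(1,3)]
      two_sides[OF c(2,3) i(3) disj(3) ne(2,3)] by blast
qed

text \<open>A closed curve minus one point is an arc, hence embeds into the line. The point to be removed is
the tip \<open>a\<close> of one arm, after this arm has been cut in half to free its tip.\<close>

lemma no_tripod_in_closed_curve: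
  fixes g :: "real \<Rightarrow> plane"
  assumes g: "simple_path g" "pathfinish g = pathstart g"
    and sub: "closed_segment y a \<subseteq> path_image g" "closed_segment y b \<subseteq> path_image g" "closed_segment y c \<subseteq> path_image g"
    and ne: "a \<noteq> y" "b \<noteq> y" "c \<noteq> y"
    and disj: "closed_segment y a \<inter> closed_segment y b = {y}" "closed_segment y a \<inter> closed_segment y c = {y}"
       "closed_segment y b \<inter> closed_segment y c = {y}"
  shows False
proof -
  define a' where "a' = midpoint y a"
  have a': "a' \<noteq> y" "closed_segment y a' \<subseteq> closed_segment y a"
    using ne unfolding a'_def by (auto simp: subset_closed_segment)
  have an: "a \<notin> closed_segment y a'"
  proof
    assume "a \<in> closed_segment y a'"
    then have "dist y a \<le> dist y a'" by (metis dist_in_closed_segment dist_commute)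
    then show False using ne by (simp add: a'_def dist_midpoint)
  qed
  define T where "T = closed_segment y a' \<union> closed_segment y b \<union> closed_segment y c"
  have aT: "a \<notin> T" using an ne disj ends_in_segment(2)[of y a] unfolding T_def by blast
  have cT: "compact T" unfolding T_def by (intro compact_Un compact_segment)
  have Tg: "T \<subseteq> path_image g" unfolding T_def using sub a' by auto
  obtain u where u: "u \<in> {0..1}" "g u = a" using sub(1) by (auto simp: path_image_def)
  define k where "k = shiftpath u g"
  have k: "simple_path k" "path_image k = path_image g" "k 0 = a" "k 1 = a"
    using g u simple_path_shiftpath[of g u] path_image_shiftpath[of u g] endpoints_shiftpath[of g u]
    by (auto simp: k_def pathstart_def pathfinish_def)
  have contk: "continuous_on {0..1} k" using k(1) by (simp add: simple_path_def path_def)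
  define Q where "Q = {t \<in> {0..1}. k t \<in> T}"
  have "Q = {0..1} \<inter> k -` T" unfolding Q_def by auto
  then have "closed Q"
    using continuous_closed_preimage[OF contk, of T] cT compact_imp_closed by auto
  then have cQ: "compact Q" using compact_eq_bounded_closed bounded_subset[of "{0..1::real}" Q] unfolding Q_def by blast
  have yT: "y \<in> T" unfolding T_def by simp
  then have "y \<in> k ` {0..1}" using Tg k(2) by (auto simp: path_image_def)
  then have neQ: "Q \<noteq> {}" using yT unfolding Q_def by blast
  obtain l where l: "l \<in> Q" "\<And>t. t \<in> Q \<Longrightarrow> l \<le> t" using compact_attains_inf[OF cQ neQ] by auto
  obtain m where m: "m \<in> Q" "\<And>t. t \<in> Q \<Longrightarrow> t \<le> m" using compact_attains_sup[OF cQ neQ] by auto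
  have "0 \<notin> Q" "1 \<notin> Q" using k aT by (auto simp: Q_def)
  then have lm: "0 < l" "l \<le> m" "m < 1" using l m by (auto simp: Q_def less_le)
  define v where "v = l / 2"
  define w where "w = (1 + m) / 2"
  have vw: "0 < v" "v < l" "m < w" "w < 1" "v \<in> {0..1}" "w \<in> {0..1}" using lm by (auto simp: v_def w_def)
  have "k v \<noteq> k w"
  proof
    assume "k v = k w"
    then have "v = w \<or> v = 0 \<and> w = 1 \<or> v = 1 \<and> w = 0"
      using k(1) vw(5,6) unfolding simple_path_def loop_free_def by blast
    then show False using vw lm by linarith
  qed
  then have arc: "arc (subpath v w k)" using arc_simple_path_subpath[OF k(1)] vw by auto
  have TQ: "T \<subseteq> path_image (subpath v w k)"
  proof
    fix z assume z: "z \<in> T"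
    have "z \<in> k ` {0..1}" using subsetD[OF Tg z] k(2) unfolding path_image_def by simp
    then obtain t where "t \<in> {0..1}" "z = k t" by blast
    then have "t \<in> Q" using z by (simp add: Q_def)
    then have "t \<in> {v..w}" using l(2)[of t] m(2)[of t] vw by auto
    then show "z \<in> path_image (subpath v w k)"
      using \<open>z = k t\<close> vw lm by (auto simp: path_image_subpath)
  qed
  obtain h where h: "homeomorphism {0..1} (path_image (subpath v w k)) (subpath v w k) h"
    using homeomorphism_arc[OF arc] by blast
  have "continuous_on T h" using h TQ continuous_on_subset unfolding homeomorphism_def by blast
  moreover have "inj_on h T"
    using h TQ by (intro inj_on_inverseI[of _ "subpath v w k"]) (auto simp: homeomorphism_def)
  moreover have "closed_segment y a' \<inter> closed_segment y b = {y}"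
    using disj(1) a'(2) ends_in_segment(1)[of y a'] ends_in_segment(1)[of y b] by blast
  moreover have "closed_segment y a' \<inter> closed_segment y c = {y}"
    using disj(2) a'(2) ends_in_segment(1)[of y a'] ends_in_segment(1)[of y c] by blast
  ultimately show False
    unfolding T_def by (rule no_tripod_in_line[OF _ _ a'(1) ne(2,3) _ _ disj(3)])
qed

lemma segments_meet_only_at_origin:
  assumes "cross2 d (a - y) = 0" "cross2 d (c - y) \<noteq> 0"
  shows "closed_segment y a \<inter> closed_segment y c = {y}"
proof -
  have "x = y" if x: "x \<in> closed_segment y a" "x \<in> closed_segment y c" for x
  proof -
    obtain t where t: "x = y + t *\<^sub>R (a - y)" using closed_segment_param[OF x(1)] by blast
    obtain u where u: "x = y + u *\<^sub>R (c - y)" using closed_segment_param[OF x(2)] by blast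
    have "cross2 d (x - y) = t * cross2 d (a - y)" unfolding t by (simp del: cross2_diff)
    moreover have "cross2 d (x - y) = u * cross2 d (c - y)" unfolding u by (simp del: cross2_diff)
    ultimately have "u = 0" using assms by simp
    then show ?thesis using u by simp
  qed
  then show ?thesis by auto
qed

text \<open>The curve is a finite union of segments. Those that do not contain \<open>y\<close> stay at a positive distance,
and one that contains \<open>y\<close> without being parallel to the edge would form a tripod with the
two halves of the edge.\<close>

lemma polygonal_curve_locally_flat:
  assumes \<Gamma>: "polygonal_curve \<Gamma>" and ab: "closed_segment a b \<subseteq> \<Gamma>" and y: "y \<in> open_segment a b"
  obtains \<epsilon> where "0 < \<epsilon>" "\<And>x. x \<in> ball y \<epsilon> \<Longrightarrow> x \<in> \<Gamma> \<longleftrightarrow> cross2 (b - a) (x - y) = 0"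
proof -
  obtain g where g: "simple_path g" "pathfinish g = pathstart g" "path_image g = \<Gamma>"
    using \<Gamma> unfolding polygonal_curve_def by blast
  obtain S :: "(plane \<times> plane) set" where S: "finite S" "\<Gamma> = (\<Union>(p, q)\<in>S. closed_segment p q)"
    using \<Gamma> unfolding polygonal_curve_def segment_union_def by blast
  obtain t where t: "0 < t" "t < 1" "y = (1 - t) *\<^sub>R a + t *\<^sub>R b" and ne: "a \<noteq> b"
    using y by (auto simp: in_segment)
  define d where "d = b - a"
  have d0: "d \<noteq> 0" using ne by (simp add: d_def)
  have ya: "a - y = (- t) *\<^sub>R d" and yb: "b - y = (1 - t) *\<^sub>R d"
    unfolding t(3) d_def by (simp_all add: algebra_simps)
  have sub: "closed_segment y a \<subseteq> \<Gamma>" "closed_segment y b \<subseteq> \<Gamma>"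
    by (rule subset_trans[OF _ ab], simp add: subset_closed_segment open_closed_segment[OF y])+
  have yab: "closed_segment y a \<inter> closed_segment y b = {y}"
  proof -
    have "x = y" if x: "x \<in> closed_segment y a" "x \<in> closed_segment y b" for x
    proof -
      obtain u where u: "0 \<le> u" "x = y + u *\<^sub>R (a - y)" using closed_segment_param[OF x(1)] by blast
      obtain v where v: "0 \<le> v" "x = y + v *\<^sub>R (b - y)" using closed_segment_param[OF x(2)] by blast
      have "(u * (- t)) *\<^sub>R d = (v * (1 - t)) *\<^sub>R d" using u v ya yb by simp
      then have "u * (- t) = v * (1 - t)" using d0 by (simp only: scaleR_cancel_right) simp
      moreover have "0 \<le> u * t" "0 \<le> v * (1 - t)" using u v t by auto
      ultimately have "v * (1 - t) = 0" by linarith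
      then show ?thesis using v t by simp
    qed
    then show ?thesis by auto
  qed
  have flat: "cross2 d (c - y) = 0" if c: "closed_segment y c \<subseteq> \<Gamma>" for c
  proof (rule ccontr)
    assume nz: "cross2 d (c - y) \<noteq> 0"
    have "cross2 d (a - y) = 0" "cross2 d (b - y) = 0" unfolding ya yb by simp_all
    then have "closed_segment y a \<inter> closed_segment y c = {y}" "closed_segment y b \<inter> closed_segment y c = {y}"
      using nz by (auto intro!: segments_meet_only_at_origin simp del: cross2_diff)
    moreover have "c \<noteq> y" using nz by auto
    moreover have "a \<noteq> y" "b \<noteq> y" using ya yb d0 t by auto
    ultimately show False
      using no_tripod_in_closed_curve[OF g(1,2), of y a b c] g(3) sub c yab by auto
  qed
  have each: "\<exists>\<epsilon>>0. \<forall>x\<in>ball y \<epsilon> \<inter> closed_segment p q. cross2 d (x - y) = 0" if pq: "(p, q) \<in> S" for p q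
  proof (cases "y \<in> closed_segment p q")
    case True
    have pq\<Gamma>: "closed_segment p q \<subseteq> \<Gamma>" using pq S by auto
    have "cross2 d (x - y) = 0" if "x \<in> closed_segment p q" for x
    proof -
      have "closed_segment y x \<subseteq> closed_segment p q" using that True by (simp add: subset_closed_segment)
      then show ?thesis using flat pq\<Gamma> by blast
    qed
    then show ?thesis by (intro exI[of _ 1]) auto
  next
    case False
    have "open (- closed_segment p q)" by (simp add: open_Compl)
    then obtain e where "0 < e" "ball y e \<subseteq> - closed_segment p q"
      using False by (meson ComplI open_contains_ball)
    then show ?thesis by (intro exI[of _ e]) auto
  qed
  then have "\<forall>s\<in>S. \<exists>\<epsilon>>0. \<forall>x\<in>ball y \<epsilon> \<inter> closed_segment (fst s) (snd s). cross2 d (x - y) = 0" by auto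
  then obtain e where e: "\<And>s. s \<in> S \<Longrightarrow> 0 < e s"
    "\<And>s x. s \<in> S \<Longrightarrow> x \<in> ball y (e s) \<inter> closed_segment (fst s) (snd s) \<Longrightarrow> cross2 d (x - y) = 0"
    by metis
  define r where "r = norm d * min t (1 - t)"
  have r: "0 < r" unfolding r_def using d0 t by simp
  define \<epsilon> where "\<epsilon> = Min (insert r (e ` S))"
  have \<epsilon>: "0 < \<epsilon>" "\<epsilon> \<le> r" "\<And>s. s \<in> S \<Longrightarrow> \<epsilon> \<le> e s"
    unfolding \<epsilon>_def using r e S by (auto intro!: Min_le)
  show ?thesis
  proof
    show "0 < \<epsilon>" by fact
    fix x assume x: "x \<in> ball y \<epsilon>"
    show "x \<in> \<Gamma> \<longleftrightarrow> cross2 (b - a) (x - y) = 0"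
    proof
      assume "x \<in> \<Gamma>"
      then obtain p q where pq: "(p, q) \<in> S" "x \<in> closed_segment p q" using S by auto
      then show "cross2 (b - a) (x - y) = 0"
        using e(2)[OF pq(1), of x] \<epsilon>(3)[OF pq(1)] x by (auto simp: d_def)
    next
      assume "cross2 (b - a) (x - y) = 0"
      then obtain c where c: "x - y = c *\<^sub>R d" using cross2_eq_0_D[of d "x - y"] d0 unfolding d_def by metis
      have "norm (x - y) < r" using x \<epsilon>(2) by (simp add: dist_norm norm_minus_commute)
      then have "norm d * \<bar>c\<bar> < norm d * min t (1 - t)" unfolding c r_def by (simp add: mult.commute)
      then have "\<bar>c\<bar> < min t (1 - t)" using d0 by simp
      then have "0 \<le> t + c" "t + c \<le> 1" by auto
      moreover have "x = (1 - (t + c)) *\<^sub>R a + (t + c) *\<^sub>R b"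
        using c t(3) unfolding d_def by (simp add: algebra_simps)
      ultimately have "x \<in> closed_segment a b" unfolding in_segment by blast
      then show "x \<in> \<Gamma>" using ab by auto
    qed
  qed
qed

lemma ball_half_plane:
  fixes y d :: plane
  assumes "0 < \<epsilon>" "d \<noteq> 0"
  shows "connected {x \<in> ball y \<epsilon>. 0 < s * cross2 d (x - y)}"
    and "s \<noteq> 0 \<Longrightarrow> {x \<in> ball y \<epsilon>. 0 < s * cross2 d (x - y)} \<noteq> {}"
    and "open {x \<in> ball y \<epsilon>. 0 < s * cross2 d (x - y)}"
proof -
  define n where "n = (vector [- d $ 2, d $ 1] :: plane)"
  have *: "cross2 d x = n \<bullet> x" for x by (simp add: cross2_def n_def inner_plane)
  have eq: "{x \<in> ball y \<epsilon>. 0 < s * cross2 d (x - y)} = ball y \<epsilon> \<inter> {x. (s *\<^sub>R n) \<bullet> y < (s *\<^sub>R n) \<bullet> x}"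
    by (auto simp: * inner_diff_right algebra_simps)
  show "connected {x \<in> ball y \<epsilon>. 0 < s * cross2 d (x - y)}"
    unfolding eq by (intro convex_connected convex_Int convex_ball convex_halfspace_gt)
  show "open {x \<in> ball y \<epsilon>. 0 < s * cross2 d (x - y)}"
    unfolding eq by (intro open_Int open_ball open_halfspace_gt)
  assume "s \<noteq> 0"
  have n0: "n \<noteq> 0" using assms by (auto simp: n_def plane_eq_iff)
  have "cross2 d ((\<epsilon> / 2 / norm n * sgn s) *\<^sub>R n) = \<epsilon> / 2 / norm n * sgn s * (n \<bullet> n)"
    unfolding * by simp
  then have eq: "s * cross2 d ((\<epsilon> / 2 / norm n * sgn s) *\<^sub>R n) = \<epsilon> / 2 / norm n * (s * sgn s) * (n \<bullet> n)"
    by (simp only: ac_simps)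
  have "0 < s * sgn s" using \<open>s \<noteq> 0\<close> by (simp add: sgn_if)
  then have "0 < s * cross2 d ((\<epsilon> / 2 / norm n * sgn s) *\<^sub>R n)"
    unfolding eq using n0 assms(1) by (intro mult_pos_pos[of _ "n \<bullet> n"] mult_pos_pos[of _ "s * sgn s"]) auto
  moreover have "dist y (y + (\<epsilon> / 2 / norm n * sgn s) *\<^sub>R n) < \<epsilon>"
    using n0 \<open>s \<noteq> 0\<close> assms(1) by (simp add: dist_norm sgn_if)
  ultimately show "{x \<in> ball y \<epsilon>. 0 < s * cross2 d (x - y)} \<noteq> {}"
    by (auto intro!: exI[of _ "y + (\<epsilon> / 2 / norm n * sgn s) *\<^sub>R n"] simp del: cross2_scaleR)
qed

text \<open>Near \<open>y\<close> the complement of the curve consists of two half disks, each of which lies on one side of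
the curve. Both the inside and the outside accumulate at \<open>y\<close>, so each of them gets one half disk.\<close>

lemma polygonal_curve_sides:
  assumes \<Gamma>: "polygonal_curve \<Gamma>" and ab: "closed_segment a b \<subseteq> \<Gamma>" and y: "y \<in> open_segment a b"
  obtains \<epsilon> s :: real where "0 < \<epsilon>" "s = 1 \<or> s = -1"
    "\<And>x. x \<in> ball y \<epsilon> \<Longrightarrow> 0 < s * cross2 (b - a) (x - y) \<Longrightarrow> x \<in> inside \<Gamma>"
    "\<And>x. x \<in> ball y \<epsilon> \<Longrightarrow> s * cross2 (b - a) (x - y) < 0 \<Longrightarrow> x \<in> outside \<Gamma>"
proof -
  obtain g where g: "simple_path g" "pathfinish g = pathstart g" "path_image g = \<Gamma>"
    using \<Gamma> unfolding polygonal_curve_def by blast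
  note J = Jordan_plane[OF g(1,2), unfolded g(3)]
  obtain \<epsilon> where \<epsilon>: "0 < \<epsilon>" "\<And>x. x \<in> ball y \<epsilon> \<Longrightarrow> x \<in> \<Gamma> \<longleftrightarrow> cross2 (b - a) (x - y) = 0"
    using polygonal_curve_locally_flat[OF assms] by blast
  define d where "d = b - a"
  have d0: "d \<noteq> 0" using y by (auto simp: d_def)
  define H where "H s = {x \<in> ball y \<epsilon>. 0 < s * cross2 d (x - y)}" for s :: real
  have H: "connected (H s)" "open (H s)" "s \<noteq> 0 \<Longrightarrow> H s \<noteq> {}" for s
    unfolding H_def using ball_half_plane[OF \<epsilon>(1) d0] by auto
  have H\<Gamma>: "H s \<inter> \<Gamma> = {}" for s
    using \<epsilon>(2) unfolding H_def d_def by auto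
  have either: "H s \<subseteq> inside \<Gamma> \<or> H s \<subseteq> outside \<Gamma>" for s
  proof -
    have "H s \<inter> inside \<Gamma> = {} \<or> H s - inside \<Gamma> = {}"
      using connected_Int_frontier[OF H(1), of s "inside \<Gamma>"] H\<Gamma> J by auto
    then show ?thesis using H\<Gamma>[of s] inside_Un_outside[of \<Gamma>] by blast
  qed
  have yG: "y \<in> \<Gamma>" using \<epsilon> by auto
  have meets: "H 1 \<inter> U \<noteq> {} \<or> H (-1) \<inter> U \<noteq> {}" if "open U" "frontier U = \<Gamma>" for U
  proof -
    have "y \<in> closure U" using yG that by (auto simp: frontier_def)
    then have ne: "U \<inter> ball y \<epsilon> \<noteq> {}"
      using \<epsilon>(1) unfolding closure_approachable by (metis IntI dist_commute empty_iff mem_ball)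
    then obtain x where x: "x \<in> U" "x \<in> ball y \<epsilon>" by auto
    have "x \<notin> \<Gamma>" using x that frontier_disjoint_eq[of U] by (auto simp: frontier_def interior_open)
    then have "cross2 d (x - y) \<noteq> 0" using \<epsilon>(2)[OF x(2)] by (simp add: d_def)
    then have "x \<in> H 1 \<or> x \<in> H (-1)" using x unfolding H_def by auto
    then show ?thesis using x by auto
  qed
  have io: "inside \<Gamma> \<inter> outside \<Gamma> = {}" by simp
  have "H 1 \<subseteq> inside \<Gamma> \<and> H (-1) \<subseteq> outside \<Gamma> \<or> H (-1) \<subseteq> inside \<Gamma> \<and> H 1 \<subseteq> outside \<Gamma>"
    using either[of 1] either[of "-1"] meets[of "inside \<Gamma>"] meets[of "outside \<Gamma>"] J io by blast
  then obtain s :: real where s: "s = 1 \<or> s = -1" "H s \<subseteq> inside \<Gamma>" "H (- s) \<subseteq> outside \<Gamma>"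
    by force
  show ?thesis
    using s by (intro that[of \<epsilon> s] \<epsilon>(1)) (auto simp: H_def d_def)
qed

text \<open>The inside lies to the same side of the edge at all points of the open edge, because the side is
locally constant there and the open edge is connected. This makes the description that defines
the outer normal satisfiable. It determines the normal, since the only other unit vector
orthogonal to the edge points inside.\<close>

lemma outer_normal_polygon:
  assumes \<Gamma>: "polygonal_curve \<Gamma>" and ab: "closed_segment a b \<subseteq> \<Gamma>" "a \<noteq> b"
  defines "n \<equiv> outer_normal (inside \<Gamma>) a b"
  shows "norm n = 1" "n \<bullet> (b - a) = 0"
    "\<And>y. y \<in> open_segment a b \<Longrightarrow> \<forall>\<^sub>F t in at_right 0. y - t *\<^sub>R n \<in> inside \<Gamma> \<and> y + t *\<^sub>R n \<notin> inside \<Gamma>"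
proof -
  define d where "d = b - a"
  have d0: "d \<noteq> 0" using ab by (simp add: d_def)
  define side where "side y s \<longleftrightarrow> (\<exists>\<epsilon>>0. \<forall>x\<in>ball y \<epsilon>. (0 < s * cross2 d (x - y) \<longrightarrow> x \<in> inside \<Gamma>) \<and>
     (s * cross2 d (x - y) < 0 \<longrightarrow> x \<in> outside \<Gamma>))" for y and s :: real
  have ex: "\<exists>s. (s = 1 \<or> s = -1) \<and> side y s" if "y \<in> open_segment a b" for y
    using polygonal_curve_sides[OF \<Gamma> ab(1) that] unfolding side_def d_def by metis
  have unique: "s = s'" if y: "side y s" "side y s'" "s = 1 \<or> s = -1" "s' = 1 \<or> s' = -1" for y s s'
  proof (rule ccontr)
    assume "s \<noteq> s'"
    then have s': "s' = - s" using y by auto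
    obtain e where e: "e > 0" "\<And>x. x \<in> ball y e \<Longrightarrow> 0 < s * cross2 d (x - y) \<Longrightarrow> x \<in> inside \<Gamma>"
      using y(1) unfolding side_def by blast
    obtain e' where e': "e' > 0" "\<And>x. x \<in> ball y e' \<Longrightarrow> s' * cross2 d (x - y) < 0 \<Longrightarrow> x \<in> outside \<Gamma>"
      using y(2) unfolding side_def by blast
    have "{x \<in> ball y (min e e'). 0 < s * cross2 d (x - y)} \<noteq> {}"
      using e(1) e'(1) d0 y by (intro ball_half_plane) auto
    then obtain x where "x \<in> ball y e" "x \<in> ball y e'" "0 < s * cross2 d (x - y)" by auto
    then have "x \<in> inside \<Gamma>" "x \<in> outside \<Gamma>" using e(2) e'(2) unfolding s' by (auto simp del: cross2_diff)
    then show False using inside_Int_outside[of \<Gamma>] by blast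
  qed
  define f where "f y = (SOME s. (s = 1 \<or> s = -1) \<and> side y s)" for y
  have f: "f y = 1 \<or> f y = -1" "side y (f y)" if "y \<in> open_segment a b" for y
    using someI_ex[OF ex[OF that]] unfolding f_def by auto
  have par: "cross2 d (x - y) = 0" if xy: "x \<in> open_segment a b" "y \<in> open_segment a b" for x y
  proof -
    obtain t where t: "x = a + t *\<^sub>R d"
      using closed_segment_param[OF open_closed_segment[OF xy(1)]] unfolding d_def by blast
    obtain u where u: "y = a + u *\<^sub>R d"
      using closed_segment_param[OF open_closed_segment[OF xy(2)]] unfolding d_def by blast
    show ?thesis unfolding t u by simp
  qed
  have const: "f x = f y" if xy: "x \<in> open_segment a b" "y \<in> open_segment a b" for x y
  proof (rule connected_local_const[of "open_segment a b"])
    show "connected (open_segment a b)" by (intro convex_connected convex_segment)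
    show "\<forall>x\<in>open_segment a b. \<forall>\<^sub>F z in at x within open_segment a b. f x = f z"
    proof
      fix x assume x: "x \<in> open_segment a b"
      obtain e where e: "e > 0" "\<And>z. z \<in> ball x e \<Longrightarrow> 0 < f x * cross2 d (z - x) \<Longrightarrow> z \<in> inside \<Gamma>"
        "\<And>z. z \<in> ball x e \<Longrightarrow> f x * cross2 d (z - x) < 0 \<Longrightarrow> z \<in> outside \<Gamma>"
        using f(2)[OF x] unfolding side_def by blast
      have "f x = f z" if z: "z \<in> open_segment a b" "dist z x < e / 2" for z
      proof -
        have "side z (f x)"
          unfolding side_def
        proof (intro exI[of _ "e / 2"] conjI ballI)
          fix w assume w: "w \<in> ball z (e / 2)"
          have "dist x w \<le> dist x z + dist z w" by (rule dist_triangle)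
          then have "w \<in> ball x e" using w z(2) by (simp add: dist_commute)
          moreover have "cross2 d (w - x) = cross2 d (w - z)" using par[OF z(1) x] by simp
          ultimately show "0 < f x * cross2 d (w - z) \<longrightarrow> w \<in> inside \<Gamma>" "f x * cross2 d (w - z) < 0 \<longrightarrow> w \<in> outside \<Gamma>"
            using e(2,3)[of w] by (simp_all del: cross2_diff)
        qed (use e in auto)
        then show ?thesis using unique[of z "f x" "f z"] f[OF z(1)] f[OF x] by blast
      qed
      then show "\<forall>\<^sub>F z in at x within open_segment a b. f x = f z"
        unfolding eventually_at using e(1) by (intro exI[of _ "e / 2"]) auto
    qed
  qed (use xy in auto)
  have "midpoint a b \<in> open_segment a b" using ab by simp
  then obtain s where s: "s = 1 \<or> s = -1" "\<And>y. y \<in> open_segment a b \<Longrightarrow> side y s"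
    using f const by metis
  define N where "N = (s / norm d) *\<^sub>R (vector [d $ 2, - d $ 1] :: plane)"
  have ss: "s * s = 1" using s by auto
  have crossN: "s * cross2 d N = - norm d"
  proof -
    have "s * cross2 d N = - (s * s) / norm d * (d \<bullet> d)"
      by (simp add: N_def cross2_def inner_plane algebra_simps)
    also have "\<dots> = - norm d"
      using d0 unfolding ss by (simp add: power2_norm_eq_inner[symmetric] power2_eq_square)
    finally show ?thesis .
  qed
  have orth: "N \<bullet> (b - a) = 0" unfolding d_def[symmetric] by (simp add: N_def inner_plane)
  have normN: "norm N = 1"
  proof -
    have "norm (vector [d $ 2, - d $ 1] :: plane) = norm d"
      by (simp add: norm_eq_sqrt_inner inner_plane add.commute)
    then show ?thesis using d0 s by (auto simp: N_def)
  qed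
  have sideN: "\<forall>\<^sub>F t in at_right 0. y - t *\<^sub>R N \<in> inside \<Gamma> \<and> y + t *\<^sub>R N \<in> outside \<Gamma>"
    if y: "y \<in> open_segment a b" for y
  proof -
    obtain e where e: "e > 0" "\<And>z. z \<in> ball y e \<Longrightarrow> 0 < s * cross2 d (z - y) \<Longrightarrow> z \<in> inside \<Gamma>"
        "\<And>z. z \<in> ball y e \<Longrightarrow> s * cross2 d (z - y) < 0 \<Longrightarrow> z \<in> outside \<Gamma>"
      using s(2)[OF y] unfolding side_def by blast
    have "y - t *\<^sub>R N \<in> inside \<Gamma> \<and> y + t *\<^sub>R N \<in> outside \<Gamma>" if t: "0 < t" "t < e" for t
    proof -
      have b: "y - t *\<^sub>R N \<in> ball y e" "y + t *\<^sub>R N \<in> ball y e" using t normN by (auto simp: dist_norm)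
      have "s * cross2 d ((y - t *\<^sub>R N) - y) = - t * (s * cross2 d N)" by simp
      then have 1: "0 < s * cross2 d ((y - t *\<^sub>R N) - y)" unfolding crossN using t d0 by simp
      have "s * cross2 d ((y + t *\<^sub>R N) - y) = t * (s * cross2 d N)" by simp
      then have 2: "s * cross2 d ((y + t *\<^sub>R N) - y) < 0" unfolding crossN using t d0 by simp
      show ?thesis using e(2)[OF b(1) 1] e(3)[OF b(2) 2] by blast
    qed
    then show ?thesis unfolding eventually_at_right_field using e(1) by blast
  qed
  define good where "good n \<longleftrightarrow> norm n = 1 \<and> n \<bullet> (b - a) = 0 \<and>
     (\<forall>y\<in>open_segment a b. \<forall>\<^sub>F t in at_right 0. y - t *\<^sub>R n \<in> inside \<Gamma> \<and> y + t *\<^sub>R n \<notin> inside \<Gamma>)" for n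
  have io: "x \<notin> inside \<Gamma>" if "x \<in> outside \<Gamma>" for x using inside_Int_outside[of \<Gamma>] that by blast
  have good: "good N"
    unfolding good_def using normN orth
  proof (intro conjI ballI)
    fix y assume "y \<in> open_segment a b"
    from sideN[OF this] show "\<forall>\<^sub>F t in at_right 0. y - t *\<^sub>R N \<in> inside \<Gamma> \<and> y + t *\<^sub>R N \<notin> inside \<Gamma>"
      by (auto elim!: eventually_mono dest: io)
  qed
  have "n' = N" if n': "good n'" for n'
  proof -
    have "n' = N \<or> n' = - N"
      using n' normN orth ab by (intro unit_normals_cases[of _ _ "b - a"]) (auto simp: good_def)
    moreover have "n' \<noteq> - N"
    proof
      assume eq: "n' = - N"
      have y: "midpoint a b \<in> open_segment a b" using ab by simp
      have "\<forall>\<^sub>F t in at_right 0. midpoint a b - t *\<^sub>R n' \<in> inside \<Gamma>"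
        using n' y unfolding good_def by (auto elim!: eventually_mono dest!: bspec)
      moreover have "\<forall>\<^sub>F t in at_right 0. midpoint a b - t *\<^sub>R n' \<notin> inside \<Gamma>"
        using sideN[OF y] unfolding eq by (auto elim!: eventually_mono dest: io)
      ultimately have "\<forall>\<^sub>F t in at_right (0::real). False"
        by eventually_elim blast
      then show False by simp
    qed
    ultimately show ?thesis by blast
  qed
  then have "n = N" unfolding n_def outer_normal_def good_def[symmetric]
    using good by (intro the_equality)
  then show "norm n = 1" "n \<bullet> (b - a) = 0"
    "\<And>y. y \<in> open_segment a b \<Longrightarrow> \<forall>\<^sub>F t in at_right 0. y - t *\<^sub>R n \<in> inside \<Gamma> \<and> y + t *\<^sub>R n \<notin> inside \<Gamma>"
    using good by (auto simp: good_def)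
qed

section \<open>Variation of a piecewise constant function along a line\<close>

text \<open>A partition into open cells whose common boundaries inside \<open>\<Omega>\<close> are segments, in the form shared by
the primal and the dual mesh: \<open>k e\<close> and \<open>l e\<close> are the two cells adjacent to the edge \<open>e\<close>. The edges
may cross or overlap.\<close>

locale polygonal_partition =
  fixes \<Omega> :: "plane set" and I :: "'i set" and S :: "'i \<Rightarrow> plane set"
    and E :: "'e set" and a b :: "'e \<Rightarrow> plane" and k l :: "'e \<Rightarrow> 'i"
  assumes open_\<Omega>: "open \<Omega>"
    and finite_I: "finite I" and finite_E: "finite E"
    and open_S: "\<And>i. i \<in> I \<Longrightarrow> open (S i)"
    and S_subset: "\<And>i. i \<in> I \<Longrightarrow> S i \<subseteq> \<Omega>"
    and disjoint_S: "disjoint_family_on S I"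
    and negligible_rest: "negligible (\<Omega> - (\<Union>i\<in>I. S i))"
    and sides: "\<And>e. e \<in> E \<Longrightarrow> k e \<in> I \<and> l e \<in> I \<and> k e \<noteq> l e"
    and edge_subset: "\<And>e. e \<in> E \<Longrightarrow> closed_segment (a e) (b e) \<subseteq> frontier (S (k e)) \<inter> frontier (S (l e))"
    and frontier_edges: "\<And>i x. i \<in> I \<Longrightarrow> x \<in> \<Omega> \<Longrightarrow> x \<in> frontier (S i) \<Longrightarrow>
        \<exists>e\<in>E. (i = k e \<or> i = l e) \<and> x \<in> closed_segment (a e) (b e)"
begin

abbreviation seg :: "'e \<Rightarrow> plane set" where
  "seg e \<equiv> closed_segment (a e) (b e)"

definition jump :: "('i \<Rightarrow> real) \<Rightarrow> 'e \<Rightarrow> real" where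
  "jump u e = \<bar>u (k e) - u (l e)\<bar>"

lemma jump_nonneg [simp]: "0 \<le> jump u e"
  by (simp add: jump_def)

lemma same_cell: "x \<in> S i \<Longrightarrow> x \<in> S j \<Longrightarrow> i \<in> I \<Longrightarrow> j \<in> I \<Longrightarrow> i = j"
  using disjoint_S by (auto simp: disjoint_family_on_def)

lemma connected_open_in_cell:
  assumes "open H" "connected H" "H \<noteq> {}" "H \<subseteq> \<Omega>" and no_edge: "\<And>e. e \<in> E \<Longrightarrow> H \<inter> seg e = {}"
  obtains i where "i \<in> I" "H \<subseteq> S i"
proof -
  have "\<not> H \<subseteq> \<Omega> - (\<Union>i\<in>I. S i)"
    using negligible_rest negligible_subset open_not_negligible assms by blast
  then obtain i where i: "i \<in> I" "H \<inter> S i \<noteq> {}" using \<open>H \<subseteq> \<Omega>\<close> by blast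
  have "H \<inter> frontier (S i) = {}"
    using frontier_edges[OF i(1)] no_edge \<open>H \<subseteq> \<Omega>\<close> by blast
  then have "H - S i = {}"
    using connected_Int_frontier[OF \<open>connected H\<close> i(2)] by blast
  then show ?thesis using that[OF i(1)] by blast
qed

text \<open>The points that the lines under consideration must avoid: a line that misses them crosses each edge
at most once and transversally, and the edges through any of its points are collinear.\<close>

definition exceptional :: "plane set" where
  "exceptional = (\<Union>e\<in>E. {a e, b e}) \<union>
     (\<Union>e\<in>E. \<Union>e'\<in>{e'\<in>E. cross2 (b e - a e) (b e' - a e') \<noteq> 0}. seg e \<inter> seg e')"

lemma seg_direction:
  assumes "x \<in> closed_segment p q" "y \<in> closed_segment p q"
  obtains t where "x - y = t *\<^sub>R (q - p)"
proof -
  obtain t where t: "x = p + t *\<^sub>R (q - p)" using closed_segment_param[OF assms(1)] by blast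
  obtain s where s: "y = p + s *\<^sub>R (q - p)" using closed_segment_param[OF assms(2)] by blast
  have "x - y = (t - s) *\<^sub>R (q - p)" unfolding s t by (simp add: scaleR_diff_left)
  then show ?thesis by (rule that)
qed

lemma finite_exceptional: "finite exceptional"
proof -
  have "finite (seg e \<inter> seg e')" if "cross2 (b e - a e) (b e' - a e') \<noteq> 0" for e e'
  proof -
    have eq: "x = y" if x: "x \<in> seg e" "x \<in> seg e'" and y: "y \<in> seg e" "y \<in> seg e'" for x y
    proof -
      obtain t where t: "x - y = t *\<^sub>R (b e - a e)" using seg_direction[OF x(1) y(1)] by blast
      obtain s where s: "x - y = s *\<^sub>R (b e' - a e')" using seg_direction[OF x(2) y(2)] by blast
      have "cross2 (b e - a e) (x - y) = 0" unfolding t by (simp del: cross2_diff)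
      then have "s * cross2 (b e - a e) (b e' - a e') = 0" unfolding s by (simp del: cross2_diff cross2_left_simps)
      then show ?thesis using that s \<open>cross2 (b e - a e) (b e' - a e') \<noteq> 0\<close> by auto
    qed
    show ?thesis
    proof (cases "seg e \<inter> seg e' = {}")
      case False
      then obtain x where "x \<in> seg e \<inter> seg e'" by blast
      then have "seg e \<inter> seg e' \<subseteq> {x}" using eq by blast
      then show ?thesis by (rule finite_subset) simp
    qed (metis finite.emptyI)
  qed
  then show ?thesis unfolding exceptional_def using finite_E by (intro finite_UnI finite_UN_I) auto
qed

text \<open>All the edges through \<open>z\<close> lie on one line, with direction \<open>d\<close>, that is transversal to \<open>c\<close>. A small
disk around \<open>z\<close> minus this line consists of two half disks which meet no edge, so each of
them lies in one cell. If the cells \<open>i\<close>, \<open>j\<close> differ, \<open>z\<close> is on the boundary of \<open>i\<close>, hence on an edge of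
\<open>i\<close>; the other cell of this edge has points near \<open>z\<close> off the line, so it is \<open>j\<close>.\<close>

lemma jump_across_point:
  assumes z: "z \<in> \<Omega>" and c: "c \<noteq> 0"
    and trans: "\<And>e. e \<in> E \<Longrightarrow> z \<in> seg e \<Longrightarrow> cross2 c (b e - a e) \<noteq> 0"
    and par: "\<And>e e'. e \<in> E \<Longrightarrow> z \<in> seg e \<Longrightarrow> e' \<in> E \<Longrightarrow> z \<in> seg e' \<Longrightarrow> cross2 (b e - a e) (b e' - a e') = 0"
  obtains \<epsilon> i j where "0 < \<epsilon>" "i \<in> I" "j \<in> I"
    "\<And>\<tau>. - \<epsilon> < \<tau> \<Longrightarrow> \<tau> < 0 \<Longrightarrow> z + \<tau> *\<^sub>R c \<in> S i" "\<And>\<tau>. 0 < \<tau> \<Longrightarrow> \<tau> < \<epsilon> \<Longrightarrow> z + \<tau> *\<^sub>R c \<in> S j"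
    "\<bar>u i - u j\<bar> \<le> (\<Sum>e\<in>{e\<in>E. z \<in> seg e}. jump u e)"
proof -
  obtain d where d: "cross2 c d \<noteq> 0" "\<And>e. e \<in> E \<Longrightarrow> z \<in> seg e \<Longrightarrow> cross2 d (b e - a e) = 0"
  proof (cases "\<exists>e\<in>E. z \<in> seg e")
    case True
    then show ?thesis using that trans par by blast
  next
    case False
    have "cross2 c (vector [- c $ 2, c $ 1]) = c \<bullet> c" by (simp add: cross2_def inner_plane)
    then show ?thesis using False that[of "vector [- c $ 2, c $ 1]"] c by auto
  qed
  have d0: "d \<noteq> 0" using d(1) by auto
  have flat: "cross2 d (x - z) = 0" if e: "e \<in> E" "z \<in> seg e" "x \<in> seg e" for e x
  proof -
    obtain t where t: "x - z = t *\<^sub>R (b e - a e)" using seg_direction[OF e(3,2)] by blast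
    show ?thesis unfolding t using d(2)[OF e(1,2)] by (simp del: cross2_diff)
  qed
  define F where "F = \<Omega> - (\<Union>e\<in>{e\<in>E. z \<notin> seg e}. seg e)"
  have "open F" unfolding F_def using finite_E open_\<Omega> by (intro open_Diff closed_UN) auto
  moreover have "z \<in> F" using z by (auto simp: F_def)
  ultimately obtain \<epsilon> where \<epsilon>: "0 < \<epsilon>" "ball z \<epsilon> \<subseteq> F" by (meson open_contains_ball)
  define H where "H s = {x \<in> ball z \<epsilon>. 0 < s * cross2 d (x - z)}" for s :: real
  have H: "connected (H s)" "open (H s)" "s \<noteq> 0 \<Longrightarrow> H s \<noteq> {}" for s
    unfolding H_def using ball_half_plane[OF \<epsilon>(1) d0] by auto
  have H\<Omega>: "H s \<subseteq> \<Omega>" for s using \<epsilon>(2) by (auto simp: H_def F_def)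
  have Hseg: "H s \<inter> seg e = {}" if "e \<in> E" for s e
  proof (cases "z \<in> seg e")
    case True
    then show ?thesis using flat[OF that True] unfolding H_def by (auto simp del: cross2_diff)
  next
    case False
    then show ?thesis using \<epsilon>(2) that unfolding H_def F_def by blast
  qed
  define s where "s = cross2 d c"
  have s: "s \<noteq> 0" using d(1) cross2_commute[of c d] by (simp add: s_def)
  obtain i where i: "i \<in> I" "H (- s) \<subseteq> S i"
    using connected_open_in_cell[OF H(2,1) _ H\<Omega> Hseg, of "- s"] H(3)[of "- s"] s by auto
  obtain j where j: "j \<in> I" "H s \<subseteq> S j"
    using connected_open_in_cell[OF H(2,1) _ H\<Omega> Hseg, of s] H(3)[of s] s by auto
  have near: "\<exists>x\<in>H \<sigma>. dist x z < r" if "0 < r" "\<sigma> \<noteq> 0" for r \<sigma>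
  proof -
    have "{x \<in> ball z (min r \<epsilon>). 0 < \<sigma> * cross2 d (x - z)} \<noteq> {}"
      using that \<epsilon>(1) by (intro ball_half_plane(2) d0) auto
    then show ?thesis unfolding H_def by (auto simp del: cross2_diff simp: dist_commute)
  qed
  have bound: "\<bar>u i - u j\<bar> \<le> (\<Sum>e\<in>{e\<in>E. z \<in> seg e}. jump u e)"
  proof (cases "i = j")
    case True
    then show ?thesis by (simp add: sum_nonneg)
  next
    case False
    have "z \<notin> S i"
    proof
      assume "z \<in> S i"
      then obtain r where "0 < r" "ball z r \<subseteq> S i" using open_S[OF i(1)] by (meson open_contains_ball)
      moreover obtain x where "x \<in> H s" "dist x z < r" using near[OF \<open>0 < r\<close> s] by blast
      ultimately have "x \<in> H s" "x \<in> S i" by (auto simp: dist_commute)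
      then show False using same_cell[OF _ _ i(1) j(1)] j(2) False by blast
    qed
    moreover have "z \<in> closure (S i)"
      unfolding closure_approachable using near[of _ "- s"] s i(2) by (meson neg_equal_0_iff_equal subsetD)
    ultimately have "z \<in> frontier (S i)"
      using open_S[OF i(1)] by (simp add: frontier_def interior_open)
    then obtain e where e: "e \<in> E" "i = k e \<or> i = l e" "z \<in> seg e"
      using frontier_edges[OF i(1) z] by blast
    \<comment> \<open>the cell on the other side of \<open>e\<close>\<close>
    define w where "w = (if i = k e then l e else k e)"
    have w: "w \<in> I" "w \<noteq> i" "{i, w} = {k e, l e}" using sides[OF e(1)] e(2) by (auto simp: w_def)
    have "z \<in> frontier (S w)" using edge_subset[OF e(1)] e(3) w(3) by (auto simp: w_def)
    then have "z \<in> closure (S w)" by (simp add: frontier_def)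
    then obtain y where y: "y \<in> S w" "dist y z < \<epsilon>" using \<epsilon>(1) closure_approachable by blast
    have "open (S w \<inter> ball z \<epsilon>)" using open_S[OF w(1)] by (intro open_Int open_ball)
    then obtain r where r: "0 < r" "ball y r \<subseteq> S w \<inter> ball z \<epsilon>"
      using y unfolding open_contains_ball by (metis IntI dist_commute mem_ball)
    have "\<exists>x\<in>ball y r. cross2 d (x - z) \<noteq> 0"
    proof (cases "cross2 d (y - z) = 0")
      case True
      obtain x where x: "x \<in> ball y r" "0 < 1 * cross2 d (x - y)" using ball_half_plane(2)[OF r(1) d0, of 1] by auto
      then have "cross2 d (x - z) \<noteq> 0" using True by simp
      then show ?thesis using x by blast
    qed (use r in auto)
    then obtain x where x: "x \<in> S w" "x \<in> ball z \<epsilon>" "cross2 d (x - z) \<noteq> 0" using r by blast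
    then have "x \<in> H s \<or> x \<in> H (- s)" unfolding H_def using s by (auto simp: zero_less_mult_iff mult_less_0_iff linorder_neq_iff simp del: cross2_diff)
    then have "w = i \<or> w = j" using same_cell[OF x(1) _ w(1)] i j by blast
    then have "{k e, l e} = {i, j}" using w by auto
    then have "\<bar>u i - u j\<bar> = jump u e" by (auto simp: jump_def doubleton_eq_iff)
    also have "\<dots> \<le> (\<Sum>e\<in>{e\<in>E. z \<in> seg e}. jump u e)"
      using e finite_E by (intro member_le_sum) auto
    finally show ?thesis .
  qed
  show ?thesis
  proof (rule that[of "\<epsilon> / norm c" i j])
    show "0 < \<epsilon> / norm c" using \<epsilon>(1) c by simp
    have b: "z + \<tau> *\<^sub>R c \<in> ball z \<epsilon>" if "\<bar>\<tau>\<bar> < \<epsilon> / norm c" for \<tau>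
      using that c by (simp add: dist_norm field_simps)
    have ss: "0 < s * s" using s by (metis not_real_square_gt_zero)
    show "z + \<tau> *\<^sub>R c \<in> S i" if \<tau>: "- (\<epsilon> / norm c) < \<tau>" "\<tau> < 0" for \<tau>
    proof -
      have "0 < - \<tau> * (s * s)" using \<tau> ss by (intro mult_pos_pos[of _ "s * s"]) auto
      then have "z + \<tau> *\<^sub>R c \<in> H (- s)" using b[of \<tau>] \<tau> by (simp add: H_def s_def[symmetric] mult_ac)
      then show ?thesis using i by blast
    qed
    show "z + \<tau> *\<^sub>R c \<in> S j" if \<tau>: "0 < \<tau>" "\<tau> < \<epsilon> / norm c" for \<tau>
    proof -
      have "0 < \<tau> * (s * s)" using \<tau> ss by (intro mult_pos_pos[of _ "s * s"]) auto
      then have "z + \<tau> *\<^sub>R c \<in> H s" using b[of \<tau>] \<tau> by (simp add: H_def s_def[symmetric] mult_ac)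
      then show ?thesis using j by blast
    qed
  qed (use bound i j in auto)
qed

definition generic_line :: "plane \<Rightarrow> plane \<Rightarrow> bool" where
  "generic_line c x \<longleftrightarrow> (\<forall>q\<in>exceptional. cross2 c (q - x) \<noteq> 0)"

lemma generic_line_transversal:
  assumes generic: "generic_line c x" and e: "e \<in> E" "x + \<tau> *\<^sub>R c \<in> seg e"
  shows "cross2 c (b e - a e) \<noteq> 0"
proof
  assume 0: "cross2 c (b e - a e) = 0"
  obtain t where t: "x + \<tau> *\<^sub>R c = a e + t *\<^sub>R (b e - a e)" using closed_segment_param[OF e(2)] by blast
  then have "a e - x = \<tau> *\<^sub>R c - t *\<^sub>R (b e - a e)" by (simp add: algebra_simps)
  then have "cross2 c (a e - x) = \<tau> * cross2 c c - t * cross2 c (b e - a e)" by (simp only: cross2_diff cross2_scaleR)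
  then have "cross2 c (a e - x) = 0" using 0 by simp
  moreover have "a e \<in> exceptional" using e by (auto simp: exceptional_def)
  ultimately show False using generic unfolding generic_line_def by blast
qed

lemma generic_line_edges_parallel:
  assumes generic: "generic_line c x"
    and e: "e \<in> E" "x + \<tau> *\<^sub>R c \<in> seg e" "e' \<in> E" "x + \<tau> *\<^sub>R c \<in> seg e'"
  shows "cross2 (b e - a e) (b e' - a e') = 0"
proof (rule ccontr)
  assume "cross2 (b e - a e) (b e' - a e') \<noteq> 0"
  then have "x + \<tau> *\<^sub>R c \<in> exceptional" unfolding exceptional_def using e by blast
  then have "cross2 c (x + \<tau> *\<^sub>R c - x) \<noteq> 0" using generic unfolding generic_line_def by blast
  then show False by simp
qed

lemma generic_line_meets_once:
  assumes generic: "generic_line c x" and c: "c \<noteq> 0"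
    and e: "e \<in> E" "x + \<tau> *\<^sub>R c \<in> seg e" "x + \<tau>' *\<^sub>R c \<in> seg e"
  shows "\<tau> = \<tau>'"
proof -
  obtain t where t: "x + \<tau> *\<^sub>R c - (x + \<tau>' *\<^sub>R c) = t *\<^sub>R (b e - a e)" using seg_direction[OF e(2,3)] by blast
  have "cross2 c (x + \<tau> *\<^sub>R c - (x + \<tau>' *\<^sub>R c)) = 0" by simp
  then have "t * cross2 c (b e - a e) = 0" unfolding t by (simp only: cross2_scaleR)
  then have "t = 0" using generic_line_transversal[OF generic e(1,2)] by simp
  then have "(\<tau> - \<tau>') *\<^sub>R c = 0" using t by (simp add: algebra_simps)
  then show ?thesis using c by simp
qed

text \<open>The estimate for a short interval around any parameter is \<open>jump_across_point\<close>, and it is additive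
over adjacent intervals since no edge is met twice; Bolzano's bisection principle combines the
two facts. The value of the function at a point of an edge is replaced by its limit from the left,
which is why intervals are half-open and why \<open>\<tau> < \<beta>\<close> appears in \<open>V\<close>.\<close>

lemma variation_on_line:
  assumes c: "c \<noteq> 0" and in_\<Omega>: "\<And>\<tau>. 0 \<le> \<tau> \<Longrightarrow> \<tau> \<le> 1 \<Longrightarrow> x + \<tau> *\<^sub>R c \<in> \<Omega>"
    and generic: "generic_line c x"
    and \<alpha>\<beta>: "0 \<le> \<alpha>" "\<alpha> \<le> \<beta>" "\<beta> \<le> 1" and ij: "i \<in> I" "j \<in> I" "x + \<alpha> *\<^sub>R c \<in> S i" "x + \<beta> *\<^sub>R c \<in> S j"
  shows "\<bar>u i - u j\<bar> \<le> (\<Sum>e\<in>{e\<in>E. cross2 c (a e - x) * cross2 c (b e - x) \<le> 0}. jump u e)"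
proof -
  define left_in where "left_in \<tau> i \<longleftrightarrow> i \<in> I \<and> (\<exists>\<epsilon>>0. \<forall>\<sigma>. \<tau> - \<epsilon> < \<sigma> \<and> \<sigma> < \<tau> \<longrightarrow> x + \<sigma> *\<^sub>R c \<in> S i)" for \<tau> i
  have left_unique: "i = j" if ij: "left_in \<tau> i" "left_in \<tau> j" for \<tau> i j
  proof -
    obtain e where e: "e > 0" "\<And>\<sigma>. \<tau> - e < \<sigma> \<Longrightarrow> \<sigma> < \<tau> \<Longrightarrow> x + \<sigma> *\<^sub>R c \<in> S i"
      using ij(1) unfolding left_in_def by blast
    obtain e' where e': "e' > 0" "\<And>\<sigma>. \<tau> - e' < \<sigma> \<Longrightarrow> \<sigma> < \<tau> \<Longrightarrow> x + \<sigma> *\<^sub>R c \<in> S j"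
      using ij(2) unfolding left_in_def by blast
    define \<sigma> where "\<sigma> = \<tau> - min e e' / 2"
    have "x + \<sigma> *\<^sub>R c \<in> S i" "x + \<sigma> *\<^sub>R c \<in> S j"
      using e(1) e'(1) by (auto intro!: e(2) e'(2) simp: \<sigma>_def min_def)
    then show ?thesis using same_cell ij unfolding left_in_def by blast
  qed
  define L where "L \<tau> = (SOME i. left_in \<tau> i)" for \<tau>
  have L: "L \<tau> = i" if "left_in \<tau> i" for \<tau> i
    unfolding L_def using that left_unique by (intro some_equality) auto
  define V where "V \<alpha> \<beta> = (\<Sum>e\<in>{e\<in>E. \<exists>\<tau>. \<alpha> \<le> \<tau> \<and> \<tau> < \<beta> \<and> x + \<tau> *\<^sub>R c \<in> seg e}. jump u e)" for \<alpha> \<beta>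
  define P where "P \<alpha> \<beta> \<longleftrightarrow> (0 \<le> \<alpha> \<and> \<beta> \<le> 1 \<longrightarrow> \<bar>u (L \<alpha>) - u (L \<beta>)\<bar> \<le> V \<alpha> \<beta>)" for \<alpha> \<beta>
  have "P \<alpha> \<beta>"
    using \<open>\<alpha> \<le> \<beta>\<close>
  proof (induction rule: Bolzano)
    case (trans p q r)
    have "V p q + V q r = (\<Sum>e\<in>{e\<in>E. \<exists>\<tau>. p \<le> \<tau> \<and> \<tau> < q \<and> x + \<tau> *\<^sub>R c \<in> seg e} \<union> {e\<in>E. \<exists>\<tau>. q \<le> \<tau> \<and> \<tau> < r \<and> x + \<tau> *\<^sub>R c \<in> seg e}. jump u e)"
      unfolding V_def
    proof (rule sum.union_disjoint[symmetric])
      show "{e\<in>E. \<exists>\<tau>. p \<le> \<tau> \<and> \<tau> < q \<and> x + \<tau> *\<^sub>R c \<in> seg e} \<inter> {e\<in>E. \<exists>\<tau>. q \<le> \<tau> \<and> \<tau> < r \<and> x + \<tau> *\<^sub>R c \<in> seg e} = {}"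
      proof -
        have "False" if "e \<in> E" "\<tau> < q" "q \<le> \<tau>'" "x + \<tau> *\<^sub>R c \<in> seg e" "x + \<tau>' *\<^sub>R c \<in> seg e" for e \<tau> \<tau>'
          using generic_line_meets_once[OF generic c that(1,4,5)] that(2,3) by simp
        then show ?thesis by blast
      qed
    qed (use finite_E in auto)
    also have "\<dots> \<le> V p r" unfolding V_def
      using finite_E trans(3,4) by (intro sum_mono2) (auto intro: order.trans less_le_trans)
    finally show ?case using trans unfolding P_def by auto
  next
    case (local \<tau>)
    then have \<tau>: "0 \<le> \<tau>" "\<tau> \<le> 1" using \<alpha>\<beta> by auto
    have tr: "cross2 c (b e - a e) \<noteq> 0" if "e \<in> E" "x + \<tau> *\<^sub>R c \<in> seg e" for e
      using generic_line_transversal[OF generic that] .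
    have pa: "cross2 (b e - a e) (b e' - a e') = 0"
      if "e \<in> E" "x + \<tau> *\<^sub>R c \<in> seg e" "e' \<in> E" "x + \<tau> *\<^sub>R c \<in> seg e'" for e e'
      using generic_line_edges_parallel[OF generic that] .
    obtain \<epsilon> i j where e: "0 < \<epsilon>" "i \<in> I" "j \<in> I"
      "\<And>\<sigma>. - \<epsilon> < \<sigma> \<Longrightarrow> \<sigma> < 0 \<Longrightarrow> x + \<tau> *\<^sub>R c + \<sigma> *\<^sub>R c \<in> S i"
      "\<And>\<sigma>. 0 < \<sigma> \<Longrightarrow> \<sigma> < \<epsilon> \<Longrightarrow> x + \<tau> *\<^sub>R c + \<sigma> *\<^sub>R c \<in> S j"
      "\<bar>u i - u j\<bar> \<le> (\<Sum>e\<in>{e\<in>E. x + \<tau> *\<^sub>R c \<in> seg e}. jump u e)"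
      by (rule jump_across_point[OF in_\<Omega>[OF \<tau>] c tr pa, where u = u]) (assumption | rule that)+
    have li: "left_in \<sigma> i" if "\<tau> - \<epsilon> < \<sigma>" "\<sigma> \<le> \<tau>" for \<sigma>
      unfolding left_in_def
    proof (intro conjI exI[of _ "\<sigma> - (\<tau> - \<epsilon>)"] allI impI)
      fix \<rho> assume "\<sigma> - (\<sigma> - (\<tau> - \<epsilon>)) < \<rho> \<and> \<rho> < \<sigma>"
      then show "x + \<rho> *\<^sub>R c \<in> S i" using e(4)[of "\<rho> - \<tau>"] that by (simp add: algebra_simps)
    qed (use that e in auto)
    have lj: "left_in \<sigma> j" if "\<tau> < \<sigma>" "\<sigma> < \<tau> + \<epsilon>" for \<sigma>
      unfolding left_in_def
    proof (intro conjI exI[of _ "\<sigma> - \<tau>"] allI impI)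
      fix \<rho> assume "\<sigma> - (\<sigma> - \<tau>) < \<rho> \<and> \<rho> < \<sigma>"
      then show "x + \<rho> *\<^sub>R c \<in> S j" using e(5)[of "\<rho> - \<tau>"] that by (simp add: algebra_simps)
    qed (use that e in auto)
    show ?case
    proof (intro exI[of _ \<epsilon>] conjI allI impI)
      fix p q assume pq: "p \<le> \<tau> \<and> \<tau> \<le> q \<and> q - p < \<epsilon>"
      have Lp: "L p = i" using pq by (intro L li) auto
      have V0: "0 \<le> V p q" unfolding V_def by (intro sum_nonneg) auto
      show "P p q"
      proof (cases "\<tau> = q")
        case True
        then have "L q = i" using pq e(1) by (intro L li) auto
        then show ?thesis using Lp V0 by (simp add: P_def)
      next
        case False
        then have "L q = j" using pq by (intro L lj) auto
        have "(\<Sum>e\<in>{e\<in>E. x + \<tau> *\<^sub>R c \<in> seg e}. jump u e) \<le> V p q"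
          unfolding V_def using finite_E pq False by (intro sum_mono2) (auto simp: less_le)
        then show ?thesis using Lp \<open>L q = j\<close> e(6) by (simp add: P_def)
      qed
    qed (use e in auto)
  qed
  moreover have near: "left_in \<tau> i" if cell: "i \<in> I" "x + \<tau> *\<^sub>R c \<in> S i" for \<tau> i
  proof -
    obtain r where r: "0 < r" "ball (x + \<tau> *\<^sub>R c) r \<subseteq> S i"
      using open_S[OF cell(1)] cell(2) by (meson open_contains_ball)
    show ?thesis unfolding left_in_def
    proof (intro conjI exI[of _ "r / norm c"] allI impI)
      fix \<sigma> assume \<sigma>: "\<tau> - r / norm c < \<sigma> \<and> \<sigma> < \<tau>"
      have "dist (x + \<tau> *\<^sub>R c) (x + \<sigma> *\<^sub>R c) = \<bar>\<tau> - \<sigma>\<bar> * norm c"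
        by (simp add: dist_norm scaleR_diff_left[symmetric])
      also have "\<dots> < r" using \<sigma> c by (simp add: field_simps)
      finally show "x + \<sigma> *\<^sub>R c \<in> S i" using r(2) by auto
    qed (use r c that in auto)
  qed
  ultimately have "\<bar>u i - u j\<bar> \<le> V \<alpha> \<beta>"
    using L[OF near[OF ij(1,3)]] L[OF near[OF ij(2,4)]] \<alpha>\<beta> by (simp add: P_def)
  also have "\<dots> \<le> (\<Sum>e\<in>{e\<in>E. cross2 c (a e - x) * cross2 c (b e - x) \<le> 0}. jump u e)"
    unfolding V_def
  proof (intro sum_mono2)
    show "{e \<in> E. \<exists>\<tau>. \<alpha> \<le> \<tau> \<and> \<tau> < \<beta> \<and> x + \<tau> *\<^sub>R c \<in> seg e} \<subseteq> {e \<in> E. cross2 c (a e - x) * cross2 c (b e - x) \<le> 0}"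
    proof clarify
      fix e \<tau> assume e: "e \<in> E" "x + \<tau> *\<^sub>R c \<in> seg e"
      obtain t where t: "0 \<le> t" "t \<le> 1" "x + \<tau> *\<^sub>R c = (1 - t) *\<^sub>R a e + t *\<^sub>R b e"
        using e(2) by (auto simp: in_segment)
      have "\<tau> *\<^sub>R c = (1 - t) *\<^sub>R (a e - x) + t *\<^sub>R (b e - x)" using t(3) by (simp add: algebra_simps)
      then have "\<tau> * cross2 c c = (1 - t) * cross2 c (a e - x) + t * cross2 c (b e - x)"
        by (metis cross2_add cross2_scaleR)
      then have 0: "(1 - t) * cross2 c (a e - x) + t * cross2 c (b e - x) = 0" by (simp del: cross2_diff)
      show "cross2 c (a e - x) * cross2 c (b e - x) \<le> 0"
      proof (rule ccontr)
        assume "\<not> ?thesis"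
        then consider "0 < cross2 c (a e - x)" "0 < cross2 c (b e - x)" | "cross2 c (a e - x) < 0" "cross2 c (b e - x) < 0"
          by (metis not_le zero_less_mult_iff)
        then show False
        proof cases
          case 1
          then have "0 < (1 - t) * cross2 c (a e - x) + t * cross2 c (b e - x)"
            using t by (cases "t = 0") (auto intro!: add_nonneg_pos simp del: cross2_diff)
          then show False using 0 by simp
        next
          case 2
          then have "(1 - t) * cross2 c (a e - x) + t * cross2 c (b e - x) < 0"
            using t by (cases "t = 0") (auto intro!: add_nonpos_neg simp: mult_nonneg_nonpos mult_pos_neg simp del: cross2_diff)
          then show False using 0 by simp
        qed
      qed
    qed
  qed (use finite_E in auto)
  finally show ?thesis .
qed

end

section \<open>Integration in oblique coordinates\<close>

lemma borel_measurable_linear: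
  fixes f :: "'a::euclidean_space \<Rightarrow> 'b::euclidean_space"
  assumes "linear f"
  shows "f \<in> borel_measurable borel"
  using linear_continuous_on[of f UNIV] assms
  by (intro borel_measurable_continuous_onI) (simp add: linear_conv_bounded_linear)

lemma linear_vector2: "linear (\<lambda>(s, t). vector [s, t] :: plane)"
  by (rule linearI) (auto simp: plane_eq_iff)

text \<open>Fubini's theorem speaks about products, whereas \<open>plane\<close> is a type of vectors indexed by a
two-element type.\<close>

lemma lborel_plane: "(lborel :: plane measure) = distr (lborel \<Otimes>\<^sub>M lborel) borel (\<lambda>(s, t). vector [s, t])"
proof (rule lborel_eqI)
  let ?V = "\<lambda>(s, t). vector [s, t] :: plane"
  have [measurable]: "?V \<in> borel_measurable (lborel \<Otimes>\<^sub>M lborel)"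
    unfolding lborel_prod using borel_measurable_linear[OF linear_vector2] by simp
  fix l u :: plane
  assume le: "\<And>b. b \<in> Basis \<Longrightarrow> l \<bullet> b \<le> u \<bullet> b"
  have le': "l $ 1 \<le> u $ 1" "l $ 2 \<le> u $ 2"
    using le[of "axis 1 1"] le[of "axis 2 1"] by (auto simp: inner_axis axis_in_Basis_iff)
  have "?V -` box l u \<inter> space (lborel \<Otimes>\<^sub>M lborel) = {l $ 1<..<u $ 1} \<times> {l $ 2<..<u $ 2}"
    by (auto simp: space_pair_measure mem_box_cart forall_2)
  then have "emeasure (distr (lborel \<Otimes>\<^sub>M lborel) borel ?V) (box l u)
      = emeasure (lborel \<Otimes>\<^sub>M lborel) ({l $ 1<..<u $ 1} \<times> {l $ 2<..<u $ 2})"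
    by (subst emeasure_distr) auto
  also have "\<dots> = ennreal (u $ 1 - l $ 1) * ennreal (u $ 2 - l $ 2)"
    using le' by (subst lborel.emeasure_pair_measure_Times) auto
  also have "\<dots> = ennreal (\<Prod>b\<in>Basis. (u - l) \<bullet> b)"
  proof -
    have "(\<Prod>b\<in>Basis. (u - l) \<bullet> b) = (\<Prod>i\<in>UNIV. (u - l) $ i)"
      by (simp add: Basis_vec_def UNION_singleton_eq_range prod.reindex inj_on_def axis_eq_axis inner_axis)
    also have "\<dots> = (u $ 1 - l $ 1) * (u $ 2 - l $ 2)" unfolding UNIV_2 by simp
    finally show ?thesis using le' by (simp add: ennreal_mult)
  qed
  finally show "emeasure (distr (lborel \<Otimes>\<^sub>M lborel) borel ?V) (box l u) = ennreal (\<Prod>b\<in>Basis. (u - l) \<bullet> b)" .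
qed simp

text \<open>Lebesgue measure is determined by its values on boxes, and the measure of the preimage of a box
is known because \<open>cross2 c1 c2\<close> is the determinant of the linear map.\<close>

lemma lborel_oblique:
  fixes c1 c2 :: plane
  assumes D: "cross2 c1 c2 \<noteq> 0"
  shows "(lborel :: plane measure)
    = density (distr lborel borel (\<lambda>x :: plane. x $ 1 *\<^sub>R c1 + x $ 2 *\<^sub>R c2)) (\<lambda>_. ennreal \<bar>cross2 c1 c2\<bar>)"
proof (rule lborel_eqI)
  let ?M = "\<lambda>x :: plane. x $ 1 *\<^sub>R c1 + x $ 2 *\<^sub>R c2"
  let ?D = "cross2 c1 c2"
  let ?N = "\<lambda>x. vector [cross2 x c2 / ?D, cross2 c1 x / ?D] :: plane"
  have linM: "linear ?M" by (rule linearI) (auto simp: algebra_simps)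
  have linN: "linear ?N" by (rule linearI) (auto simp: plane_eq_iff add_divide_distrib)
  have NM: "?N (?M x) = x" for x
    using D cross2_commute[of c2 c1] by (simp add: plane_eq_iff)
  have MN: "?M (?N x) = x" for x
  proof -
    have "?D *\<^sub>R ?M (?N x) = cross2 x c2 *\<^sub>R c1 + cross2 c1 x *\<^sub>R c2" using D by (simp add: scaleR_add_right)
    also have "\<dots> = ?D *\<^sub>R x" by (simp add: plane_eq_iff cross2_def algebra_simps)
    finally show ?thesis by (rule scaleR_left_imp_eq[OF D])
  qed
  have [measurable]: "?M \<in> borel_measurable lborel"
    using borel_measurable_linear[OF linM] by simp
  fix l u :: plane
  assume le: "\<And>b. b \<in> Basis \<Longrightarrow> l \<bullet> b \<le> u \<bullet> b"
  define P where "P = ?M -` box l u"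
  have PN: "P = ?N ` box l u"
  proof (intro set_eqI iffI)
    fix x assume "x \<in> P"
    then have "?M x \<in> box l u" unfolding P_def by simp
    from imageI[OF this, of ?N] show "x \<in> ?N ` box l u" unfolding NM .
  next
    fix x assume "x \<in> ?N ` box l u"
    then obtain y where "y \<in> box l u" "x = ?N y" by blast
    then show "x \<in> P" unfolding P_def vimage_eq using MN[of y] by simp
  qed
  have "open P" unfolding P_def
    using linear_continuous_on[of ?M UNIV] linM by (intro open_vimage) (auto simp: linear_conv_bounded_linear)
  moreover have "bounded P" unfolding PN
    using linN by (intro bounded_linear_image bounded_box) (auto simp: linear_conv_bounded_linear)
  ultimately have Plm: "P \<in> lmeasurable" by (rule lmeasurable_open[rotated])
  have Pb: "P \<in> sets borel" using \<open>open P\<close> by simp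
  have "?M ` P = box l u"
  proof (intro set_eqI iffI)
    fix x assume "x \<in> ?M ` P"
    then show "x \<in> box l u" unfolding P_def by auto
  next
    fix x assume "x \<in> box l u"
    then have "?N x \<in> P" unfolding PN by (rule imageI)
    from imageI[OF this, of ?M] show "x \<in> ?M ` P" unfolding MN .
  qed
  then have "measure lebesgue (box l u) = \<bar>det (matrix ?M)\<bar> * measure lebesgue P"
    using measure_linear_image[OF linM Plm] by simp
  moreover have "det (matrix ?M) = ?D"
    by (simp add: det_2 matrix_def axis_def cross2_def)
  ultimately have "\<bar>?D\<bar> * measure lebesgue P = measure lebesgue (box l u)" by simp
  moreover have "emeasure lborel P = ennreal (measure lebesgue P)"
    using emeasure_bounded_finite[OF \<open>bounded P\<close>] Pb
    by (simp add: emeasure_eq_ennreal_measure measure_completion less_top)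
  ultimately have e: "ennreal \<bar>?D\<bar> * emeasure lborel P = ennreal (measure lebesgue (box l u))"
    by (metis abs_ge_zero ennreal_mult measure_nonneg)
  have "emeasure (density (distr lborel borel ?M) (\<lambda>_. ennreal \<bar>?D\<bar>)) (box l u) = ennreal \<bar>?D\<bar> * emeasure lborel P"
    by (subst emeasure_density_const) (auto simp: emeasure_distr P_def)
  also have "\<dots> = ennreal (\<Prod>b\<in>Basis. (u - l) \<bullet> b)"
    unfolding e using le by (simp add: measure_lborel_box_eq)
  finally show "emeasure (density (distr lborel borel ?M) (\<lambda>_. ennreal \<bar>?D\<bar>)) (box l u) = ennreal (\<Prod>b\<in>Basis. (u - l) \<bullet> b)" .
qed simp

lemma nn_integral_oblique:
  fixes c1 c2 :: plane and f :: "plane \<Rightarrow> ennreal"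
  assumes D: "cross2 c1 c2 \<noteq> 0" and f[measurable]: "f \<in> borel_measurable borel"
  shows "(\<integral>\<^sup>+x. f x \<partial>lborel)
    = ennreal \<bar>cross2 c1 c2\<bar> * (\<integral>\<^sup>+s. \<integral>\<^sup>+t. f (s *\<^sub>R c1 + t *\<^sub>R c2) \<partial>lborel \<partial>lborel)"
proof -
  let ?M = "\<lambda>x :: plane. x $ 1 *\<^sub>R c1 + x $ 2 *\<^sub>R c2"
  have linM: "linear ?M" by (rule linearI) (auto simp: algebra_simps)
  have [measurable]: "?M \<in> borel_measurable borel"
    by (rule borel_measurable_linear[OF linM])
  have [measurable]: "(\<lambda>(s, t). vector [s, t] :: plane) \<in> borel_measurable (lborel \<Otimes>\<^sub>M lborel)"
    unfolding lborel_prod using borel_measurable_linear[OF linear_vector2] by simp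
  have "(\<integral>\<^sup>+x. f x \<partial>lborel) = ennreal \<bar>cross2 c1 c2\<bar> * (\<integral>\<^sup>+x. f (?M x) \<partial>lborel)"
    by (subst lborel_oblique[OF D]) (simp add: nn_integral_density nn_integral_distr nn_integral_cmult)
  also have "(\<integral>\<^sup>+x. f (?M x) \<partial>lborel) = (\<integral>\<^sup>+z. f (?M (case z of (s, t) \<Rightarrow> vector [s, t])) \<partial>(lborel \<Otimes>\<^sub>M lborel))"
    by (subst lborel_plane) (simp add: nn_integral_distr)
  also have "\<dots> = (\<integral>\<^sup>+z. f (case z of (s, t) \<Rightarrow> s *\<^sub>R c1 + t *\<^sub>R c2) \<partial>(lborel \<Otimes>\<^sub>M lborel))"
    by (simp add: case_prod_unfold)
  also have "\<dots> = (\<integral>\<^sup>+s. \<integral>\<^sup>+t. f (s *\<^sub>R c1 + t *\<^sub>R c2) \<partial>lborel \<partial>lborel)"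
    by (subst lborel.nn_integral_fst[symmetric]) (simp_all add: case_prod_unfold)
  finally show ?thesis .
qed

section \<open>The embedding of BV into L2 for functions constant on cells\<close>

context polygonal_partition
begin

definition step_fun :: "('i \<Rightarrow> real) \<Rightarrow> plane \<Rightarrow> ennreal" where
  "step_fun w x = (\<Sum>i\<in>I. ennreal (w i) * indicator (S i) x)"

lemma sum_indicator_cell:
  fixes y :: "'i \<Rightarrow> 'b::semiring_1"
  assumes i: "i \<in> I" "x \<in> S i"
  shows "(\<Sum>j\<in>I. y j * indicator (S j) x) = y i"
proof -
  have "y j * indicator (S j) x = (if j = i then y j else 0)" if "j \<in> I" for j
  proof (cases "j = i")
    case False
    then have "x \<notin> S j" using same_cell[OF i(2) _ i(1) that] by blast
    then show ?thesis using False by simp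
  qed (use i in simp)
  then have "(\<Sum>j\<in>I. y j * indicator (S j) x) = (\<Sum>j\<in>I. if j = i then y j else 0)"
    by (intro sum.cong) auto
  then show ?thesis using finite_I i by simp
qed

lemma step_fun_cell: "i \<in> I \<Longrightarrow> x \<in> S i \<Longrightarrow> step_fun w x = ennreal (w i)"
  unfolding step_fun_def by (rule sum_indicator_cell)

lemma step_fun_outside: "x \<notin> (\<Union>i\<in>I. S i) \<Longrightarrow> step_fun w x = 0"
  unfolding step_fun_def by (intro sum.neutral) auto

lemma borel_S [measurable]: "i \<in> I \<Longrightarrow> S i \<in> sets borel"
  using open_S by simp

lemma measurable_step_fun [measurable]: "step_fun w \<in> borel_measurable borel"
  unfolding step_fun_def by measurable

lemma point_in_cell:
  assumes "z \<in> \<Omega>" and no_edge: "\<And>e. e \<in> E \<Longrightarrow> z \<notin> seg e"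
  obtains i where "i \<in> I" "z \<in> S i"
proof -
  have "open (\<Omega> - (\<Union>e\<in>E. seg e))" using finite_E open_\<Omega> by (intro open_Diff closed_UN) auto
  then obtain r where r: "0 < r" "ball z r \<subseteq> \<Omega> - (\<Union>e\<in>E. seg e)"
    using assms unfolding open_contains_ball by blast
  have "\<exists>i\<in>I. ball z r \<subseteq> S i"
  proof (rule connected_open_in_cell)
    show "ball z r \<noteq> {}" using r by auto
    show "\<And>e. e \<in> E \<Longrightarrow> ball z r \<inter> seg e = {}" "ball z r \<subseteq> \<Omega>" using r by auto
  qed auto
  then show ?thesis using that r(1) by (meson centre_in_ball subsetD)
qed

text \<open>The integral of \<open>\<bar>u\<bar>\<close> over the line through \<open>x\<close> with direction \<open>c\<close>, plus the jumps across the edges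
whose endpoints are not strictly on the same side of this line. It is constant along the line
(\<open>line_bound_shift\<close>).\<close>

definition line_bound :: "plane \<Rightarrow> ('i \<Rightarrow> real) \<Rightarrow> plane \<Rightarrow> ennreal" where
  "line_bound c u x = (\<integral>\<^sup>+\<sigma>. step_fun (\<lambda>i. \<bar>u i\<bar>) (x + \<sigma> *\<^sub>R c) \<partial>lborel)
     + (\<Sum>e\<in>E. ennreal (jump u e) * indicator {y. cross2 c (a e - y) * cross2 c (b e - y) \<le> 0} x)"

text \<open>For almost every point of the segment from \<open>x\<close> to \<open>x + c\<close>, the value at \<open>x\<close> is at most the value at that
point plus the sum of the jumps; this is averaged over the segment.\<close>

lemma step_fun_le_line_bound:
  assumes c: "c \<noteq> 0" and in_\<Omega>: "\<And>\<tau>. 0 \<le> \<tau> \<Longrightarrow> \<tau> \<le> 1 \<Longrightarrow> x + \<tau> *\<^sub>R c \<in> \<Omega>" and generic: "generic_line c x"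
  shows "step_fun (\<lambda>i. \<bar>u i\<bar>) x \<le> line_bound c u x"
proof (cases "x \<in> (\<Union>i\<in>I. S i)")
  case False
  then show ?thesis by (simp add: step_fun_outside)
next
  case True
  then obtain i where i: "i \<in> I" "x \<in> S i" by blast
  let ?v = "step_fun (\<lambda>i. \<bar>u i\<bar>)"
  define J where "J = (\<Sum>e\<in>{e\<in>E. cross2 c (a e - x) * cross2 c (b e - x) \<le> 0}. jump u e)"
  have J0: "0 \<le> J" unfolding J_def by (intro sum_nonneg) auto
  have J: "ennreal J = (\<Sum>e\<in>E. ennreal (jump u e) * indicator {y. cross2 c (a e - y) * cross2 c (b e - y) \<le> 0} x)"
  proof -
    have "ennreal J = (\<Sum>e\<in>{e\<in>E. cross2 c (a e - x) * cross2 c (b e - x) \<le> 0}. ennreal (jump u e))"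
      unfolding J_def by (rule sum_ennreal[symmetric]) simp
    also have "\<dots> = (\<Sum>e\<in>E. if cross2 c (a e - x) * cross2 c (b e - x) \<le> 0 then ennreal (jump u e) else 0)"
      using finite_E by (rule sum.inter_filter)
    also have "\<dots> = (\<Sum>e\<in>E. ennreal (jump u e) * indicator {y. cross2 c (a e - y) * cross2 c (b e - y) \<le> 0} x)"
      by (intro sum.cong) (auto simp: indicator_def)
    finally show ?thesis .
  qed
  define N where "N = (\<Union>e\<in>E. {\<tau>. x + \<tau> *\<^sub>R c \<in> seg e})"
  have "finite N"
    unfolding N_def
  proof (intro finite_UN_I finite_E)
    fix e assume "e \<in> E"
    show "finite {\<tau>. x + \<tau> *\<^sub>R c \<in> seg e}"
    proof (cases "{\<tau>. x + \<tau> *\<^sub>R c \<in> seg e} = {}")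
      case False
      then obtain \<tau> where "x + \<tau> *\<^sub>R c \<in> seg e" by blast
      then have "{\<tau>. x + \<tau> *\<^sub>R c \<in> seg e} \<subseteq> {\<tau>}" using generic_line_meets_once[OF generic c \<open>e \<in> E\<close>] by blast
      then show ?thesis by (rule finite_subset) simp
    qed (metis finite.emptyI)
  qed
  have pointwise: "?v x \<le> ?v (x + \<tau> *\<^sub>R c) + ennreal J" if \<tau>: "\<tau> \<in> {0..1}" "\<tau> \<notin> N" for \<tau>
  proof -
    obtain j where j: "j \<in> I" "x + \<tau> *\<^sub>R c \<in> S j"
      using point_in_cell[of "x + \<tau> *\<^sub>R c"] in_\<Omega>[of \<tau>] \<tau> unfolding N_def by auto
    have "\<bar>u i - u j\<bar> \<le> J"
      unfolding J_def using \<tau> i j by (intro variation_on_line[OF c in_\<Omega> generic, of 0 \<tau>]) auto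
    then have "\<bar>u i\<bar> \<le> \<bar>u j\<bar> + J" by simp
    then have "ennreal \<bar>u i\<bar> \<le> ennreal \<bar>u j\<bar> + ennreal J"
      using J0 by (simp add: ennreal_plus[symmetric] del: ennreal_plus)
    then show ?thesis using step_fun_cell[OF i] step_fun_cell[OF j] by simp
  qed
  have [measurable]: "(\<lambda>\<tau>. x + \<tau> *\<^sub>R c) \<in> borel_measurable borel" by measurable
  have AE_N: "AE \<tau> in lborel. \<tau> \<notin> N" using \<open>finite N\<close> by (intro AE_not_in finite_imp_null_set_lborel)
  have "?v x = (\<integral>\<^sup>+\<tau>. ?v x * indicator {0..1::real} \<tau> \<partial>lborel)" by (simp add: nn_integral_cmult)
  also have "\<dots> \<le> (\<integral>\<^sup>+\<tau>. ?v (x + \<tau> *\<^sub>R c) + ennreal J * indicator {0..1} \<tau> \<partial>lborel)"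
  proof (rule nn_integral_mono_AE)
    show "AE \<tau> in lborel. ?v x * indicator {0..1} \<tau> \<le> ?v (x + \<tau> *\<^sub>R c) + ennreal J * indicator {0..1} \<tau>"
      using AE_N
    proof eventually_elim
      case (elim \<tau>)
      then show ?case using pointwise[of \<tau>] by (cases "\<tau> \<in> {0..1}") auto
    qed
  qed
  also have "\<dots> = (\<integral>\<^sup>+\<tau>. ?v (x + \<tau> *\<^sub>R c) \<partial>lborel) + ennreal J"
    by (simp add: nn_integral_add nn_integral_cmult)
  finally show ?thesis unfolding line_bound_def J .
qed

lemma line_bound_shift: "line_bound c u (x + s *\<^sub>R c) = line_bound c u x"
proof -
  let ?v = "step_fun (\<lambda>i. \<bar>u i\<bar>)"
  have "(\<integral>\<^sup>+\<sigma>. ?v (x + \<sigma> *\<^sub>R c) \<partial>lborel) = (\<integral>\<^sup>+\<sigma>. ?v (x + (s + 1 * \<sigma>) *\<^sub>R c) \<partial>lborel)"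
    by (subst nn_integral_real_affine[where c = 1 and t = s]) simp_all
  also have "\<dots> = (\<integral>\<^sup>+\<sigma>. ?v (x + s *\<^sub>R c + \<sigma> *\<^sub>R c) \<partial>lborel)"
    by (simp add: algebra_simps)
  finally show ?thesis unfolding line_bound_def by (simp add: indicator_def)
qed

lemma measurable_cross2 [measurable]: "(\<lambda>x. cross2 c x) \<in> borel_measurable borel"
  unfolding cross2_def by (intro borel_measurable_continuous_onI continuous_intros)

lemma measurable_line_bound [measurable]: "line_bound c u \<in> borel_measurable borel"
  unfolding line_bound_def by measurable

definition total_variation :: "('i \<Rightarrow> real) \<Rightarrow> real" where
  "total_variation u = (\<Sum>e\<in>E. dist (a e) (b e) * jump u e)"

text \<open>Integrating over all lines with direction \<open>c\<close> turns the integrals over lines into an integral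
over the plane, and the indicator of the lines that meet an edge into the length of the projection
of that edge along \<open>c\<close>.\<close>

lemma nn_integral_line_bound:
  assumes D: "cross2 c c' \<noteq> 0"
  shows "ennreal \<bar>cross2 c c'\<bar> * (\<integral>\<^sup>+t. line_bound c u (t *\<^sub>R c') \<partial>lborel)
    \<le> (\<integral>\<^sup>+x. step_fun (\<lambda>i. \<bar>u i\<bar>) x \<partial>lborel) + ennreal (norm c * total_variation u)"
proof -
  let ?v = "step_fun (\<lambda>i. \<bar>u i\<bar>)"
  let ?D = "cross2 c c'"
  let ?H = "\<lambda>e. {y. cross2 c (a e - y) * cross2 c (b e - y) \<le> 0}"
  have [measurable]: "?H e \<in> sets borel" for e by measurable
  have edge: "ennreal \<bar>?D\<bar> * (\<integral>\<^sup>+t. indicator (?H e) (t *\<^sub>R c') \<partial>lborel) \<le> ennreal (norm c * dist (a e) (b e))" for e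
  proof -
    define A where "A = cross2 c (a e) / ?D"
    define B where "B = cross2 c (b e) / ?D"
    have "t \<in> {min A B..max A B}" if "t *\<^sub>R c' \<in> ?H e" for t
    proof -
      have "(cross2 c (a e) - t * ?D) * (cross2 c (b e) - t * ?D) \<le> 0" using that by simp
      moreover have "cross2 c (a e) - t * ?D = (A - t) * ?D" "cross2 c (b e) - t * ?D = (B - t) * ?D"
        using D by (simp_all add: A_def B_def algebra_simps)
      ultimately have "((A - t) * (B - t)) * (?D * ?D) \<le> 0" by (simp only: mult_ac)
      moreover have "0 < ?D * ?D" using D by (metis not_real_square_gt_zero)
      ultimately have "(A - t) * (B - t) \<le> 0" by (meson mult_pos_pos not_less)
      then show ?thesis by (auto simp: mult_le_0_iff)
    qed
    then have "(\<integral>\<^sup>+t. indicator (?H e) (t *\<^sub>R c') \<partial>lborel) \<le> (\<integral>\<^sup>+t. indicator {min A B..max A B} t \<partial>lborel)"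
      by (intro nn_integral_mono) (simp add: indicator_def)
    also have "\<dots> = ennreal \<bar>A - B\<bar>" by (simp add: min_def max_def)
    finally have "ennreal \<bar>?D\<bar> * (\<integral>\<^sup>+t. indicator (?H e) (t *\<^sub>R c') \<partial>lborel) \<le> ennreal \<bar>?D\<bar> * ennreal \<bar>A - B\<bar>"
      by (rule mult_left_mono) simp
    also have "\<dots> = ennreal \<bar>cross2 c (a e - b e)\<bar>"
      using D by (simp add: ennreal_mult[symmetric] A_def B_def abs_mult[symmetric] right_diff_distrib)
    also have "\<dots> \<le> ennreal (norm c * dist (a e) (b e))"
      using abs_cross2_le[of c "a e - b e"] by (intro ennreal_leI) (simp only: dist_norm)
    finally show ?thesis .
  qed
  have "(\<integral>\<^sup>+t. line_bound c u (t *\<^sub>R c') \<partial>lborel)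
     = (\<integral>\<^sup>+t. \<integral>\<^sup>+\<sigma>. ?v (t *\<^sub>R c' + \<sigma> *\<^sub>R c) \<partial>lborel \<partial>lborel)
       + (\<Sum>e\<in>E. ennreal (jump u e) * (\<integral>\<^sup>+t. indicator (?H e) (t *\<^sub>R c') \<partial>lborel))"
    unfolding line_bound_def by (subst nn_integral_add) (simp_all add: nn_integral_sum nn_integral_cmult)
  then have "ennreal \<bar>?D\<bar> * (\<integral>\<^sup>+t. line_bound c u (t *\<^sub>R c') \<partial>lborel)
     = ennreal \<bar>?D\<bar> * (\<integral>\<^sup>+t. \<integral>\<^sup>+\<sigma>. ?v (t *\<^sub>R c' + \<sigma> *\<^sub>R c) \<partial>lborel \<partial>lborel)
       + (\<Sum>e\<in>E. ennreal (jump u e) * (ennreal \<bar>?D\<bar> * (\<integral>\<^sup>+t. indicator (?H e) (t *\<^sub>R c') \<partial>lborel)))"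
    by (simp add: distrib_left sum_distrib_left mult_ac)
  also have "ennreal \<bar>?D\<bar> * (\<integral>\<^sup>+t. \<integral>\<^sup>+\<sigma>. ?v (t *\<^sub>R c' + \<sigma> *\<^sub>R c) \<partial>lborel \<partial>lborel) = (\<integral>\<^sup>+x. ?v x \<partial>lborel)"
  proof -
    have "cross2 c' c \<noteq> 0" "\<bar>cross2 c' c\<bar> = \<bar>?D\<bar>" using D cross2_commute[of c c'] by auto
    then show ?thesis using nn_integral_oblique[of c' c ?v] by simp
  qed
  also have "(\<integral>\<^sup>+x. ?v x \<partial>lborel) + (\<Sum>e\<in>E. ennreal (jump u e) * (ennreal \<bar>?D\<bar> * (\<integral>\<^sup>+t. indicator (?H e) (t *\<^sub>R c') \<partial>lborel)))
      \<le> (\<integral>\<^sup>+x. ?v x \<partial>lborel) + (\<Sum>e\<in>E. ennreal (jump u e) * ennreal (norm c * dist (a e) (b e)))"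
    using edge by (intro add_left_mono sum_mono mult_left_mono) auto
  also have "(\<Sum>e\<in>E. ennreal (jump u e) * ennreal (norm c * dist (a e) (b e))) = ennreal (norm c * total_variation u)"
    by (simp add: ennreal_mult[symmetric] total_variation_def sum_distrib_left mult_ac)
  finally show ?thesis .
qed

lemma total_variation_nonneg: "0 \<le> total_variation u"
  unfolding total_variation_def by (intro sum_nonneg) auto

text \<open>One factor of the square is bounded along \<open>c1\<close> and the other along \<open>c2\<close>. The first bound
does not depend on \<open>s\<close>, the second does not depend on \<open>t\<close>, and the double integral factorizes.\<close>

lemma square_integral_on_piece:
  fixes u :: "'i \<Rightarrow> real" and c1 c2 :: plane
  assumes D: "cross2 c1 c2 \<noteq> 0" and W[measurable]: "W \<in> sets borel"
    and in_\<Omega>: "\<And>x \<tau>. x \<in> W \<Longrightarrow> 0 \<le> \<tau> \<Longrightarrow> \<tau> \<le> 1 \<Longrightarrow> x + \<tau> *\<^sub>R c1 \<in> \<Omega> \<and> x + \<tau> *\<^sub>R c2 \<in> \<Omega>"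
  defines "v \<equiv> \<integral>\<^sup>+x. step_fun (\<lambda>i. \<bar>u i\<bar>) x \<partial>lborel"
  shows "ennreal \<bar>cross2 c1 c2\<bar> * (\<integral>\<^sup>+x. step_fun (\<lambda>i. \<bar>u i\<bar>) x * step_fun (\<lambda>i. \<bar>u i\<bar>) x * indicator W x \<partial>lborel)
    \<le> (v + ennreal (norm c1 * total_variation u)) * (v + ennreal (norm c2 * total_variation u))"
proof -
  let ?v = "step_fun (\<lambda>i. \<bar>u i\<bar>)"
  let ?D = "cross2 c1 c2"
  have D': "cross2 c2 c1 \<noteq> 0" "\<bar>cross2 c2 c1\<bar> = \<bar>?D\<bar>" using D cross2_commute[of c1 c2] by auto
  have c0: "c1 \<noteq> 0" "c2 \<noteq> 0" using D by auto
  define N1 where "N1 = (\<lambda>q. cross2 c1 q / ?D) ` exceptional"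
  define N2 where "N2 = (\<lambda>q. cross2 c2 q / cross2 c2 c1) ` exceptional"
  have AE1: "AE t in lborel. t \<notin> N1" and AE2: "AE t in lborel. t \<notin> N2"
    unfolding N1_def N2_def using finite_exceptional by (intro AE_not_in finite_imp_null_set_lborel finite_imageI; simp)+
  let ?h = "\<lambda>x. ?v x * ?v x * indicator W x"
  let ?G1 = "\<lambda>t. line_bound c1 u (t *\<^sub>R c2)"
  let ?G2 = "\<lambda>s. line_bound c2 u (s *\<^sub>R c1)"
  have pointwise: "?h (s *\<^sub>R c1 + t *\<^sub>R c2) \<le> ?G2 s * ?G1 t" if "t \<notin> N1" "s \<notin> N2" for s t
  proof (cases "s *\<^sub>R c1 + t *\<^sub>R c2 \<in> W")
    case True
    let ?x = "s *\<^sub>R c1 + t *\<^sub>R c2"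
    have "generic_line c1 ?x"
      using that(1) D unfolding generic_line_def N1_def by (auto simp: image_iff field_simps)
    then have "?v ?x \<le> line_bound c1 u ?x" using in_\<Omega>[OF True] c0 by (intro step_fun_le_line_bound) auto
    also have "line_bound c1 u ?x = ?G1 t" using line_bound_shift[of c1 u "t *\<^sub>R c2" s] by (simp add: add.commute)
    finally have 1: "?v ?x \<le> ?G1 t" .
    have "generic_line c2 ?x"
      using that(2) D' unfolding generic_line_def N2_def by (auto simp: image_iff field_simps)
    then have "?v ?x \<le> line_bound c2 u ?x" using in_\<Omega>[OF True] c0 by (intro step_fun_le_line_bound) auto
    also have "line_bound c2 u ?x = ?G2 s" using line_bound_shift[of c2 u "s *\<^sub>R c1" t] by simp
    finally have "?v ?x \<le> ?G2 s" .
    then show ?thesis using True 1 by (auto intro: mult_mono)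
  qed simp
  have "(\<integral>\<^sup>+x. ?h x \<partial>lborel) = ennreal \<bar>?D\<bar> * (\<integral>\<^sup>+s. \<integral>\<^sup>+t. ?h (s *\<^sub>R c1 + t *\<^sub>R c2) \<partial>lborel \<partial>lborel)"
    by (rule nn_integral_oblique[OF D]) measurable
  also have "(\<integral>\<^sup>+s. \<integral>\<^sup>+t. ?h (s *\<^sub>R c1 + t *\<^sub>R c2) \<partial>lborel \<partial>lborel) \<le> (\<integral>\<^sup>+s. \<integral>\<^sup>+t. ?G2 s * ?G1 t \<partial>lborel \<partial>lborel)"
  proof (rule nn_integral_mono_AE)
    show "AE s in lborel. (\<integral>\<^sup>+t. ?h (s *\<^sub>R c1 + t *\<^sub>R c2) \<partial>lborel) \<le> (\<integral>\<^sup>+t. ?G2 s * ?G1 t \<partial>lborel)"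
      using AE2
    proof eventually_elim
      case (elim s)
      show ?case
        by (rule nn_integral_mono_AE, rule eventually_mono[OF AE1], rule pointwise[OF _ elim])
    qed
  qed
  also have "(\<integral>\<^sup>+s. \<integral>\<^sup>+t. ?G2 s * ?G1 t \<partial>lborel \<partial>lborel) = (\<integral>\<^sup>+s. ?G2 s \<partial>lborel) * (\<integral>\<^sup>+t. ?G1 t \<partial>lborel)"
    by (simp add: nn_integral_cmult nn_integral_multc)
  finally have "ennreal \<bar>?D\<bar> * (\<integral>\<^sup>+x. ?h x \<partial>lborel)
      \<le> ennreal \<bar>?D\<bar> * (ennreal \<bar>?D\<bar> * ((\<integral>\<^sup>+s. ?G2 s \<partial>lborel) * (\<integral>\<^sup>+t. ?G1 t \<partial>lborel)))"
    by (simp add: mult_left_mono)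
  also have "\<dots> = (ennreal \<bar>?D\<bar> * (\<integral>\<^sup>+t. ?G1 t \<partial>lborel)) * (ennreal \<bar>cross2 c2 c1\<bar> * (\<integral>\<^sup>+s. ?G2 s \<partial>lborel))"
    unfolding D' by (simp only: mult_ac)
  also have "\<dots> \<le> (v + ennreal (norm c1 * total_variation u)) * (v + ennreal (norm c2 * total_variation u))"
    unfolding v_def by (intro mult_mono nn_integral_line_bound D D') auto
  finally show ?thesis .
qed

lemma nn_integral_step_fun:
  assumes "bounded \<Omega>" "\<And>i. i \<in> I \<Longrightarrow> 0 \<le> w i"
  shows "(\<integral>\<^sup>+x. step_fun w x \<partial>lborel) = ennreal (\<Sum>i\<in>I. measure lebesgue (S i) * w i)"
proof -
  have "emeasure lborel (S i) = ennreal (measure lebesgue (S i))" if "i \<in> I" for i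
    using emeasure_bounded_finite[of "S i"] bounded_subset[OF assms(1) S_subset[OF that]] borel_S[OF that]
    by (simp add: emeasure_eq_ennreal_measure measure_completion less_top)
  then show ?thesis unfolding step_fun_def
    using assms(2) by (simp add: nn_integral_sum nn_integral_cmult ennreal_mult[symmetric] mult_ac)
qed

end

text \<open>The form of the cone condition that is used: on each of finitely many open sets \<open>U\<close> covering \<open>\<Omega>\<close>, two
independent vectors can be attached to all points of \<open>U \<inter> \<Omega>\<close> without leaving \<open>\<Omega>\<close>.\<close>

definition cone_cover :: "plane set \<Rightarrow> (plane set \<times> plane \<times> plane) set \<Rightarrow> bool" where
  "cone_cover \<Omega> \<C> \<longleftrightarrow> finite \<C> \<and> \<Omega> \<subseteq> (\<Union>(U, c1, c2)\<in>\<C>. U) \<and>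
     (\<forall>(U, c1, c2)\<in>\<C>. open U \<and> cross2 c1 c2 \<noteq> 0 \<and>
        (\<forall>x\<in>U \<inter> \<Omega>. \<forall>\<tau>\<in>{0..1}. x + \<tau> *\<^sub>R c1 \<in> \<Omega> \<and> x + \<tau> *\<^sub>R c2 \<in> \<Omega>))"

definition cover_const :: "(plane set \<times> plane \<times> plane) set \<Rightarrow> real" where
  "cover_const \<C> = (\<Sum>(U, c1, c2)\<in>\<C>. (1 + norm c1) * (1 + norm c2) / \<bar>cross2 c1 c2\<bar>)"

text \<open>The constant depends on the cover only, hence on the domain but not on the partition.\<close>

lemma (in polygonal_partition) Sobolev_partition:
  assumes bd: "bounded \<Omega>" and cov: "cone_cover \<Omega> \<C>"
  shows "(\<Sum>i\<in>I. measure lebesgue (S i) * (u i)\<^sup>2)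
    \<le> cover_const \<C> * ((\<Sum>i\<in>I. measure lebesgue (S i) * \<bar>u i\<bar>) + total_variation u)\<^sup>2"
proof -
  define V where "V = (\<Sum>i\<in>I. measure lebesgue (S i) * \<bar>u i\<bar>)"
  define T where "T = total_variation u"
  have V0: "0 \<le> V" unfolding V_def by (intro sum_nonneg) auto
  have T0: "0 \<le> T" unfolding T_def by (rule total_variation_nonneg)
  let ?v = "step_fun (\<lambda>i. \<bar>u i\<bar>)"
  have V: "(\<integral>\<^sup>+x. ?v x \<partial>lborel) = ennreal V"
    unfolding V_def by (intro nn_integral_step_fun bd) auto
  have sq: "step_fun (\<lambda>i. (u i)\<^sup>2) x = ?v x * ?v x" for x
  proof (cases "x \<in> (\<Union>i\<in>I. S i)")
    case True
    then obtain i where "i \<in> I" "x \<in> S i" by blast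
    then show ?thesis by (simp add: step_fun_cell ennreal_mult[symmetric] power2_eq_square)
  qed (simp add: step_fun_outside)
  have piece: "(\<integral>\<^sup>+x. ?v x * ?v x * indicator (U \<inter> \<Omega>) x \<partial>lborel)
      \<le> ennreal ((1 + norm c1) * (1 + norm c2) / \<bar>cross2 c1 c2\<bar> * (V + T)\<^sup>2)" if C: "(U, c1, c2) \<in> \<C>" for U c1 c2
  proof -
    let ?D = "cross2 c1 c2"
    let ?I = "\<integral>\<^sup>+x. ?v x * ?v x * indicator (U \<inter> \<Omega>) x \<partial>lborel"
    have C': "open U" "?D \<noteq> 0" "\<And>x \<tau>. x \<in> U \<inter> \<Omega> \<Longrightarrow> 0 \<le> \<tau> \<Longrightarrow> \<tau> \<le> 1 \<Longrightarrow> x + \<tau> *\<^sub>R c1 \<in> \<Omega> \<and> x + \<tau> *\<^sub>R c2 \<in> \<Omega>"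
      using cov C unfolding cone_cover_def by fastforce+
    have bc: "V + norm c * T \<le> (1 + norm c) * (V + T)" for c :: plane
      using V0 T0 by (simp add: algebra_simps)
    have "ennreal \<bar>?D\<bar> * ?I \<le> (ennreal V + ennreal (norm c1 * T)) * (ennreal V + ennreal (norm c2 * T))"
      unfolding V[symmetric] T_def using C' open_\<Omega> by (intro square_integral_on_piece) (auto intro!: borel_open)
    also have "\<dots> = ennreal ((V + norm c1 * T) * (V + norm c2 * T))"
      using V0 T0 by (subst (1 2) ennreal_plus[symmetric]) (auto simp: ennreal_mult[symmetric] simp del: ennreal_plus)
    also have "\<dots> \<le> ennreal (((1 + norm c1) * (V + T)) * ((1 + norm c2) * (V + T)))"
      using bc V0 T0 by (intro ennreal_leI mult_mono) auto
    finally have "ennreal (1 / \<bar>?D\<bar>) * (ennreal \<bar>?D\<bar> * ?I) \<le> ennreal (1 / \<bar>?D\<bar>) * ennreal (((1 + norm c1) * (V + T)) * ((1 + norm c2) * (V + T)))"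
      by (intro mult_left_mono) auto
    moreover have "ennreal (1 / \<bar>?D\<bar>) * (ennreal \<bar>?D\<bar> * ?I) = ?I"
      using C'(2) by (simp add: mult.assoc[symmetric] ennreal_mult[symmetric])
    moreover have "ennreal (1 / \<bar>?D\<bar>) * ennreal (((1 + norm c1) * (V + T)) * ((1 + norm c2) * (V + T)))
       = ennreal ((1 + norm c1) * (1 + norm c2) / \<bar>?D\<bar> * (V + T)\<^sup>2)"
      using V0 T0 by (simp add: ennreal_mult[symmetric] power2_eq_square mult_ac)
    ultimately show ?thesis by simp
  qed
  have sub: "\<Omega> \<subseteq> (\<Union>p\<in>\<C>. fst p)"
    using cov unfolding cone_cover_def by (simp only: case_prod_unfold)
  have fin: "finite \<C>" and opn: "\<And>U c1 c2. (U, c1, c2) \<in> \<C> \<Longrightarrow> open U"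
    using cov unfolding cone_cover_def by fastforce+
  have "ennreal (\<Sum>i\<in>I. measure lebesgue (S i) * (u i)\<^sup>2) = (\<integral>\<^sup>+x. ?v x * ?v x \<partial>lborel)"
    unfolding sq[symmetric] by (intro nn_integral_step_fun[symmetric] bd) auto
  also have "\<dots> \<le> (\<integral>\<^sup>+x. (\<Sum>p\<in>\<C>. ?v x * ?v x * indicator (fst p \<inter> \<Omega>) x) \<partial>lborel)"
  proof (rule nn_integral_mono)
    fix x
    show "?v x * ?v x \<le> (\<Sum>p\<in>\<C>. ?v x * ?v x * indicator (fst p \<inter> \<Omega>) x)"
    proof (cases "x \<in> \<Omega>")
      case True
      then obtain p where p: "p \<in> \<C>" "x \<in> fst p" using sub by blast
      have "?v x * ?v x = ?v x * ?v x * indicator (fst p \<inter> \<Omega>) x" using p True by simp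
      also have "\<dots> \<le> (\<Sum>p\<in>\<C>. ?v x * ?v x * indicator (fst p \<inter> \<Omega>) x)"
        using p fin by (intro member_le_sum) auto
      finally show ?thesis .
    next
      case False
      then have "x \<notin> (\<Union>i\<in>I. S i)" using S_subset by blast
      then show ?thesis by (simp add: step_fun_outside)
    qed
  qed
  also have "\<dots> = (\<Sum>p\<in>\<C>. (\<integral>\<^sup>+x. ?v x * ?v x * indicator (fst p \<inter> \<Omega>) x \<partial>lborel))"
  proof (rule nn_integral_sum)
    fix p assume "p \<in> \<C>"
    then have [measurable]: "fst p \<inter> \<Omega> \<in> sets borel"
      using opn[of "fst p" "fst (snd p)" "snd (snd p)"] open_\<Omega> by auto
    show "(\<lambda>x. ?v x * ?v x * indicator (fst p \<inter> \<Omega>) x) \<in> borel_measurable lborel" by measurable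
  qed
  also have "\<dots> \<le> (\<Sum>(U, c1, c2)\<in>\<C>. ennreal ((1 + norm c1) * (1 + norm c2) / \<bar>cross2 c1 c2\<bar> * (V + T)\<^sup>2))"
    using piece by (intro sum_mono) auto
  also have "\<dots> = ennreal (cover_const \<C> * (V + T)\<^sup>2)"
    unfolding cover_const_def sum_distrib_right by (subst sum_ennreal[symmetric]) (auto simp: case_prod_unfold)
  finally show ?thesis unfolding V_def T_def
    by (subst (asm) ennreal_le_iff) (auto simp: cover_const_def intro!: mult_nonneg_nonneg sum_nonneg)
qed

section \<open>The cone condition for Lipschitz domains\<close>

text \<open>Above the graph of an \<open>L\<close>-Lipschitz function, moving in the directions \<open>(1, L + 1)\<close> and \<open>(- 1, L + 1)\<close>
stays above the graph. Near a boundary point two short vectors with these directions in the local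
coordinates serve, near an interior point any two short independent vectors. Compactness of
the closure leaves finitely many.\<close>

lemma lipschitz_cone_cover:
  assumes bd: "bounded \<Omega>" and lip: "lipschitz_domain \<Omega>"
  obtains \<C> where "cone_cover \<Omega> \<C>"
proof -
  have "open \<Omega>" using lip by (simp add: lipschitz_domain_def)
  define good where "good U c1 c2 \<longleftrightarrow> open U \<and> cross2 c1 c2 \<noteq> 0 \<and>
      (\<forall>y\<in>U \<inter> \<Omega>. \<forall>\<tau>\<in>{0..1}. y + \<tau> *\<^sub>R c1 \<in> \<Omega> \<and> y + \<tau> *\<^sub>R c2 \<in> \<Omega>)" for U c1 c2
  have in_ball: "y + \<tau> *\<^sub>R c \<in> ball x r"
    if "y \<in> ball x (r / 2)" "\<tau> \<in> {0..1}" "norm c \<le> r / 4" "0 < r" for x y c :: plane and \<tau> r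
  proof -
    have "\<bar>\<tau>\<bar> * norm c \<le> 1 * (r / 4)" using that by (intro mult_mono) auto
    moreover have "dist x (y + \<tau> *\<^sub>R c) \<le> dist x y + \<bar>\<tau>\<bar> * norm c"
      using norm_triangle_ineq4[of "x - y" "\<tau> *\<^sub>R c"] by (simp add: dist_norm algebra_simps)
    ultimately show ?thesis using that by simp
  qed
  have interior: "\<exists>U c1 c2. x \<in> U \<and> good U c1 c2" if x: "x \<in> \<Omega>" for x
  proof -
    obtain r where r: "0 < r" "ball x r \<subseteq> \<Omega>" using \<open>open \<Omega>\<close> x by (meson open_contains_ball)
    define c1 where "c1 = ((r / 4) *\<^sub>R axis 1 1 :: plane)"
    define c2 where "c2 = ((r / 4) *\<^sub>R axis 2 1 :: plane)"
    have "norm c1 = r / 4" "norm c2 = r / 4"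
      using r by (simp_all add: c1_def c2_def axis_in_Basis_iff norm_Basis)
    then have le: "norm c1 \<le> r / 4" "norm c2 \<le> r / 4" by simp_all
    have "cross2 c1 c2 \<noteq> 0" using r by (simp add: c1_def c2_def cross2_def axis_def)
    then have "good (ball x (r / 2)) c1 c2"
      unfolding good_def using in_ball[OF _ _ le(1) r(1)] in_ball[OF _ _ le(2) r(1)] r(2) open_ball by blast
    moreover have "x \<in> ball x (r / 2)" using r by simp
    ultimately show ?thesis by blast
  qed
  have boundary: "\<exists>U c1 c2. x \<in> U \<and> good U c1 c2" if x: "x \<in> frontier \<Omega>" for x
  proof -
    obtain r L and R :: "plane \<Rightarrow> plane" and \<phi> where r: "0 < r" and R: "orthogonal_transformation R" and \<phi>: "L-lipschitz_on UNIV \<phi>"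
      and eq: "\<Omega> \<inter> ball x r = {y \<in> ball x r. \<phi> (R y $ 1) < R y $ 2}"
      using lip x unfolding lipschitz_domain_def by blast
    have L0: "0 \<le> L" using \<phi> lipschitz_on_nonneg by blast
    have linR: "linear R" and surjR: "surj R" and normR: "norm (R v) = norm v" for v
      using R orthogonal_transformation_linear orthogonal_transformation_surj orthogonal_transformation_norm by auto
    define w where "w \<epsilon> = (vector [\<epsilon>, L + 1] :: plane)" for \<epsilon>
    obtain v1 v2 where v: "R v1 = w 1" "R v2 = w (- 1)" using surjR by (metis surjD)
    define N where "N = sqrt (1 + (L + 1)\<^sup>2)"
    have N0: "0 < N" unfolding N_def by (simp add: add_pos_nonneg)
    have N: "norm v1 = N" "norm v2 = N"
      using normR[of v1] normR[of v2] unfolding v by (simp_all add: w_def norm_eq_sqrt_inner inner_plane N_def power2_eq_square)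
    have indep: "cross2 v1 v2 \<noteq> 0"
    proof
      assume "cross2 v1 v2 = 0"
      moreover have "v1 \<noteq> 0" using N N0 by auto
      ultimately obtain c where "v2 = c *\<^sub>R v1" using cross2_eq_0_D by metis
      then have "w (- 1) = c *\<^sub>R w 1" using v linR by (metis linear_scale)
      then have "- 1 = c" "L + 1 = c * (L + 1)" unfolding w_def plane_eq_iff by auto
      then show False using L0 by auto
    qed
    define h where "h = r / (4 * N)"
    have h: "0 < h" "h * N = r / 4" using r N0 by (auto simp: h_def)
    have stays: "y + \<tau> *\<^sub>R (h *\<^sub>R v') \<in> \<Omega>"
      if y: "y \<in> ball x (r / 2) \<inter> \<Omega>" and \<tau>: "\<tau> \<in> {0..1}" and v': "norm v' = N" "R v' = w \<epsilon>" and \<epsilon>: "\<bar>\<epsilon>\<bar> = 1"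
      for y \<tau> v' \<epsilon>
    proof -
      let ?z = "y + \<tau> *\<^sub>R (h *\<^sub>R v')"
      have zb: "?z \<in> ball x r" using y \<tau> h v' r by (intro in_ball) auto
      have Rz: "R ?z = R y + (\<tau> * h) *\<^sub>R w \<epsilon>"
        using linR v' by (simp add: linear_add linear_scale)
      have "\<phi> (R ?z $ 1) - \<phi> (R y $ 1) \<le> L * \<bar>R ?z $ 1 - R y $ 1\<bar>"
        using lipschitz_onD[OF \<phi>, of "R ?z $ 1" "R y $ 1"] by (simp add: dist_real_def)
      also have "\<bar>R ?z $ 1 - R y $ 1\<bar> = \<tau> * h"
        unfolding Rz using \<tau> h \<epsilon> by (simp add: w_def abs_mult)
      finally have "\<phi> (R ?z $ 1) \<le> \<phi> (R y $ 1) + L * (\<tau> * h)" by simp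
      moreover have "y \<in> ball x r" using y r by auto
      then have "\<phi> (R y $ 1) < R y $ 2" using y eq by blast
      moreover have "R ?z $ 2 = R y $ 2 + \<tau> * h * (L + 1)" unfolding Rz by (simp add: w_def)
      moreover have "0 \<le> \<tau> * h" using \<tau> h by simp
      ultimately have "\<phi> (R ?z $ 1) < R ?z $ 2" by (simp add: algebra_simps)
      then show ?thesis using zb eq by blast
    qed
    have "good (ball x (r / 2)) (h *\<^sub>R v1) (h *\<^sub>R v2)"
      unfolding good_def using stays[OF _ _ N(1) v(1)] stays[OF _ _ N(2) v(2)] indep h by auto
    moreover have "x \<in> ball x (r / 2)" using r by simp
    ultimately show ?thesis by blast
  qed
  have "\<forall>x\<in>closure \<Omega>. \<exists>U c1 c2. x \<in> U \<and> good U c1 c2"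
    using interior boundary closure_Un_frontier[of \<Omega>] by blast
  then obtain U c1 c2 where U: "\<And>x. x \<in> closure \<Omega> \<Longrightarrow> x \<in> U x \<and> good (U x) (c1 x) (c2 x)" by metis
  have "compact (closure \<Omega>)" using bd by simp
  then obtain X where X: "X \<subseteq> closure \<Omega>" "finite X" "closure \<Omega> \<subseteq> (\<Union>x\<in>X. U x)"
  proof (rule compactE_image[of "closure \<Omega>" "closure \<Omega>" U])
    show "\<And>x. x \<in> closure \<Omega> \<Longrightarrow> open (U x)" using U unfolding good_def by blast
    show "closure \<Omega> \<subseteq> (\<Union>x\<in>closure \<Omega>. U x)" using U by blast
  qed
  have "cone_cover \<Omega> ((\<lambda>x. (U x, c1 x, c2 x)) ` X)"
    unfolding cone_cover_def
  proof (intro conjI)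
    show "\<Omega> \<subseteq> (\<Union>(V, c1, c2)\<in>(\<lambda>x. (U x, c1 x, c2 x)) ` X. V)"
      using X(3) closure_subset[of \<Omega>] by auto
    show "\<forall>(V, c1, c2)\<in>(\<lambda>x. (U x, c1 x, c2 x)) ` X. open V \<and> cross2 c1 c2 \<noteq> 0 \<and>
        (\<forall>y\<in>V \<inter> \<Omega>. \<forall>\<tau>\<in>{0..1}. y + \<tau> *\<^sub>R c1 \<in> \<Omega> \<and> y + \<tau> *\<^sub>R c2 \<in> \<Omega>)"
      using U X(1) unfolding good_def by blast
  qed (use X in simp)
  then show ?thesis by (rule that)
qed

section \<open>The embedding applied to powers\<close>

context polygonal_partition
begin

lemma sum_edges_le_sum_cells:
  fixes y :: "'i \<Rightarrow> real"
  assumes "\<And>i. i \<in> I \<Longrightarrow> 0 \<le> y i" and "\<And>e. e \<in> E \<Longrightarrow> 0 \<le> \<omega> e"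
    and \<zeta>: "\<And>i. i \<in> I \<Longrightarrow> (\<Sum>e\<in>{e\<in>E. i = k e \<or> i = l e}. \<omega> e) \<le> M i / \<zeta>"
    and side: "\<And>e. e \<in> E \<Longrightarrow> j e = k e \<or> j e = l e"
  shows "(\<Sum>e\<in>E. \<omega> e * y (j e)) \<le> (\<Sum>i\<in>I. M i * y i) / \<zeta>"
proof -
  have "(\<Sum>e\<in>E. \<omega> e * y (j e)) = (\<Sum>i\<in>I. \<Sum>e\<in>{e\<in>E. j e = i}. \<omega> e * y (j e))"
    using finite_E finite_I side sides by (intro sum.group[symmetric]) force+
  also have "\<dots> = (\<Sum>i\<in>I. (\<Sum>e\<in>{e\<in>E. j e = i}. \<omega> e) * y i)"
    by (intro sum.cong) (auto simp: sum_distrib_right)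
  also have "\<dots> \<le> (\<Sum>i\<in>I. M i / \<zeta> * y i)"
  proof (intro sum_mono mult_right_mono)
    fix i assume i: "i \<in> I"
    have "(\<Sum>e\<in>{e\<in>E. j e = i}. \<omega> e) \<le> (\<Sum>e\<in>{e\<in>E. i = k e \<or> i = l e}. \<omega> e)"
      using finite_E assms(2) side by (intro sum_mono2) auto
    then show "(\<Sum>e\<in>{e\<in>E. j e = i}. \<omega> e) \<le> M i / \<zeta>" using \<zeta>[OF i] by simp
  qed (use assms in auto)
  finally show ?thesis by (simp add: sum_divide_distrib)
qed

text \<open>The embedding is applied to \<open>w = \<bar>u\<bar> powr r\<close>. By the mean value theorem the jump of \<open>w\<close> is at most
\<open>r\<close> times the jump of \<open>u\<close> times the sum of the two values of \<open>\<bar>u\<bar> powr (r - 1)\<close>, and Hoelder's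
inequality separates these factors. The relation between \<open>p\<close>, \<open>q\<close> and \<open>r\<close> says that
\<open>\<bar>u\<bar> powr (r - 1)\<close> is \<open>\<bar>u\<bar> powr q\<close> raised to the power \<open>1 - 1 / p\<close>. On a mesh, \<open>\<omega> e\<close> is
the product of the lengths of the diagonals of the diamond of \<open>e\<close>, and \<open>g e\<close> the norm of the gradient.\<close>

lemma power_estimate:
  fixes u :: "'i \<Rightarrow> real" and \<omega> g :: "'e \<Rightarrow> real" and p q r \<zeta> :: real
  defines "\<mu> \<equiv> \<lambda>i. measure lebesgue (S i)"
  assumes bd: "bounded \<Omega>" and cov: "cone_cover \<Omega> \<C>"
    and p: "1 \<le> p" and r: "1 \<le> r" and qp: "q * (p - 1) = p * (r - 1)" and \<zeta>: "0 < \<zeta>"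
    and \<omega>: "\<And>e. e \<in> E \<Longrightarrow> 0 \<le> \<omega> e" and g: "\<And>e. e \<in> E \<Longrightarrow> 0 \<le> g e"
    and slope: "\<And>e. e \<in> E \<Longrightarrow> dist (a e) (b e) * jump u e \<le> \<omega> e * g e"
    and reg: "\<And>i. i \<in> I \<Longrightarrow> (\<Sum>e\<in>{e\<in>E. i = k e \<or> i = l e}. \<omega> e) \<le> \<mu> i / \<zeta>"
  shows "(\<Sum>i\<in>I. \<mu> i * \<bar>u i\<bar> powr (2 * r)) powr (1 / 2)
    \<le> sqrt (cover_const \<C>) *
      ((\<Sum>i\<in>I. \<mu> i * \<bar>u i\<bar> powr p) powr (1 / p)
        + 2 * r / \<zeta> powr (1 - 1 / p) * (\<Sum>e\<in>E. \<omega> e * g e powr p) powr (1 / p))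
      * (\<Sum>i\<in>I. \<mu> i * \<bar>u i\<bar> powr q) powr (1 - 1 / p)"
proof -
  define \<kappa> where "\<kappa> = 1 - 1 / p"
  have \<kappa>: "0 \<le> \<kappa>" "0 \<le> 1 / p" "1 / p + \<kappa> = 1" using p by (auto simp: \<kappa>_def)
  have q\<kappa>: "q * \<kappa> = r - 1" using qp p by (simp add: \<kappa>_def field_simps)
  have \<mu>0: "0 \<le> \<mu> i" for i by (simp add: \<mu>_def)
  define X where "X = (\<Sum>i\<in>I. \<mu> i * \<bar>u i\<bar> powr p)"
  define Q where "Q = (\<Sum>i\<in>I. \<mu> i * \<bar>u i\<bar> powr q)"
  define G where "G = (\<Sum>e\<in>E. \<omega> e * g e powr p)"
  define w where "w i = \<bar>u i\<bar> powr r" for i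
  have low: "\<bar>t\<bar> powr (r - 1) = (\<bar>t\<bar> powr q) powr \<kappa>" for t :: real by (simp add: powr_powr q\<kappa>)
  have Q0: "0 \<le> Q" unfolding Q_def using \<mu>0 by (intro sum_nonneg) auto
  have V: "(\<Sum>i\<in>I. \<mu> i * \<bar>w i\<bar>) \<le> X powr (1 / p) * Q powr \<kappa>"
  proof -
    have e: "p * (1 / p) + q * \<kappa> = r" using p q\<kappa> by simp
    have "\<bar>w i\<bar> = (\<bar>u i\<bar> powr p) powr (1 / p) * (\<bar>u i\<bar> powr q) powr \<kappa>" for i
      unfolding w_def by (simp only: powr_powr powr_add[symmetric] e) simp
    then have "(\<Sum>i\<in>I. \<mu> i * \<bar>w i\<bar>) = (\<Sum>i\<in>I. \<mu> i * ((\<bar>u i\<bar> powr p) powr (1 / p) * (\<bar>u i\<bar> powr q) powr \<kappa>))"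
      by simp
    also have "\<dots> \<le> X powr (1 / p) * Q powr \<kappa>"
      unfolding X_def Q_def using finite_I \<mu>0 \<kappa> by (intro Holder_sum) auto
    finally show ?thesis .
  qed
  have half: "(\<Sum>e\<in>E. \<omega> e * (g e * \<bar>u (j e)\<bar> powr (r - 1))) \<le> G powr (1 / p) * (Q / \<zeta>) powr \<kappa>"
    if j: "\<And>e. e \<in> E \<Longrightarrow> j e = k e \<or> j e = l e" for j
  proof -
    have "(\<Sum>e\<in>E. \<omega> e * (g e * \<bar>u (j e)\<bar> powr (r - 1)))
        = (\<Sum>e\<in>E. \<omega> e * ((g e powr p) powr (1 / p) * (\<bar>u (j e)\<bar> powr q) powr \<kappa>))"
      using g p by (intro sum.cong) (auto simp: powr_powr q\<kappa>)
    also have "\<dots> \<le> G powr (1 / p) * (\<Sum>e\<in>E. \<omega> e * \<bar>u (j e)\<bar> powr q) powr \<kappa>"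
      unfolding G_def using finite_E \<omega> \<kappa> by (intro Holder_sum) auto
    also have "\<dots> \<le> G powr (1 / p) * (Q / \<zeta>) powr \<kappa>"
    proof (intro mult_left_mono powr_mono2 \<kappa>)
      show "(\<Sum>e\<in>E. \<omega> e * \<bar>u (j e)\<bar> powr q) \<le> Q / \<zeta>"
        unfolding Q_def using \<omega> reg j by (intro sum_edges_le_sum_cells) auto
    qed (use \<omega> in \<open>auto intro!: sum_nonneg\<close>)
    finally show ?thesis .
  qed
  have TV: "total_variation w \<le> 2 * r / \<zeta> powr \<kappa> * G powr (1 / p) * Q powr \<kappa>"
  proof -
    have "dist (a e) (b e) * jump w e \<le> r * (\<omega> e * (g e * \<bar>u (k e)\<bar> powr (r - 1)) + \<omega> e * (g e * \<bar>u (l e)\<bar> powr (r - 1)))"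
      if e: "e \<in> E" for e
    proof -
      let ?m = "\<bar>u (k e)\<bar> powr (r - 1) + \<bar>u (l e)\<bar> powr (r - 1)"
      have "jump w e \<le> r * \<bar>\<bar>u (k e)\<bar> - \<bar>u (l e)\<bar>\<bar> * ?m"
        unfolding jump_def w_def using r by (intro abs_powr_diff_le) auto
      also have "\<dots> \<le> r * jump u e * ?m"
        unfolding jump_def using r by (intro mult_right_mono mult_left_mono) auto
      finally have "dist (a e) (b e) * jump w e \<le> dist (a e) (b e) * (r * jump u e * ?m)"
        by (intro mult_left_mono) auto
      also have "\<dots> = r * (dist (a e) (b e) * jump u e) * ?m" by (simp add: mult_ac)
      also have "\<dots> \<le> r * (\<omega> e * g e) * ?m"
        using slope[OF e] r by (intro mult_right_mono mult_left_mono) auto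
      finally show ?thesis by (simp add: algebra_simps)
    qed
    then have "total_variation w \<le> (\<Sum>e\<in>E. r * (\<omega> e * (g e * \<bar>u (k e)\<bar> powr (r - 1)) + \<omega> e * (g e * \<bar>u (l e)\<bar> powr (r - 1))))"
      unfolding total_variation_def by (intro sum_mono)
    also have "\<dots> = r * ((\<Sum>e\<in>E. \<omega> e * (g e * \<bar>u (k e)\<bar> powr (r - 1))) + (\<Sum>e\<in>E. \<omega> e * (g e * \<bar>u (l e)\<bar> powr (r - 1))))"
      by (simp add: sum_distrib_left[symmetric] sum.distrib)
    also have "\<dots> \<le> r * (G powr (1 / p) * (Q / \<zeta>) powr \<kappa> + G powr (1 / p) * (Q / \<zeta>) powr \<kappa>)"
      using r half[of k] half[of l] by (intro mult_left_mono add_mono) auto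
    also have "\<dots> = 2 * r / \<zeta> powr \<kappa> * G powr (1 / p) * Q powr \<kappa>"
      using Q0 \<zeta> by (simp add: powr_divide)
    finally show ?thesis .
  qed
  define K where "K = cover_const \<C>"
  have K0: "0 \<le> K" unfolding K_def cover_const_def by (intro sum_nonneg) auto
  define W where "W = (\<Sum>i\<in>I. \<mu> i * \<bar>w i\<bar>) + total_variation w"
  have W0: "0 \<le> W" unfolding W_def using \<mu>0 total_variation_nonneg[of w] by (intro add_nonneg_nonneg sum_nonneg) auto
  have "(\<Sum>i\<in>I. \<mu> i * \<bar>u i\<bar> powr (2 * r)) = (\<Sum>i\<in>I. \<mu> i * (w i)\<^sup>2)"
    unfolding w_def by (simp add: power2_eq_square powr_add[symmetric])
  also have "\<dots> \<le> K * W\<^sup>2" unfolding K_def W_def \<mu>_def by (rule Sobolev_partition[OF bd cov])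
  finally have "(\<Sum>i\<in>I. \<mu> i * \<bar>u i\<bar> powr (2 * r)) powr (1 / 2) \<le> (K * W\<^sup>2) powr (1 / 2)"
    using \<mu>0 by (intro powr_mono2 sum_nonneg) auto
  also have "\<dots> = sqrt K * W" using K0 W0 by (simp add: powr_half_sqrt real_sqrt_mult)
  also have "\<dots> \<le> sqrt K * ((X powr (1 / p) + 2 * r / \<zeta> powr \<kappa> * G powr (1 / p)) * Q powr \<kappa>)"
    using V TV K0 unfolding W_def by (intro mult_left_mono) (auto simp: algebra_simps)
  finally show ?thesis unfolding K_def X_def G_def Q_def \<kappa>_def by (simp only: mult.assoc)
qed

end

section \<open>Geometry of a diamond\<close>

lemma Binet_Cauchy_cross2:
  "cross2 u v * cross2 x y = (u \<bullet> x) * (v \<bullet> y) - (u \<bullet> y) * (v \<bullet> x)"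
  by (simp add: cross2_def inner_plane algebra_simps)

lemma sin_line_angle:
  assumes "e \<noteq> 0" "f \<noteq> 0"
  shows "sin (line_angle e f) = \<bar>cross2 e f\<bar> / (norm e * norm f)"
proof -
  have n: "0 < norm e * norm f" using assms by simp
  let ?c = "\<bar>e \<bullet> f\<bar> / (norm e * norm f)"
  have c: "\<bar>?c\<bar> \<le> 1" using n Cauchy_Schwarz_ineq2[of e f] by simp
  have "sin (line_angle e f) = sqrt (1 - ?c\<^sup>2)" unfolding line_angle_def by (rule sin_arccos_abs[OF c])
  also have "1 - ?c\<^sup>2 = ((norm e * norm f)\<^sup>2 - (e \<bullet> f)\<^sup>2) / (norm e * norm f)\<^sup>2"
    using n assms by (simp add: power_divide diff_divide_distrib)
  also have "(norm e * norm f)\<^sup>2 - (e \<bullet> f)\<^sup>2 = (cross2 e f)\<^sup>2"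
    using Lagrange_cross2[of e f] by (simp add: power_mult_distrib)
  also have "sqrt ((cross2 e f)\<^sup>2 / (norm e * norm f)\<^sup>2) = \<bar>cross2 e f\<bar> / (norm e * norm f)"
    using n by (simp add: real_sqrt_divide)
  finally show ?thesis .
qed

text \<open>The component of \<open>e\<close> along the normal of \<open>f\<close> is the norm of \<open>e\<close> times the sine of the angle of
\<open>e\<close> and \<open>f\<close>, up to sign.\<close>

lemma abs_inner_unit_normal:
  assumes "norm n = 1" "n \<bullet> f = 0" "f \<noteq> 0"
  shows "\<bar>n \<bullet> e\<bar> = \<bar>cross2 e f\<bar> / norm f"
proof -
  have "(cross2 n f)\<^sup>2 = (norm f)\<^sup>2" using Lagrange_cross2[of n f] assms by simp
  then have nf: "\<bar>cross2 n f\<bar> = norm f" by (metis real_sqrt_abs abs_norm_cancel)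
  have "cross2 e f * cross2 n f = (e \<bullet> n) * (f \<bullet> f)"
    unfolding Binet_Cauchy_cross2 using assms by (simp add: inner_commute)
  then have "\<bar>cross2 e f\<bar> * \<bar>cross2 n f\<bar> = \<bar>n \<bullet> e\<bar> * (f \<bullet> f)"
    by (metis abs_mult abs_of_nonneg inner_commute inner_ge_zero)
  then have "\<bar>cross2 e f\<bar> * norm f = \<bar>n \<bullet> e\<bar> * (norm f * norm f)"
    by (simp only: nf power2_norm_eq_inner[symmetric] power2_eq_square)
  then show ?thesis using assms by (simp add: field_simps)
qed

text \<open>The vector \<open>n'\<close> is orthogonal to \<open>e\<close> and the component of \<open>n\<close> along \<open>e\<close> is the sine by which
the gradient is divided, up to sign and for \<open>e\<close> of unit length; so the component of the gradient
along \<open>e\<close> is \<open>A\<close> up to sign. Likewise its component along \<open>f\<close> is \<open>B\<close>.\<close>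

lemma slopes_le_norm_gradient:
  fixes e f n n' :: plane and A B :: real
  assumes e: "e \<noteq> 0" and f: "f \<noteq> 0" and s: "sin (line_angle e f) \<noteq> 0"
    and n: "norm n = 1" "n \<bullet> f = 0" and n': "norm n' = 1" "n' \<bullet> e = 0"
  defines "G \<equiv> (1 / sin (line_angle e f)) *\<^sub>R (A *\<^sub>R n + B *\<^sub>R n')"
  shows "\<bar>A\<bar> \<le> norm G" "\<bar>B\<bar> \<le> norm G"
proof -
  let ?s = "sin (line_angle e f)"
  have s_eq: "?s = \<bar>cross2 e f\<bar> / (norm e * norm f)" by (rule sin_line_angle[OF e f])
  have s0: "0 < ?s" using s unfolding s_eq by simp
  have "\<bar>n \<bullet> e\<bar> = ?s * norm e"
    unfolding abs_inner_unit_normal[OF n f] s_eq using e f by simp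
  moreover have "G \<bullet> e = A * (n \<bullet> e) / ?s" unfolding G_def using n' by (simp add: inner_add_left)
  ultimately have "\<bar>G \<bullet> e\<bar> = \<bar>A\<bar> * norm e" using s0 by (simp add: abs_mult)
  then have "\<bar>A\<bar> * norm e \<le> norm G * norm e" using Cauchy_Schwarz_ineq2[of G e] by simp
  then show "\<bar>A\<bar> \<le> norm G" using e by simp
  have "\<bar>n' \<bullet> f\<bar> = ?s * norm f"
    unfolding abs_inner_unit_normal[OF n' e] s_eq using e f cross2_commute[of f e] by simp
  moreover have "G \<bullet> f = B * (n' \<bullet> f) / ?s" unfolding G_def using n by (simp add: inner_add_left)
  ultimately have "\<bar>G \<bullet> f\<bar> = \<bar>B\<bar> * norm f" using s0 by (simp add: abs_mult)
  then have "\<bar>B\<bar> * norm f \<le> norm G * norm f" using Cauchy_Schwarz_ineq2[of G f] by simp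
  then show "\<bar>B\<bar> \<le> norm G" using f by simp
qed

text \<open>The two triangles lie on different sides of the line through \<open>a\<close> and \<open>b\<close>, so their areas add up; the
sum of the heights over the common base is the difference of the signed heights.\<close>

lemma measure_two_triangles:
  fixes a b x y :: plane
  assumes opp: "cross2 (b - a) (x - a) * cross2 (b - a) (y - a) \<le> 0" and ab: "a \<noteq> b"
  shows "measure lebesgue (interior (convex hull {x, a, b} \<union> convex hull {y, a, b})) = \<bar>cross2 (y - x) (b - a)\<bar> / 2"
proof -
  let ?d = "b - a"
  let ?T = "\<lambda>z. convex hull {z, a, b}"
  define n where "n = (vector [- ?d $ 2, ?d $ 1] :: plane)"
  have cr: "cross2 ?d z = n \<bullet> z" for z by (simp add: cross2_def n_def inner_plane algebra_simps)
  have n0: "n \<noteq> 0" using ab by (auto simp: n_def plane_eq_iff)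
  have area: "measure lebesgue (?T z) = \<bar>cross2 ?d (z - a)\<bar> / 2" for z
  proof -
    have "convex hull {z, a, b} = convex hull {a, b, z}" by (simp add: insert_commute)
    then have "measure lebesgue (?T z) = measure lborel (convex hull {a, b, z})"
      by (simp add: measure_completion compact_imp_closed finite_imp_compact_convex_hull)
    also have "\<dots> = \<bar>cross2 ?d (z - a)\<bar> / 2"
      unfolding content_triangle cross2_def by (simp add: algebra_simps abs_minus_commute)
    finally show ?thesis .
  qed
  have compact: "compact (?T z)" for z by (intro finite_imp_compact_convex_hull) simp
  have "frontier (?T x \<union> ?T y) \<subseteq> frontier (?T x) \<union> frontier (?T y)" by (rule frontier_Un_subset)
  then have "negligible (frontier (?T x \<union> ?T y))"
    by (rule negligible_subset[rotated]) (intro negligible_Un negligible_convex_frontier convex_convex_hull)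
  then have "measure lebesgue (interior (?T x \<union> ?T y)) = measure lebesgue (?T x \<union> ?T y)"
    using compact by (intro measure_interior bounded_Un[THEN iffD2]) (auto simp: compact_imp_bounded)
  also have "\<dots> = measure lebesgue (?T x) + measure lebesgue (?T y) - measure lebesgue (?T x \<inter> ?T y)"
    by (intro measure_Un3 lmeasurable_compact compact)
  also have "measure lebesgue (?T x \<inter> ?T y) = 0"
  proof -
    have le: "?T z \<subseteq> {w. n \<bullet> w \<le> n \<bullet> a}" if "cross2 ?d (z - a) \<le> 0" for z
    proof (rule hull_minimal)
      have "n \<bullet> b = n \<bullet> a" using cr[of ?d] by (simp add: inner_diff_right)
      then show "{z, a, b} \<subseteq> {w. n \<bullet> w \<le> n \<bullet> a}" using that unfolding cr by (auto simp: inner_diff_right)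
    qed (rule convex_halfspace_le)
    have ge: "?T z \<subseteq> {w. n \<bullet> w \<ge> n \<bullet> a}" if "cross2 ?d (z - a) \<ge> 0" for z
    proof (rule hull_minimal)
      have "n \<bullet> b = n \<bullet> a" using cr[of ?d] by (simp add: inner_diff_right)
      then show "{z, a, b} \<subseteq> {w. n \<bullet> w \<ge> n \<bullet> a}" using that unfolding cr by (auto simp: inner_diff_right)
    qed (rule convex_halfspace_ge)
    have "?T x \<inter> ?T y \<subseteq> {w. n \<bullet> w = n \<bullet> a}"
    proof (cases "cross2 ?d (x - a) \<le> 0 \<and> 0 \<le> cross2 ?d (y - a)")
      case True
      then show ?thesis using le[of x] ge[of y] by fastforce
    next
      case False
      then have "cross2 ?d (y - a) \<le> 0 \<and> 0 \<le> cross2 ?d (x - a)" using opp by (auto simp only: mult_le_0_iff)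
      then show ?thesis using le[of y] ge[of x] by fastforce
    qed
    then have "negligible (?T x \<inter> ?T y)" using negligible_hyperplane[of n "n \<bullet> a"] n0 negligible_subset by blast
    then show ?thesis by (rule negligible_imp_measure0)
  qed
  also have "measure lebesgue (?T x) + measure lebesgue (?T y) - 0 = (\<bar>cross2 ?d (x - a)\<bar> + \<bar>cross2 ?d (y - a)\<bar>) / 2"
    unfolding area by simp
  also have "\<bar>cross2 ?d (x - a)\<bar> + \<bar>cross2 ?d (y - a)\<bar> = \<bar>cross2 ?d (y - a) - cross2 ?d (x - a)\<bar>"
    using opp by (auto simp only: mult_le_0_iff abs_if split: if_splits)
  also have "cross2 ?d (y - a) - cross2 ?d (x - a) = - cross2 (y - x) ?d"
    by (simp add: cross2_def algebra_simps)
  finally show ?thesis by simp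
qed

text \<open>Suppose that the center is strictly on the outer side. Points \<open>z\<close> of \<open>K\<close> just inside the
edge near its midpoint are joined to the center within \<open>K\<close>, and the joining segment crosses the line of
the edge close to the midpoint, hence on the edge, which is disjoint from \<open>K\<close>. The inequality is
not strict, as an edge may point towards the center.\<close>

lemma star_center_inner_side:
  assumes star: "star_shaped_wrt K c" and edge: "open_segment a b \<inter> K = {}" and ab: "a \<noteq> b"
    and n: "norm n = 1" "n \<bullet> (b - a) = 0"
    and side: "\<forall>\<^sub>F t in at_right 0. midpoint a b - t *\<^sub>R n \<in> K"
  shows "(c - a) \<bullet> n \<le> 0"
proof (rule ccontr)
  assume "\<not> (c - a) \<bullet> n \<le> 0"
  define y where "y = midpoint a b"
  have "y - a = (1 / 2) *\<^sub>R (b - a)" by (simp add: y_def midpoint_def plane_eq_iff field_simps)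
  then have "(y - a) \<bullet> n = 0" using n by (simp add: inner_commute)
  moreover define h where "h = (c - y) \<bullet> n"
  ultimately have h: "0 < h" using \<open>\<not> (c - a) \<bullet> n \<le> 0\<close> by (simp add: inner_diff_left)
  obtain \<beta> where \<beta>: "0 < \<beta>" "\<And>t. 0 < t \<Longrightarrow> t < \<beta> \<Longrightarrow> y - t *\<^sub>R n \<in> K"
    using side unfolding eventually_at_right_field y_def by blast
  \<comment> \<open>the crossing point \<open>w\<close> has distance less than \<open>t * M\<close> from the midpoint \<open>y\<close>\<close>
  define M where "M = 1 + (norm (c - y) + 1) / h"
  have M: "0 < M" unfolding M_def using h by (simp add: add_pos_nonneg)
  define \<delta> where "\<delta> = norm (b - a) / 2"
  have \<delta>: "0 < \<delta>" using ab by (simp add: \<delta>_def)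
  define t where "t = min (\<beta> / 2) (min 1 (\<delta> / (2 * M)))"
  have t: "0 < t" "t < \<beta>" "t \<le> 1" "t \<le> \<delta> / (2 * M)" unfolding t_def using \<beta> \<delta> M by auto
  define z where "z = y - t *\<^sub>R n"
  have zK: "z \<in> K" unfolding z_def using \<beta> t by simp
  \<comment> \<open>the parameter at which the segment from \<open>z\<close>, at height \<open>- t\<close>, to the center, at height \<open>h\<close>, has height 0\<close>
  define \<nu> where "\<nu> = t / (t + h)"
  have \<nu>: "0 \<le> \<nu>" "\<nu> \<le> 1" "\<nu> \<le> t / h" unfolding \<nu>_def using t h by (auto simp: field_simps)
  define w where "w = (1 - \<nu>) *\<^sub>R z + \<nu> *\<^sub>R c"
  have "w \<in> closed_segment z c" unfolding w_def in_segment using \<nu> by blast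
  then have wK: "w \<in> K" using star zK unfolding star_shaped_wrt_def by (metis closed_segment_commute subsetD)
  have wy: "w - y = \<nu> *\<^sub>R (c - y) - ((1 - \<nu>) * t) *\<^sub>R n"
    unfolding w_def z_def by (simp add: algebra_simps)
  have nn: "n \<bullet> n = 1" using n by (simp add: dot_square_norm)
  have "(w - y) \<bullet> n = \<nu> * h - (1 - \<nu>) * t"
    unfolding wy h_def using nn by (simp add: inner_diff_left)
  also have "\<dots> = 0" unfolding \<nu>_def using t h by (simp add: field_simps)
  finally have wn: "n \<bullet> (w - y) = 0" by (simp add: inner_commute)
  have "norm (w - y) \<le> norm (\<nu> *\<^sub>R (c - y)) + norm (((1 - \<nu>) * t) *\<^sub>R n)"
    unfolding wy by (rule norm_triangle_ineq4)
  also have "\<dots> = \<nu> * norm (c - y) + (1 - \<nu>) * t" using \<nu> t n by simp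
  also have "\<dots> \<le> (t / h) * norm (c - y) + 1 * t"
    using \<nu> t by (intro add_mono mult_right_mono) auto
  also have "\<dots> < t * M" unfolding M_def using t h by (simp add: field_simps)
  also have "\<dots> \<le> \<delta> / (2 * M) * M" using t M by (intro mult_right_mono) auto
  also have "\<dots> = \<delta> / 2" using M by simp
  finally have small: "norm (w - y) < \<delta>" using \<delta> by simp
  have ba: "b - a \<noteq> 0" using ab by simp
  have "cross2 (b - a) (w - y) = 0"
  proof -
    have "cross2 n (b - a) * cross2 n (b - a) = (n \<bullet> n) * ((b - a) \<bullet> (b - a)) - 0"
      unfolding Binet_Cauchy_cross2 using n by (simp add: inner_commute)
    then have "cross2 n (b - a) \<noteq> 0" using ba unfolding nn by auto
    moreover have "cross2 n (b - a) * cross2 (b - a) (w - y) = 0"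
      unfolding Binet_Cauchy_cross2 using n wn by simp
    ultimately show ?thesis by (metis mult_eq_0_iff)
  qed
  then obtain \<gamma> where \<gamma>: "w - y = \<gamma> *\<^sub>R (b - a)" using ba by (rule cross2_eq_0_D)
  have "\<bar>\<gamma>\<bar> * norm (b - a) < 1 / 2 * norm (b - a)" using small unfolding \<gamma> \<delta>_def by simp
  then have "\<bar>\<gamma>\<bar> < 1 / 2" using ba by (simp only: mult_less_cancel_right) simp
  then have g: "0 < 1 / 2 + \<gamma>" "1 / 2 + \<gamma> < 1" by auto
  have "y = (1 / 2) *\<^sub>R a + (1 / 2) *\<^sub>R b" by (simp add: y_def midpoint_def scaleR_add_right)
  then have "w = (1 - (1 / 2 + \<gamma>)) *\<^sub>R a + (1 / 2 + \<gamma>) *\<^sub>R b"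
    using \<gamma> by (simp add: algebra_simps)
  then have "w \<in> open_segment a b" unfolding in_segment using ab g by blast
  then show False using wK edge by blast
qed

section \<open>The two partitions of a mesh\<close>

lemma measure_ae_partition:
  assumes part: "ae_partition \<Omega> I S" and bd: "bounded \<Omega>" and op: "open \<Omega>" "\<And>i. i \<in> I \<Longrightarrow> open (S i)"
  shows "(\<Sum>i\<in>I. measure lebesgue (S i)) = measure lebesgue \<Omega>"
proof -
  have P: "finite I" "\<And>i. i \<in> I \<Longrightarrow> S i \<subseteq> \<Omega>" "disjoint_family_on S I" "negligible (\<Omega> - (\<Union>i\<in>I. S i))"
    using part by (auto simp: ae_partition_def)
  have lm: "S i \<in> lmeasurable" if "i \<in> I" for i
    using bounded_subset[OF bd P(2)[OF that]] op(2)[OF that] by (rule lmeasurable_open)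
  have "(\<Sum>i\<in>I. measure lebesgue (S i)) = measure lebesgue (\<Union>i\<in>I. S i)"
  proof (intro measure_finite_Union[symmetric] P)
    show "S ` I \<subseteq> sets lebesgue" using lm by blast
    show "emeasure lebesgue (S i) \<noteq> \<infinity>" if "i \<in> I" for i
      using fmeasurableD2[OF lm[OF that]] unfolding infinity_ennreal_def .
  qed
  also have "\<dots> = measure lebesgue \<Omega>"
  proof (rule measure_negligible_symdiff)
    show "\<Omega> \<in> lmeasurable" using bd op by (intro lmeasurable_open)
    have "(\<Union>i\<in>I. S i) - \<Omega> = {}" using P(2) by blast
    then show "negligible (\<Omega> - (\<Union>i\<in>I. S i) \<union> ((\<Union>i\<in>I. S i) - \<Omega>))" using P(4) by simp
  qed
  finally show ?thesis .
qed

locale regular_ddfv_mesh =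
  fixes \<Omega> :: "plane set" and T :: ddfv_mesh and \<alpha> \<zeta> :: real
  assumes bounded_\<Omega>: "bounded \<Omega>" and lipschitz: "lipschitz_domain \<Omega>"
    and mesh: "is_ddfv_mesh \<Omega> T" and R1: "regular_R1 T \<alpha>" and R2: "regular_R2 T \<zeta>"
begin

lemma open_\<Omega>: "open \<Omega>" and \<Omega>_nonempty: "\<Omega> \<noteq> {}"
  using lipschitz by (auto simp: lipschitz_domain_def)

lemma cells_partition: "ae_partition \<Omega> (cells T) (\<lambda>K. K)"
  and mesh_cells: "\<forall>K\<in>cells T. open_polygon K \<and> star_shaped_wrt K (center T K) \<and>
        frontier K = (\<Union>D\<in>diamonds_of_cell T K. edge D)"
  and mesh_diamonds: "\<forall>D\<in>diamonds T. vertK D \<noteq> vertL D \<and> volK D \<in> cells T \<and>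
        (volL D \<in> cells T \<and> volL D \<noteq> volK D \<or>
         volL D = edge D \<and> edge D \<subseteq> frontier \<Omega> \<and> center T (volL D) \<in> edge D)"
  and mesh_vertices: "\<forall>v\<in>vertices T. polygonal_curve (dual_boundary T v) \<and>
        star_shaped_wrt (closure (dual_cell T v)) v \<and> (v \<in> \<Omega> \<longrightarrow> v \<in> dual_cell T v)"
  and dual_partition: "ae_partition \<Omega> (vertices T) (dual_cell T)"
  and diamond_partition: "ae_partition \<Omega> (diamonds T) (diamond_region T)"
  by (insert mesh[unfolded is_ddfv_mesh_def], (elim conjE, assumption)+)

lemma frontier_\<Omega>: "x \<in> frontier \<Omega> \<Longrightarrow> x \<notin> \<Omega>"
  using open_\<Omega> by (auto simp: frontier_def interior_open)

lemma cell_curve: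
  assumes "K \<in> cells T"
  obtains \<Gamma> where "polygonal_curve \<Gamma>" "K = inside \<Gamma>" "frontier K = \<Gamma>" "open K"
proof -
  obtain \<Gamma> where \<Gamma>: "polygonal_curve \<Gamma>" "K = inside \<Gamma>"
    using mesh_cells assms unfolding open_polygon_def by meson
  then obtain g where g: "simple_path g" "pathfinish g = pathstart g" "path_image g = \<Gamma>"
    unfolding polygonal_curve_def by blast
  have "frontier K = \<Gamma>" "open K"
    using Jordan_plane[OF g(1,2)] unfolding g(3) \<Gamma>(2) by blast+
  with \<Gamma> show ?thesis by (rule that)
qed

lemma star_cell: "K \<in> cells T \<Longrightarrow> star_shaped_wrt K (center T K)"
  and frontier_cell: "K \<in> cells T \<Longrightarrow> frontier K = (\<Union>D\<in>diamonds_of_cell T K. edge D)"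
  using mesh_cells by simp_all

lemma cell_subset: "K \<in> cells T \<Longrightarrow> K \<subseteq> \<Omega>"
  using cells_partition by (auto simp: ae_partition_def)

lemma center_in_cell: "K \<in> cells T \<Longrightarrow> center T K \<in> K"
  using star_cell by (auto simp: star_shaped_wrt_def)

lemma cells_disjoint: "K \<in> cells T \<Longrightarrow> L \<in> cells T \<Longrightarrow> x \<in> K \<Longrightarrow> x \<in> L \<Longrightarrow> K = L"
  using cells_partition unfolding ae_partition_def disjoint_family_on_def by blast

lemma dual_curve:
  assumes "v \<in> vertices T"
  shows "polygonal_curve (dual_boundary T v)" "frontier (dual_cell T v) = dual_boundary T v" "open (dual_cell T v)"
proof -
  show \<Gamma>: "polygonal_curve (dual_boundary T v)"
    using mesh_vertices assms by simp
  then obtain g where g: "simple_path g" "pathfinish g = pathstart g" "path_image g = dual_boundary T v"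
    unfolding polygonal_curve_def by blast
  show "frontier (dual_cell T v) = dual_boundary T v" "open (dual_cell T v)"
    using Jordan_plane[OF g(1,2)] unfolding g(3) dual_cell_def by blast+
qed

lemma finite_diamonds: "finite (diamonds T)"
  using diamond_partition by (simp add: ae_partition_def)

lemma diamond_facts:
  assumes "D \<in> diamonds T"
  shows "vertK D \<noteq> vertL D" "volK D \<in> cells T" "vertK D \<in> vertices T" "vertL D \<in> vertices T"
  using mesh_diamonds assms unfolding vertices_def by auto

lemma diamond_cases:
  assumes "D \<in> diamonds T"
  obtains (interior) "volL D \<in> cells T" "volL D \<noteq> volK D"
  | (boundary) "volL D \<notin> cells T" "volL D = edge D" "edge D \<subseteq> frontier \<Omega>" "center T (volL D) \<in> edge D"
proof -
  consider "volL D \<in> cells T" "volL D \<noteq> volK D"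
    | "volL D = edge D" "edge D \<subseteq> frontier \<Omega>" "center T (volL D) \<in> edge D"
    using mesh_diamonds assms by meson
  then show ?thesis
  proof cases
    case 2
    have "volL D \<notin> cells T"
    proof
      assume L: "volL D \<in> cells T"
      then have "center T (volL D) \<in> \<Omega>" using center_in_cell cell_subset by blast
      then show False using 2 frontier_\<Omega> by blast
    qed
    then show ?thesis using boundary 2 by blast
  qed (rule interior)
qed

lemma centers_distinct:
  assumes D: "D \<in> diamonds T"
  shows "center T (volK D) \<noteq> center T (volL D)"
  using D
proof (cases rule: diamond_cases)
  case interior
  then show ?thesis using cells_disjoint center_in_cell diamond_facts(2)[OF D] by metis
next
  case boundary
  then show ?thesis using center_in_cell cell_subset diamond_facts(2)[OF D] frontier_\<Omega> by (metis subsetD)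
qed

lemma edge_subset_frontier:
  assumes "D \<in> diamonds T" "K \<in> cells T" "K = volK D \<or> K = volL D"
  shows "edge D \<subseteq> frontier K"
  unfolding frontier_cell[OF assms(2)] using assms by (auto simp: diamonds_of_cell_def)

lemma dual_edge_subset_frontier:
  assumes "D \<in> diamonds T" "v = vertK D \<or> v = vertL D"
  shows "dual_edge T D \<subseteq> frontier (dual_cell T v)"
proof -
  have "v \<in> vertices T" using assms diamond_facts[OF assms(1)] by auto
  then show ?thesis
    unfolding dual_curve(2)[OF \<open>v \<in> vertices T\<close>] dual_boundary_def using assms by (auto simp: diamonds_of_vertex_def)
qed

text \<open>On the primal mesh only the edges in the interior of \<open>\<Omega>\<close> separate two cells.\<close>

sublocale primal: polygonal_partition \<Omega> "cells T" "\<lambda>K. K" "{D \<in> diamonds T. volL D \<in> cells T}" vertK vertL volK volL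
proof
  show "open \<Omega>" by (rule open_\<Omega>)
  show "finite (cells T)" "disjoint_family_on (\<lambda>K. K) (cells T)" "negligible (\<Omega> - (\<Union>K\<in>cells T. K))"
    using cells_partition by (auto simp: ae_partition_def)
  show "finite {D \<in> diamonds T. volL D \<in> cells T}" using finite_diamonds by simp
  show "K \<subseteq> \<Omega>" if "K \<in> cells T" for K using that by (rule cell_subset)
  show "open K" if "K \<in> cells T" for K using that cell_curve by blast
  fix D assume "D \<in> {D \<in> diamonds T. volL D \<in> cells T}"
  then have D: "D \<in> diamonds T" "volL D \<in> cells T" by auto
  show "volK D \<in> cells T \<and> volL D \<in> cells T \<and> volK D \<noteq> volL D"
    using D(1)
  proof (cases rule: diamond_cases)
    case interior
    then show ?thesis using diamond_facts(2)[OF D(1)] by blast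
  qed (use D in blast)
  show "closed_segment (vertK D) (vertL D) \<subseteq> frontier (volK D) \<inter> frontier (volL D)"
    using edge_subset_frontier[OF D(1) diamond_facts(2)[OF D(1)]] edge_subset_frontier[OF D(1,2)]
    unfolding edge_def by blast
next
  fix K x assume K: "K \<in> cells T" and x: "x \<in> \<Omega>" "x \<in> frontier K"
  obtain D where D: "D \<in> diamonds T" "K = volK D \<or> K = volL D" "x \<in> edge D"
    using x(2) unfolding frontier_cell[OF K] diamonds_of_cell_def by blast
  have "volL D \<in> cells T"
    using D(1)
  proof (cases rule: diamond_cases)
    case boundary
    then show ?thesis using D(3) x(1) frontier_\<Omega> by blast
  qed
  then show "\<exists>D\<in>{D \<in> diamonds T. volL D \<in> cells T}. (K = volK D \<or> K = volL D) \<and> x \<in> closed_segment (vertK D) (vertL D)"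
    using D unfolding edge_def by blast
qed

text \<open>Every dual edge separates two dual cells, also those that end on the boundary of \<open>\<Omega>\<close>. The
remaining sides of a boundary dual cell lie on boundary edges and do not meet \<open>\<Omega>\<close>.\<close>

sublocale dual: polygonal_partition \<Omega> "vertices T" "dual_cell T" "diamonds T"
  "\<lambda>D. center T (volK D)" "\<lambda>D. center T (volL D)" vertK vertL
proof
  show "open \<Omega>" by (rule open_\<Omega>)
  show "finite (vertices T)" "disjoint_family_on (dual_cell T) (vertices T)" "negligible (\<Omega> - (\<Union>v\<in>vertices T. dual_cell T v))"
    using dual_partition by (auto simp: ae_partition_def)
  show "finite (diamonds T)" by (rule finite_diamonds)
  show "dual_cell T v \<subseteq> \<Omega>" if "v \<in> vertices T" for v using that dual_partition by (auto simp: ae_partition_def)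
  show "open (dual_cell T v)" if "v \<in> vertices T" for v using that by (rule dual_curve)
  fix D assume D: "D \<in> diamonds T"
  show "vertK D \<in> vertices T \<and> vertL D \<in> vertices T \<and> vertK D \<noteq> vertL D"
    using diamond_facts[OF D] by blast
  show "closed_segment (center T (volK D)) (center T (volL D)) \<subseteq> frontier (dual_cell T (vertK D)) \<inter> frontier (dual_cell T (vertL D))"
    using dual_edge_subset_frontier[OF D] unfolding dual_edge_def by blast
next
  fix v x assume v: "v \<in> vertices T" and x: "x \<in> \<Omega>" "x \<in> frontier (dual_cell T v)"
  have "x \<notin> closed_segment v (center T (volL D))" if D: "D \<in> diamonds_of_vertex T v" "volL D = edge D" for D
  proof
    assume xs: "x \<in> closed_segment v (center T (volL D))"
    have D': "D \<in> diamonds T" "v = vertK D \<or> v = vertL D" using D by (auto simp: diamonds_of_vertex_def)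
    have b: "edge D \<subseteq> frontier \<Omega>" "center T (volL D) \<in> edge D"
      using D'(1)
    proof (atomize(full), cases rule: diamond_cases)
      case interior
      have "volL D \<subseteq> frontier (volL D)" using edge_subset_frontier[OF D'(1) interior(1)] D(2) by simp
      then have "volL D = {}" using cell_curve[OF interior(1)] frontier_disjoint_eq by (metis inf.absorb_iff2)
      then show "edge D \<subseteq> frontier \<Omega> \<and> center T (volL D) \<in> edge D"
        using center_in_cell[OF interior(1)] by blast
    qed auto
    have "v \<in> edge D" using D'(2) by (auto simp: edge_def)
    then have "closed_segment v (center T (volL D)) \<subseteq> edge D"
      using b(2) unfolding edge_def by (simp add: subset_closed_segment)
    then show False using xs b(1) x(1) frontier_\<Omega> by blast
  qed
  then obtain D where "D \<in> diamonds_of_vertex T v" "x \<in> dual_edge T D"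
    using x(2) unfolding dual_curve(2)[OF v] dual_boundary_def by blast
  then show "\<exists>D\<in>diamonds T. (v = vertK D \<or> v = vertL D) \<and> x \<in> closed_segment (center T (volK D)) (center T (volL D))"
    unfolding diamonds_of_vertex_def dual_edge_def by blast
qed

lemma primal_normal:
  assumes D: "D \<in> diamonds T" and K: "K \<in> cells T" "K = volK D \<or> K = volL D"
  defines "n \<equiv> outer_normal K (vertK D) (vertL D)"
  shows "norm n = 1" "n \<bullet> (vertL D - vertK D) = 0"
    "\<forall>\<^sub>F t in at_right 0. midpoint (vertK D) (vertL D) - t *\<^sub>R n \<in> K"
    "(center T K - vertK D) \<bullet> n \<le> 0"
proof -
  obtain \<Gamma> where \<Gamma>: "polygonal_curve \<Gamma>" "K = inside \<Gamma>" "frontier K = \<Gamma>" "open K"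
    using cell_curve[OF K(1)] .
  have seg: "closed_segment (vertK D) (vertL D) \<subseteq> \<Gamma>"
    using edge_subset_frontier[OF D K] \<Gamma>(3) by (simp add: edge_def)
  have ab: "vertK D \<noteq> vertL D" using diamond_facts[OF D] by blast
  note N = outer_normal_polygon[OF \<Gamma>(1) seg ab, folded \<Gamma>(2), folded n_def]
  show n: "norm n = 1" "n \<bullet> (vertL D - vertK D) = 0" using N by auto
  have "midpoint (vertK D) (vertL D) \<in> open_segment (vertK D) (vertL D)" using ab by simp
  from N(3)[OF this] show ev: "\<forall>\<^sub>F t in at_right 0. midpoint (vertK D) (vertL D) - t *\<^sub>R n \<in> K"
    by (rule eventually_mono) blast
  have "open_segment (vertK D) (vertL D) \<inter> K = {}"
    using seg \<Gamma>(3,4) frontier_disjoint_eq[of K] segment_open_subset_closed[of "vertK D" "vertL D"] by blast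
  then show "(center T K - vertK D) \<bullet> n \<le> 0"
    by (intro star_center_inner_side[OF star_cell[OF K(1)] _ ab n ev])
qed

lemma dual_normal:
  assumes D: "D \<in> diamonds T"
  defines "n \<equiv> outer_normal (dual_cell T (vertK D)) (center T (volK D)) (center T (volL D))"
  shows "norm n = 1" "n \<bullet> (center T (volL D) - center T (volK D)) = 0"
proof -
  have v: "vertK D \<in> vertices T" using diamond_facts[OF D] by blast
  have "closed_segment (center T (volK D)) (center T (volL D)) \<subseteq> dual_boundary T (vertK D)"
    using dual_edge_subset_frontier[OF D, of "vertK D"] dual_curve(2)[OF v] by (simp add: dual_edge_def)
  note N = outer_normal_polygon[OF dual_curve(1)[OF v] this centers_distinct[OF D], folded dual_cell_def, folded n_def]
  show "norm n = 1" "n \<bullet> (center T (volL D) - center T (volK D)) = 0" using N by auto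
qed

text \<open>The outward normals of the two cells at their common edge are opposite, because the
cells are disjoint, and neither center is beyond the edge of its own cell. For a boundary edge
the second center is on the edge.\<close>

lemma centers_on_opposite_sides:
  assumes D: "D \<in> diamonds T"
  defines "f \<equiv> vertL D - vertK D"
  shows "cross2 f (center T (volK D) - vertK D) * cross2 f (center T (volL D) - vertK D) \<le> 0"
proof -
  have K: "volK D \<in> cells T" and ab: "vertK D \<noteq> vertL D" using diamond_facts[OF D] by auto
  have f0: "f \<noteq> 0" using ab by (simp add: f_def)
  define n where "n = outer_normal (volK D) (vertK D) (vertL D)"
  have n: "norm n = 1" "n \<bullet> f = 0" "\<forall>\<^sub>F t in at_right 0. midpoint (vertK D) (vertL D) - t *\<^sub>R n \<in> volK D"
    "(center T (volK D) - vertK D) \<bullet> n \<le> 0"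
    using primal_normal[OF D K] by (auto simp: n_def f_def)
  have L: "0 \<le> (center T (volL D) - vertK D) \<bullet> n"
    using D
  proof (cases rule: diamond_cases)
    case interior
    define n' where "n' = outer_normal (volL D) (vertK D) (vertL D)"
    have n': "norm n' = 1" "n' \<bullet> f = 0" "\<forall>\<^sub>F t in at_right 0. midpoint (vertK D) (vertL D) - t *\<^sub>R n' \<in> volL D"
      "(center T (volL D) - vertK D) \<bullet> n' \<le> 0"
      using primal_normal[OF D interior(1)] by (auto simp: n'_def f_def)
    have "n' \<noteq> n"
    proof
      assume "n' = n"
      with n'(3) have "\<forall>\<^sub>F t in at_right 0. midpoint (vertK D) (vertL D) - t *\<^sub>R n \<in> volL D" by simp
      from eventually_happens[OF eventually_conj[OF n(3) this]]
      obtain t where "midpoint (vertK D) (vertL D) - t *\<^sub>R n \<in> volK D" "midpoint (vertK D) (vertL D) - t *\<^sub>R n \<in> volL D"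
        by auto
      then show False using cells_disjoint[OF K interior(1)] interior(2) by metis
    qed
    then have "n' = - n" using unit_normals_cases[OF n(1) n'(1) n(2) n'(2) f0] by blast
    then show ?thesis using n'(4) by simp
  next
    case boundary
    obtain t where "center T (volL D) = vertK D + t *\<^sub>R f"
      using boundary(4) closed_segment_param unfolding edge_def f_def by metis
    then show ?thesis using n(2) by (simp add: inner_commute)
  qed
  let ?x = "center T (volK D) - vertK D" and ?y = "center T (volL D) - vertK D"
  have nn: "n \<bullet> n = 1" using n(1) by (simp add: dot_square_norm)
  have cross: "cross2 f z * cross2 f n = (f \<bullet> f) * (z \<bullet> n)" for z
    unfolding Binet_Cauchy_cross2 using n(2) by (simp add: inner_commute)
  have "(cross2 f n)\<^sup>2 = f \<bullet> f" using cross[of n] nn by (simp add: power2_eq_square)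
  then have pos: "0 < (cross2 f n)\<^sup>2" using f0 by simp
  have "(cross2 f ?x * cross2 f ?y) * (cross2 f n)\<^sup>2 = (cross2 f ?x * cross2 f n) * (cross2 f ?y * cross2 f n)"
    by (simp only: power2_eq_square mult_ac)
  also have "\<dots> = ((f \<bullet> f) * (f \<bullet> f)) * ((?x \<bullet> n) * (?y \<bullet> n))"
    unfolding cross by (simp only: mult_ac)
  also have "\<dots> \<le> 0"
    using n(4) L by (intro mult_nonneg_nonpos mult_nonpos_nonneg) auto
  finally show ?thesis using pos by (meson mult_pos_pos not_less)
qed

lemma diamond_measure:
  assumes D: "D \<in> diamonds T"
  shows "measure lebesgue (diamond_region T D) = edge_length D * dual_edge_length T D * sin (diamond_angle T D) / 2"
proof -
  let ?e = "center T (volL D) - center T (volK D)" and ?f = "vertL D - vertK D"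
  have ef: "?e \<noteq> 0" "?f \<noteq> 0" using centers_distinct[OF D] diamond_facts[OF D] by auto
  have "measure lebesgue (diamond_region T D) = \<bar>cross2 ?e ?f\<bar> / 2"
    unfolding diamond_region_def
    using centers_on_opposite_sides[OF D] diamond_facts(1)[OF D] by (rule measure_two_triangles)
  also have "\<dots> = norm ?f * norm ?e * sin (diamond_angle T D) / 2"
    unfolding diamond_angle_def sin_line_angle[OF ef] using ef by simp
  finally show ?thesis
    by (simp add: edge_length_def dual_edge_length_def dist_norm norm_minus_commute)
qed

lemma sin_\<alpha>: "0 < sin \<alpha>" "sin \<alpha> \<le> 1"
  using R1 sin_gt_zero[of \<alpha>] pi_gt_zero by (auto simp: regular_R1_def)

lemma sin_diamond_angle:
  assumes D: "D \<in> diamonds T"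
  shows "sin \<alpha> \<le> sin (diamond_angle T D)" "sin (diamond_angle T D) \<le> 1"
proof -
  have "center T (volL D) - center T (volK D) \<noteq> 0" "vertL D - vertK D \<noteq> 0"
    using centers_distinct[OF D] diamond_facts[OF D] by auto
  then have "0 \<le> sin (diamond_angle T D)" unfolding diamond_angle_def by (subst sin_line_angle) auto
  then show "sin \<alpha> \<le> sin (diamond_angle T D)" using R1 D by (auto simp: regular_R1_def)
qed simp

lemma slopes_le_gradient:
  assumes D: "D \<in> diamonds T"
  shows "edge_length D * \<bar>fst u (volL D) - fst u (volK D)\<bar>
      \<le> edge_length D * dual_edge_length T D * norm (discrete_grad T u D)"
    and "dual_edge_length T D * \<bar>snd u (vertL D) - snd u (vertK D)\<bar>
      \<le> edge_length D * dual_edge_length T D * norm (discrete_grad T u D)"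
proof -
  let ?e = "center T (volL D) - center T (volK D)" and ?f = "vertL D - vertK D"
  have ef: "?e \<noteq> 0" "?f \<noteq> 0" using centers_distinct[OF D] diamond_facts[OF D] by auto
  have len: "0 < edge_length D" "0 < dual_edge_length T D"
    using centers_distinct[OF D] diamond_facts[OF D] by (auto simp: edge_length_def dual_edge_length_def)
  have "sin (line_angle ?e ?f) \<noteq> 0"
    using sin_diamond_angle(1)[OF D] sin_\<alpha> by (simp add: diamond_angle_def)
  note slopes = slopes_le_norm_gradient[OF ef this primal_normal(1,2)[OF D diamond_facts(2)[OF D] disjI1[OF refl]] dual_normal[OF D]]
  have "\<bar>(fst u (volL D) - fst u (volK D)) / dual_edge_length T D\<bar> \<le> norm (discrete_grad T u D)"
    "\<bar>(snd u (vertL D) - snd u (vertK D)) / edge_length D\<bar> \<le> norm (discrete_grad T u D)"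
    unfolding discrete_grad_def diamond_angle_def by (rule slopes(1)) (rule slopes(2))
  then have "\<bar>fst u (volL D) - fst u (volK D)\<bar> \<le> dual_edge_length T D * norm (discrete_grad T u D)"
    "\<bar>snd u (vertL D) - snd u (vertK D)\<bar> \<le> edge_length D * norm (discrete_grad T u D)"
    using len by (simp_all add: abs_divide field_simps)
  then show "edge_length D * \<bar>fst u (volL D) - fst u (volK D)\<bar>
      \<le> edge_length D * dual_edge_length T D * norm (discrete_grad T u D)"
    "dual_edge_length T D * \<bar>snd u (vertL D) - snd u (vertK D)\<bar>
      \<le> edge_length D * dual_edge_length T D * norm (discrete_grad T u D)"
    using len by (simp_all add: mult.assoc mult.left_commute[of "edge_length D"])
qed

end

lemma (in polygonal_partition) integral_step_function:
  assumes "bounded \<Omega>"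
  shows "(LINT x:\<Omega>|lebesgue. \<bar>\<Sum>i\<in>I. u i * indicator (S i) x\<bar> powr p) = (\<Sum>i\<in>I. measure lebesgue (S i) * \<bar>u i\<bar> powr p)"
proof -
  have lm: "S i \<in> lmeasurable" if "i \<in> I" for i
    using bounded_subset[OF assms S_subset[OF that]] open_S[OF that] by (rule lmeasurable_open)
  have pointwise: "indicator \<Omega> x *\<^sub>R \<bar>\<Sum>i\<in>I. u i * indicator (S i) x\<bar> powr p = (\<Sum>i\<in>I. \<bar>u i\<bar> powr p * indicator (S i) x)" for x
  proof (cases "x \<in> (\<Union>i\<in>I. S i)")
    case True
    then obtain i where i: "i \<in> I" "x \<in> S i" by blast
    have "x \<in> \<Omega>" using S_subset[OF i(1)] i(2) by blast
    then show ?thesis unfolding sum_indicator_cell[OF i] by simp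
  next
    case False
    then have "indicator (S i) x = (0 :: real)" if "i \<in> I" for i using that by auto
    then show ?thesis by simp
  qed
  have "(LINT x:\<Omega>|lebesgue. \<bar>\<Sum>i\<in>I. u i * indicator (S i) x\<bar> powr p) = (LINT x|lebesgue. (\<Sum>i\<in>I. \<bar>u i\<bar> powr p * indicator (S i) x))"
    unfolding set_lebesgue_integral_def pointwise ..
  also have "\<dots> = (\<Sum>i\<in>I. LINT x|lebesgue. \<bar>u i\<bar> powr p * indicator (S i) x)"
    using lm by (intro Bochner_Integration.integral_sum integrable_mult_right) (auto simp: fmeasurable_def)
  also have "\<dots> = (\<Sum>i\<in>I. measure lebesgue (S i) * \<bar>u i\<bar> powr p)"
    by (simp add: mult.commute)
  finally show ?thesis .
qed

section \<open>Discrete norms as weighted sums of powers\<close>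

context regular_ddfv_mesh
begin

text \<open>The norm with exponent \<open>q\<close> is that of a function on the disjoint union of the cells and the
vertices, with half the area of the cells as weights.\<close>

definition weight :: "plane set + plane \<Rightarrow> real" where
  "weight j = (case j of Inl K \<Rightarrow> measure lebesgue K | Inr v \<Rightarrow> measure lebesgue (dual_cell T v)) / 2"

definition value_at :: "ddfv_unknowns \<Rightarrow> plane set + plane \<Rightarrow> real" where
  "value_at u j = (case j of Inl K \<Rightarrow> \<bar>fst u K\<bar> | Inr v \<Rightarrow> \<bar>snd u v\<bar>)"

definition power_sum :: "ddfv_unknowns \<Rightarrow> real \<Rightarrow> real" where
  "power_sum u q = (\<Sum>j\<in>cells T <+> vertices T. weight j * value_at u j powr q)"

lemma weight_nonneg: "0 \<le> weight j"
  by (simp add: weight_def split: sum.split)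

lemma value_at_nonneg: "0 \<le> value_at u j"
  by (simp add: value_at_def split: sum.split)

lemma finite_unknowns: "finite (cells T <+> vertices T)"
  using primal.finite_I dual.finite_I by simp

lemma power_sum_nonneg: "0 \<le> power_sum u q"
  unfolding power_sum_def by (intro sum_nonneg mult_nonneg_nonneg weight_nonneg) simp

lemma power_sum_split:
  "power_sum u q = 1 / 2 * (\<Sum>K\<in>cells T. measure lebesgue K * \<bar>fst u K\<bar> powr q)
     + 1 / 2 * (\<Sum>v\<in>vertices T. measure lebesgue (dual_cell T v) * \<bar>snd u v\<bar> powr q)"
  unfolding power_sum_def
  by (subst sum.Plus[OF primal.finite_I dual.finite_I]) (simp add: weight_def value_at_def sum_distrib_left)

lemma norm0_power_sum:
  assumes "0 < q"
  shows "norm0 \<Omega> T q u = power_sum u q powr (1 / q)"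
proof -
  have P: "0 \<le> (\<Sum>K\<in>cells T. measure lebesgue K * \<bar>fst u K\<bar> powr q)"
    "0 \<le> (\<Sum>v\<in>vertices T. measure lebesgue (dual_cell T v) * \<bar>snd u v\<bar> powr q)"
    by (auto intro!: sum_nonneg)
  have "Lp_norm \<Omega> q (primal_fun T u) powr q = (\<Sum>K\<in>cells T. measure lebesgue K * \<bar>fst u K\<bar> powr q)"
    unfolding Lp_norm_def primal_fun_def primal.integral_step_function[OF bounded_\<Omega>]
    using P assms by (simp add: powr_powr)
  moreover have "Lp_norm \<Omega> q (dual_fun T u) powr q = (\<Sum>v\<in>vertices T. measure lebesgue (dual_cell T v) * \<bar>snd u v\<bar> powr q)"
    unfolding Lp_norm_def dual_fun_def dual.integral_step_function[OF bounded_\<Omega>]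
    using P assms by (simp add: powr_powr)
  ultimately show ?thesis unfolding norm0_def power_sum_split by simp
qed

lemma power_sum_eq_0_cong:
  assumes "power_sum u q = 0"
  shows "power_sum u q' = 0"
proof -
  have "\<forall>j\<in>cells T <+> vertices T. weight j * value_at u j powr q = 0"
    using assms unfolding power_sum_def
    by (subst (asm) sum_nonneg_eq_0_iff[OF finite_unknowns]) (auto intro!: mult_nonneg_nonneg weight_nonneg)
  then show ?thesis unfolding power_sum_def by (intro sum.neutral) auto
qed

definition diamond_weight :: "diamond \<Rightarrow> real" where
  "diamond_weight D = edge_length D * dual_edge_length T D"

lemma diamond_weight_nonneg: "0 \<le> diamond_weight D"
  by (simp add: diamond_weight_def edge_length_def dual_edge_length_def)

lemma \<zeta>_pos: "0 < \<zeta>"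
  using R2 by (simp add: regular_R2_def)

lemma primal_regularity:
  assumes K: "K \<in> cells T"
  shows "(\<Sum>D\<in>{D \<in> {D \<in> diamonds T. volL D \<in> cells T}. K = volK D \<or> K = volL D}. diamond_weight D) \<le> measure lebesgue K / \<zeta>"
proof -
  have "(\<Sum>D\<in>{D \<in> {D \<in> diamonds T. volL D \<in> cells T}. K = volK D \<or> K = volL D}. diamond_weight D)
      \<le> (\<Sum>D\<in>diamonds_of_cell T K. diamond_weight D)"
    using finite_diamonds diamond_weight_nonneg by (intro sum_mono2) (auto simp: diamonds_of_cell_def)
  also have "\<dots> \<le> measure lebesgue K / \<zeta>" using R2 K by (auto simp: regular_R2_def diamond_weight_def)
  finally show ?thesis .
qed

lemma dual_regularity:
  assumes v: "v \<in> vertices T"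
  shows "(\<Sum>D\<in>{D \<in> diamonds T. v = vertK D \<or> v = vertL D}. diamond_weight D) \<le> measure lebesgue (dual_cell T v) / \<zeta>"
  using R2 v by (auto simp: regular_R2_def diamond_weight_def diamonds_of_vertex_def)

lemma diamond_weight_bounds:
  assumes D: "D \<in> diamonds T"
  shows "2 * measure lebesgue (diamond_region T D) \<le> diamond_weight D"
    "diamond_weight D \<le> 2 / sin \<alpha> * measure lebesgue (diamond_region T D)"
proof -
  have eq: "2 * measure lebesgue (diamond_region T D) = diamond_weight D * sin (diamond_angle T D)"
    unfolding diamond_measure[OF D] diamond_weight_def by simp
  show "2 * measure lebesgue (diamond_region T D) \<le> diamond_weight D"
    unfolding eq using sin_diamond_angle(2)[OF D] diamond_weight_nonneg[of D] by (simp add: mult_left_le)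
  have "diamond_weight D * sin \<alpha> \<le> 2 * measure lebesgue (diamond_region T D)"
    unfolding eq using sin_diamond_angle(1)[OF D] diamond_weight_nonneg[of D] by (rule mult_left_mono)
  then show "diamond_weight D \<le> 2 / sin \<alpha> * measure lebesgue (diamond_region T D)"
    using sin_\<alpha> by (simp add: field_simps)
qed

text \<open>Summing (R2) over all vertices gives at most the area of \<open>\<Omega>\<close> divided by \<open>\<zeta>\<close>, while each diamond
contributes at least twice its own area. As a consequence \<open>mesh_factor\<close> is at least 1, and the
zero order part of the norm can be multiplied by it.\<close>

lemma \<zeta>_le_1: "\<zeta> \<le> 1"
proof -
  have "open (diamond_region T D)" for D by (simp add: diamond_region_def)
  then have "2 * measure lebesgue \<Omega> = 2 * (\<Sum>D\<in>diamonds T. measure lebesgue (diamond_region T D))"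
    using measure_ae_partition[OF diamond_partition bounded_\<Omega> open_\<Omega>] by simp
  also have "\<dots> = (\<Sum>D\<in>diamonds T. 2 * measure lebesgue (diamond_region T D))"
    by (rule sum_distrib_left)
  also have "\<dots> \<le> (\<Sum>D\<in>diamonds T. diamond_weight D)"
    using diamond_weight_bounds(1) by (rule sum_mono)
  also have "\<dots> = (\<Sum>D\<in>diamonds T. diamond_weight D * 1)" by simp
  also have "\<dots> \<le> (\<Sum>v\<in>vertices T. measure lebesgue (dual_cell T v) * 1) / \<zeta>"
    using diamond_weight_nonneg dual_regularity by (intro dual.sum_edges_le_sum_cells[where j = vertK]) auto
  also have "\<dots> = measure lebesgue \<Omega> / \<zeta>"
    using measure_ae_partition[OF dual_partition bounded_\<Omega> open_\<Omega>] dual_curve(3) by simp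
  finally have "2 * \<zeta> * measure lebesgue \<Omega> \<le> 1 * measure lebesgue \<Omega>" using \<zeta>_pos by (simp add: field_simps)
  moreover have "0 < measure lebesgue \<Omega>"
  proof -
    have "\<Omega> \<in> lmeasurable" using bounded_\<Omega> open_\<Omega> by (rule lmeasurable_open)
    then have "measure lebesgue \<Omega> \<noteq> 0"
      using open_not_negligible[OF open_\<Omega> \<Omega>_nonempty] negligible_iff_measure0 by blast
    then show ?thesis using measure_nonneg[of lebesgue \<Omega>] by linarith
  qed
  ultimately have "2 * \<zeta> \<le> 1" by (simp only: mult_le_cancel_right)
  then show ?thesis using \<zeta>_pos by simp
qed

definition mesh_factor :: "real \<Rightarrow> real" where
  "mesh_factor p = 1 / (sin \<alpha> powr (1 / p) * \<zeta> powr (1 - 1 / p))"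

lemma mesh_factor_ge_1: "1 \<le> p \<Longrightarrow> 1 \<le> mesh_factor p"
proof -
  assume p: "1 \<le> p"
  have "sin \<alpha> powr (1 / p) \<le> 1" "\<zeta> powr (1 - 1 / p) \<le> 1"
    using p sin_\<alpha> \<zeta>_pos \<zeta>_le_1 by (auto intro!: powr_le1)
  then have "sin \<alpha> powr (1 / p) * \<zeta> powr (1 - 1 / p) \<le> 1 * 1" by (intro mult_mono) auto
  then show ?thesis unfolding mesh_factor_def using sin_\<alpha> \<zeta>_pos by simp
qed

lemma seminorm1_nonneg: "0 \<le> seminorm1 T p u"
  by (simp add: seminorm1_def)

lemma norm0_nonneg: "0 \<le> norm0 \<Omega> T p u"
  by (simp add: norm0_def)

lemma norm1_nonneg: "0 \<le> norm1 \<Omega> T p u"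
  using seminorm1_nonneg norm0_nonneg by (simp add: norm1_def)

lemma two_powr_le_2: "t \<le> 1 \<Longrightarrow> (2::real) powr t \<le> 2"
  using powr_mono[of t 1 2] by simp

lemma weighted_gradient_le_seminorm:
  assumes p: "1 \<le> p" and E: "E \<subseteq> diamonds T"
  shows "(\<Sum>D\<in>E. diamond_weight D * norm (discrete_grad T u D) powr p) powr (1 / p)
    \<le> 2 / sin \<alpha> powr (1 / p) * seminorm1 T p u"
proof -
  let ?g = "\<lambda>D. norm (discrete_grad T u D) powr p"
  have "(\<Sum>D\<in>E. diamond_weight D * ?g D) \<le> (\<Sum>D\<in>diamonds T. diamond_weight D * ?g D)"
    using finite_diamonds E diamond_weight_nonneg by (intro sum_mono2) auto
  also have "\<dots> \<le> (\<Sum>D\<in>diamonds T. 2 / sin \<alpha> * measure lebesgue (diamond_region T D) * ?g D)"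
    using diamond_weight_bounds(2) by (intro sum_mono mult_right_mono) auto
  also have "\<dots> = 2 / sin \<alpha> * (\<Sum>D\<in>diamonds T. measure lebesgue (diamond_region T D) * ?g D)"
    by (simp add: sum_distrib_left mult.assoc)
  finally have "(\<Sum>D\<in>E. diamond_weight D * ?g D) powr (1 / p)
      \<le> (2 / sin \<alpha> * (\<Sum>D\<in>diamonds T. measure lebesgue (diamond_region T D) * ?g D)) powr (1 / p)"
    using diamond_weight_nonneg p by (intro powr_mono2 sum_nonneg) auto
  also have "\<dots> = 2 powr (1 / p) / sin \<alpha> powr (1 / p) * seminorm1 T p u"
    unfolding seminorm1_def using sin_\<alpha> by (simp add: powr_mult powr_divide sum_nonneg)
  also have "\<dots> \<le> 2 / sin \<alpha> powr (1 / p) * seminorm1 T p u"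
    using two_powr_le_2[of "1 / p"] p seminorm1_nonneg by (intro mult_right_mono divide_right_mono) auto
  finally show ?thesis .
qed

text \<open>Here \<open>Y q\<close> is the \<open>q\<close>-th power of the \<open>L\<^sup>q\<close> norm of either the primal or the dual part of \<open>u\<close>; each
is at most twice \<open>power_sum u q\<close>.\<close>

lemma primal_or_dual_estimate:
  fixes Y :: "real \<Rightarrow> real"
  assumes p: "1 \<le> p" and r: "1 \<le> r" and K: "0 \<le> K"
    and Y: "\<And>t. 0 \<le> Y t" "\<And>t. Y t \<le> 2 * power_sum u t" and E: "E \<subseteq> diamonds T"
    and est: "Y (2 * r) powr (1 / 2) \<le> K * (Y p powr (1 / p) + 2 * r / \<zeta> powr (1 - 1 / p) *
        (\<Sum>D\<in>E. diamond_weight D * norm (discrete_grad T u D) powr p) powr (1 / p)) * Y q powr (1 - 1 / p)"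
  shows "Y (2 * r) powr (1 / 2) \<le> 8 * r * K * (mesh_factor p * norm1 \<Omega> T p u) * power_sum u q powr (1 - 1 / p)"
proof -
  define A where "A = mesh_factor p"
  define \<kappa> where "\<kappa> = 1 - 1 / p"
  have \<kappa>: "0 \<le> \<kappa>" "\<kappa> \<le> 1" using p by (auto simp: \<kappa>_def)
  have A: "1 \<le> A" unfolding A_def using p by (rule mesh_factor_ge_1)
  let ?n = "norm0 \<Omega> T p u" and ?s = "seminorm1 T p u"
  let ?G = "(\<Sum>D\<in>E. diamond_weight D * norm (discrete_grad T u D) powr p) powr (1 / p)"
  have scale: "Y t powr c \<le> 2 * power_sum u t powr c" if c: "0 \<le> c" "c \<le> 1" for t c
  proof -
    have "Y t powr c \<le> (2 * power_sum u t) powr c" using Y c by (intro powr_mono2) auto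
    also have "\<dots> = 2 powr c * power_sum u t powr c" by (simp add: powr_mult power_sum_nonneg)
    also have "\<dots> \<le> 2 * power_sum u t powr c" using two_powr_le_2[OF c(2)] by (intro mult_right_mono) auto
    finally show ?thesis .
  qed
  have "Y p powr (1 / p) \<le> 2 * ?n"
    using scale[of "1 / p" p] p by (simp add: norm0_power_sum)
  also have "\<dots> \<le> 4 * r * A * ?n"
  proof (rule mult_right_mono)
    have "1 * 1 \<le> r * A" using r A by (intro mult_mono) auto
    moreover have "4 * r * A = 4 * (r * A)" by simp
    ultimately show "2 \<le> 4 * r * A" by linarith
  qed (rule norm0_nonneg)
  finally have 1: "Y p powr (1 / p) \<le> 4 * r * A * ?n" .
  have "2 * r / \<zeta> powr \<kappa> * ?G \<le> 2 * r / \<zeta> powr \<kappa> * (2 / sin \<alpha> powr (1 / p) * ?s)"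
    using weighted_gradient_le_seminorm[OF p E] r by (intro mult_left_mono) auto
  also have "\<dots> = 4 * r * A * ?s" unfolding A_def mesh_factor_def \<kappa>_def by (simp add: mult_ac)
  finally have 2: "2 * r / \<zeta> powr \<kappa> * ?G \<le> 4 * r * A * ?s" .
  have "Y (2 * r) powr (1 / 2) \<le> K * (Y p powr (1 / p) + 2 * r / \<zeta> powr \<kappa> * ?G) * Y q powr \<kappa>"
    using est by (simp add: \<kappa>_def)
  also have "\<dots> \<le> K * (4 * r * A * ?n + 4 * r * A * ?s) * (2 * power_sum u q powr \<kappa>)"
  proof (rule mult_mono)
    show "K * (Y p powr (1 / p) + 2 * r / \<zeta> powr \<kappa> * ?G) \<le> K * (4 * r * A * ?n + 4 * r * A * ?s)"
      using K by (intro mult_left_mono add_mono 1 2)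
    show "0 \<le> K * (4 * r * A * ?n + 4 * r * A * ?s)"
      using K r A norm0_nonneg seminorm1_nonneg by (intro mult_nonneg_nonneg add_nonneg_nonneg) auto
  qed (use scale[OF \<kappa>] in auto)
  also have "\<dots> = 8 * r * K * (A * norm1 \<Omega> T p u) * power_sum u q powr \<kappa>"
    by (simp add: norm1_def algebra_simps)
  finally show ?thesis unfolding A_def \<kappa>_def .
qed

lemma power_sum_estimate:
  assumes cov: "cone_cover \<Omega> \<C>" and p: "1 \<le> p" and r: "1 \<le> r" and qp: "q * (p - 1) = p * (r - 1)"
  shows "power_sum u (2 * r) powr (1 / 2)
    \<le> 16 * r * sqrt (cover_const \<C>) * (mesh_factor p * norm1 \<Omega> T p u) * power_sum u q powr (1 - 1 / p)"
proof -
  let ?K = "sqrt (cover_const \<C>)"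
  have K: "0 \<le> ?K" unfolding cover_const_def by (intro real_sqrt_ge_zero sum_nonneg) auto
  define P where "P t = (\<Sum>K\<in>cells T. measure lebesgue K * \<bar>fst u K\<bar> powr t)" for t
  define V where "V t = (\<Sum>v\<in>vertices T. measure lebesgue (dual_cell T v) * \<bar>snd u v\<bar> powr t)" for t
  have nn: "0 \<le> P t" "0 \<le> V t" for t unfolding P_def V_def by (auto intro!: sum_nonneg)
  have split: "power_sum u t = 1 / 2 * P t + 1 / 2 * V t" for t
    unfolding P_def V_def by (rule power_sum_split)
  let ?R = "8 * r * ?K * (mesh_factor p * norm1 \<Omega> T p u) * power_sum u q powr (1 - 1 / p)"
  have "P (2 * r) powr (1 / 2) \<le> ?R"
  proof (rule primal_or_dual_estimate[OF p r K])
    show "P (2 * r) powr (1 / 2) \<le> ?K * (P p powr (1 / p) + 2 * r / \<zeta> powr (1 - 1 / p) *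
        (\<Sum>D\<in>{D \<in> diamonds T. volL D \<in> cells T}. diamond_weight D * norm (discrete_grad T u D) powr p) powr (1 / p)) * P q powr (1 - 1 / p)"
      unfolding P_def
    proof (rule primal.power_estimate[OF bounded_\<Omega> cov p r qp \<zeta>_pos])
      fix D assume "D \<in> {D \<in> diamonds T. volL D \<in> cells T}"
      then show "dist (vertK D) (vertL D) * primal.jump (fst u) D \<le> diamond_weight D * norm (discrete_grad T u D)"
        using slopes_le_gradient(1)[of D u]
        by (simp add: primal.jump_def diamond_weight_def edge_length_def abs_minus_commute)
    qed (use diamond_weight_nonneg primal_regularity in auto)
  qed (use nn split in auto)
  moreover have "V (2 * r) powr (1 / 2) \<le> ?R"
  proof (rule primal_or_dual_estimate[OF p r K])
    show "V (2 * r) powr (1 / 2) \<le> ?K * (V p powr (1 / p) + 2 * r / \<zeta> powr (1 - 1 / p) *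
        (\<Sum>D\<in>diamonds T. diamond_weight D * norm (discrete_grad T u D) powr p) powr (1 / p)) * V q powr (1 - 1 / p)"
      unfolding V_def
    proof (rule dual.power_estimate[OF bounded_\<Omega> cov p r qp \<zeta>_pos])
      fix D assume "D \<in> diamonds T"
      then show "dist (center T (volK D)) (center T (volL D)) * dual.jump (snd u) D \<le> diamond_weight D * norm (discrete_grad T u D)"
        using slopes_le_gradient(2)[of D u]
        by (simp add: dual.jump_def diamond_weight_def dual_edge_length_def abs_minus_commute)
    qed (use diamond_weight_nonneg dual_regularity in auto)
  qed (use nn split in auto)
  moreover have "power_sum u (2 * r) powr (1 / 2) \<le> P (2 * r) powr (1 / 2) + V (2 * r) powr (1 / 2)"
  proof -
    have "power_sum u (2 * r) powr (1 / 2) \<le> (P (2 * r) + V (2 * r)) powr (1 / 2)"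
      using nn[of "2 * r"] power_sum_nonneg split[of "2 * r"] by (intro powr_mono2) auto
    also have "\<dots> \<le> P (2 * r) powr (1 / 2) + V (2 * r) powr (1 / 2)"
      using sqrt_add_le_add_sqrt[of "P (2 * r)" "V (2 * r)"] nn by (simp add: powr_half_sqrt)
    finally show ?thesis .
  qed
  ultimately show ?thesis by (simp add: algebra_simps)
qed

end

section \<open>The discrete Gagliardo-Nirenberg-Sobolev inequality\<close>

theorem theorem9:
  fixes \<Omega> :: "plane set" and p s m \<theta> :: real
  assumes "bounded \<Omega>" and "polygonal_domain \<Omega>" and "lipschitz_domain \<Omega>"
    and "(1 \<le> p \<and> p < 2 \<and> 1 \<le> s \<and> s \<le> m \<and> m \<le> 2 * p / (2 - p)) \<or>
         (2 \<le> p \<and> 1 \<le> s \<and> s \<le> m)"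
    and "\<theta> = (1 / s - 1 / m) / (1 / s + 1 / 2 - 1 / p)"
  shows "\<exists>C>0. \<forall>T \<alpha> \<zeta>. is_ddfv_mesh \<Omega> T \<and> regular_R1 T \<alpha> \<and> regular_R2 T \<zeta> \<longrightarrow>
           (\<forall>u. norm0 \<Omega> T m u
                \<le> C / (sin \<alpha> powr (\<theta> / p) * \<zeta> powr (\<theta> * (p - 1) / p))
                    * norm1 \<Omega> T p u powr \<theta> * norm0 \<Omega> T s u powr (1 - \<theta>))"
proof -
  have p: "1 \<le> p" and s: "1 \<le> s" and sm: "s \<le> m" using assms(4) by auto
  \<comment> \<open>the critical exponent \<open>2 * r = q = 2 * p / (2 - p)\<close> if \<open>p < 2\<close>, a large exponent otherwise\<close>
  obtain r q where rq: "1 \<le> r" "q * (p - 1) = p * (r - 1)" "m \<le> 2 * r" "m \<le> q" "q \<le> 2 * r"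
  proof (cases "p < 2")
    case True
    have r: "2 * (p / (2 - p)) = 2 * p / (2 - p)" by simp
    show ?thesis
    proof (rule that[of "p / (2 - p)" "2 * (p / (2 - p))"])
      show "1 \<le> p / (2 - p)" using True p by (simp add: field_simps)
      show "2 * (p / (2 - p)) * (p - 1) = p * (p / (2 - p) - 1)" using True by (simp add: field_simps)
      show "m \<le> 2 * (p / (2 - p))" "m \<le> 2 * (p / (2 - p))" using assms(4) True unfolding r by auto
    qed simp
  next
    case False
    then have p2: "2 \<le> p" by simp
    have m: "1 \<le> m" using s sm by simp
    show ?thesis
    proof (rule that[of "1 + m" "p * m / (p - 1)"])
      show "p * m / (p - 1) * (p - 1) = p * (1 + m - 1)" using p2 by simp
      show "m \<le> p * m / (p - 1)" using p2 m by (simp add: field_simps)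
      have "p * m \<le> 2 * (p - 1) * m" using p2 m by (intro mult_right_mono) auto
      also have "\<dots> \<le> 2 * (1 + m) * (p - 1)" using p2 by (simp add: algebra_simps)
      finally show "p * m / (p - 1) \<le> 2 * (1 + m)" using p2 by (simp add: field_simps)
    qed (use m in auto)
  qed
  obtain \<C> where cov: "cone_cover \<Omega> \<C>" using lipschitz_cone_cover[OF assms(1,3)] .
  \<comment> \<open>the summand 1 only makes \<open>C\<close> positive\<close>
  define C where "C = 16 * r * sqrt (cover_const \<C>) + 1"
  have K0: "0 \<le> sqrt (cover_const \<C>)" unfolding cover_const_def by (intro real_sqrt_ge_zero sum_nonneg) auto
  have C: "0 < C" "16 * r * sqrt (cover_const \<C>) \<le> C" unfolding C_def using rq(1) K0 by (auto intro!: add_nonneg_pos)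
  show ?thesis
  proof (intro exI[of _ "C powr \<theta>"] conjI allI impI)
    show "0 < C powr \<theta>" using C by simp
    fix T \<alpha> \<zeta> u
    assume T: "is_ddfv_mesh \<Omega> T \<and> regular_R1 T \<alpha> \<and> regular_R2 T \<zeta>"
    interpret regular_ddfv_mesh \<Omega> T \<alpha> \<zeta>
      by unfold_locales (use assms T in auto)
    let ?A = "mesh_factor p" and ?N = "norm1 \<Omega> T p u"
    have A: "?A powr \<theta> = 1 / (sin \<alpha> powr (\<theta> / p) * \<zeta> powr (\<theta> * (p - 1) / p))"
    proof -
      have "(1 - 1 / p) * \<theta> = \<theta> * (p - 1) / p" using p by (simp add: field_simps)
      then show ?thesis
        unfolding mesh_factor_def using sin_\<alpha> \<zeta>_pos
        by (simp add: powr_divide powr_mult powr_powr mult.commute)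
    qed
    have "norm0 \<Omega> T m u \<le> (C * (?A * ?N)) powr \<theta> * norm0 \<Omega> T s u powr (1 - \<theta>)"
    proof (cases "s = m")
      case True
      \<comment> \<open>Here \<open>0 powr 0 = 0\<close> matters: if \<open>?N\<close> vanishes then so does the right-hand side, and \<open>u\<close> vanishes almost everywhere.\<close>
      then have \<theta>0: "\<theta> = 0" using assms(5) by simp
      show ?thesis
      proof (cases "?N = 0")
        case True
        then have "norm0 \<Omega> T p u = 0"
          using norm0_nonneg[of p u] seminorm1_nonneg[of p u] unfolding norm1_def by linarith
        then have "power_sum u p = 0" using p by (simp add: norm0_power_sum)
        then have "power_sum u m = 0" by (rule power_sum_eq_0_cong)
        then show ?thesis using s sm by (simp add: norm0_power_sum)
      next
        case False
        then show ?thesis using \<theta>0 \<open>s = m\<close> C mesh_factor_ge_1[OF p] norm0_nonneg by simp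
      qed
    next
      case False
      then have sm': "s < m" using sm by simp
      have \<delta>: "0 < 1 / s + 1 / 2 - 1 / p"
      proof (cases "p < 2")
        case True
        have "s < 2 * p / (2 - p)" using assms(4) True sm' by auto
        then have "s * (2 - p) < 2 * p" using True by (simp add: field_simps)
        then show ?thesis using p s by (simp add: field_simps)
      next
        case False
        then have "1 / p \<le> 1 / 2" using p by (simp add: field_simps)
        moreover have "0 < 1 / s" using s by simp
        ultimately show ?thesis by linarith
      qed
      have AN: "0 \<le> ?A * ?N" using mesh_factor_ge_1[OF p] norm1_nonneg by (intro mult_nonneg_nonneg) auto
      have "power_sum u (2 * r) powr (1 / 2)
          \<le> 16 * r * sqrt (cover_const \<C>) * (?A * ?N) * power_sum u q powr (1 - 1 / p)"
        by (rule power_sum_estimate[OF cov p rq(1,2)])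
      also have "\<dots> \<le> C * (?A * ?N) * power_sum u q powr (1 - 1 / p)"
        using C(2) AN by (intro mult_right_mono) auto
      finally have "power_sum u m powr (1 / m) \<le> (C * (?A * ?N)) powr \<theta> * (power_sum u s powr (1 / s)) powr (1 - \<theta>)"
        unfolding power_sum_def
        using weight_nonneg value_at_nonneg finite_unknowns p s sm' rq C AN \<delta> assms(5)
        by (intro interpolation_sum[where q = q and r = r and p = p]) auto
      then show ?thesis using s sm by (simp add: norm0_power_sum)
    qed
    also have "(C * (?A * ?N)) powr \<theta> = C powr \<theta> / (sin \<alpha> powr (\<theta> / p) * \<zeta> powr (\<theta> * (p - 1) / p)) * ?N powr \<theta>"
      using A C mesh_factor_ge_1[OF p] norm1_nonneg by (simp add: powr_mult)
    finally show "norm0 \<Omega> T m u \<le> C powr \<theta> / (sin \<alpha> powr (\<theta> / p) * \<zeta> powr (\<theta> * (p - 1) / p))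
        * ?N powr \<theta> * norm0 \<Omega> T s u powr (1 - \<theta>)" .
  qed
qed

end
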